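(* Let $(M,\mathcal L=\tfrac12L,\mathcal F,N)$ be a conic pseudo-Finslerian mechanical system with holonomic constraint $N$, where $L:\mathcal U\to\mathbb R$ is a conic pseudo-Finslerian metric on $M$ and $N$ is a conic pseudo-Finslerian submanifold of $(M,L)$. Then there exists a unique reaction force $\mathcal R:\mathcal U\cap TN\to TM$ satisfying the d'Alembert principle, and the solutions $\gamma:I\to N$ of the generalized Newton equation $D^{\gamma'}_\gamma\gamma'=\mathcal F(\gamma')+\mathcal R(\gamma')$ are exactly the motions of the conic pseudo-Finslerian mechanical system on $N$ with conic pseudo-Finslerian metric $\hat L=L|_{\mathcal U\cap TN}$ (kinetic energy $\tfrac12\hat L$) and external force $\mathcal F_N:\mathcal U\cap TN\to TN$, $\mathcal F_N(v)=P_v(\mathcal F(v))$, where $P_v:T_{\pi(v)}M\to T_{\pi(v)}N$ is the projection of the decomposition $T_{\pi(v)}M=T_{\pi(v)}N\oplus (T_{\pi(v)}N)^\perp_v$.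
   Context: Let $M$ be a smooth manifold, $\pi:TM\to M$ the projection, and $\mathcal U\subset TM\setminus 0$ an open set invariant under positive scalar multiplication. A conic pseudo-Finslerian metric is a smooth function $L:\mathcal U\to\mathbb R$ with $L(\lambda v)=\lambda^2L(v)$ for $\lambda>0$ whose fundamental tensor $g_v(u,w)=\tfrac12\frac{\partial^2}{\partial t\partial s}\big|_{t=s=0}L(v+tu+sw)$, $u,w\in T_{\pi(v)}M$, is nondegenerate for every $v\in\mathcal U$. An anisotropic vector field is a smooth map $X:\mathcal U\to TM$ with $X(v)\in T_{\pi(v)}M$. An anisotropic linear connection is a map $(v,X,Y)\in\mathcal U\times\mathfrak X(M)\times\mathfrak X(M)\mapsto\nabla^v_XY\in T_{\pi(v)}M$, with $v\mapsto \nabla^v_XY$ an anisotropic vector field, such that for each local vector field $V$ with values in $\mathcal U$, $\nabla^V$ is a linear connection on the domain of $V$. The Chern connection of $L$ is the unique anisotropic linear connection that is torsion-free ($\nabla^v_XY-\nabla^v_YX=[X,Y]$) and metric-compatible: $Xg_V(Y,Z)=g_V(\nabla^V_XY,Z)+g_V(Y,\nabla^V_XZ)+2C_V(Y,Z,\nabla^V_XV)$, where $C_v(u_1,u_2,u_3)=\tfrac12\frac{d}{dt}\big|_{t=0}g_{v+tu_1}(u_2,u_3)$. In coordinates put $\nabla^v_{\partial_i}\partial_j=\sum_k\Gamma^k_{ij}(v)\partial_k$. For a smooth curve $\gamma$ with $\gamma'\in\mathcal U$ ($\mathcal U$-admissible) and a vector field $X=\sum_kx_k\,\partial_k\circ\gamma$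 along $\gamma$, $D^{\gamma'}_\gamma X=\sum_k\{x_k'+\sum_{ij}\Gamma^k_{ij}(\gamma')\gamma_i'x_j\}\partial_k$. A conic pseudo-Finslerian mechanical system is a triple $(M,\tfrac12L,\mathcal F)$ with $\mathcal F:\mathcal U\to TM$ an anisotropic vector field; its motions are the $\mathcal U$-admissible smooth curves with $D^{\gamma'}_\gamma\gamma'=\mathcal F(\gamma')$, with $D$ the covariant derivative of $L$. For the system on $N$, $D$ is that of $\hat L$ on $N$. A subspace $E\subset T_pM$ is nondegenerate if $\mathcal U\cap E\ne\emptyset$ and $g_v|_{E\times E}$ is nondegenerate for every $v\in\mathcal U\cap E$; then $T_pM=E\oplus E^\perp_v$ with $E^\perp_v=\{w\in T_pM: g_v(w,u)=0\ \forall u\in E\}$. A submanifold $N$ is a conic pseudo-Finslerian submanifold if $T_pN$ is nondegenerate for every $p\in N$; then $\hat L=L|_{\mathcal U\cap TN}$ is a conic pseudo-Finslerian metric on $N$. A holonomic constraint is a submanifold $N\subset M$ with $\dim N<\dim M$. A reaction force is an anisotropic vector field $\mathcal R:\mathcal U\cap TN\to TM$ along $N$ (smooth, $\pi(\mathcal R(v))=\pi(v)$) such that for each $v\in\mathcal U\cap TN$ there is a solution $\gamma:I\to N$ of $D^{\gamma'}_\gamma\gamma'=\mathcal F(\gamma')+\mathcal R(\gamma')$ with $\gamma'(0)=v$, where $D$ is the covariant derivative of $(M,L)$. It satisfies the d'Alembert principle if $g_v(\mathcal R(v),w)=0$ for all $v\in\mathcal U\cap TN$ and $w\in T_{\pi(v)}N$.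 *)

theory Defs
  imports "HOL-Analysis.Analysis"
begin

section \<open>Smooth maps between Euclidean spaces\<close>

text \<open>Only used for open sets, where a function is of class \<open>C^(k+1)\<close> iff it is
  differentiable and all its directional derivatives are of class \<open>C^k\<close>.\<close>

primrec Ck_on :: "nat \<Rightarrow> 'a::euclidean_space set \<Rightarrow> ('a \<Rightarrow> 'b::euclidean_space) \<Rightarrow> bool" where
  "Ck_on 0 S f \<longleftrightarrow> continuous_on S f"
| "Ck_on (Suc k) S f \<longleftrightarrow> (\<forall>x\<in>S. f differentiable (at x)) \<and>
     (\<forall>h. Ck_on k S (\<lambda>x. frechet_derivative f (at x) h))"

definition smooth_on :: "'a::euclidean_space set \<Rightarrow> ('a \<Rightarrow> 'b::euclidean_space) \<Rightarrow> bool" where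
  "smooth_on S f \<longleftrightarrow> (\<forall>k. Ck_on k S f)"


section \<open>Smooth manifolds\<close>

text \<open>A chart is a coordinate domain together with the coordinate map, whose values outside the
  domain are irrelevant. The smooth structure is given by an arbitrary (not necessarily maximal)
  smooth atlas; the dimension of the manifold is the dimension of the model space \<open>'e\<close>.\<close>

type_synonym ('m, 'e) chart = "'m set \<times> ('m \<Rightarrow> 'e)"

record ('m, 'e) manifold =
  mtop :: "'m topology"
  charts :: "('m, 'e) chart set"

definition points :: "('m, 'e) manifold \<Rightarrow> 'm set" where
  "points M = topspace (mtop M)"

definition charts_at :: "('m, 'e) manifold \<Rightarrow> 'm \<Rightarrow> ('m, 'e) chart set" where
  "charts_at M p = {c \<in> charts M. p \<in> fst c}"

definition chart_inv :: "('m, 'e) chart \<Rightarrow> 'e \<Rightarrow> 'm" where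
  "chart_inv c = inv_into (fst c) (snd c)"

definition smooth_manifold :: "('m, 'e::euclidean_space) manifold \<Rightarrow> bool" where
  "smooth_manifold M \<longleftrightarrow>
     Hausdorff_space (mtop M) \<and> second_countable (mtop M) \<and>
     (\<Union>c\<in>charts M. fst c) = points M \<and>
     (\<forall>c\<in>charts M. openin (mtop M) (fst c) \<and> open (snd c ` fst c) \<and>
        homeomorphic_map (subtopology (mtop M) (fst c)) (top_of_set (snd c ` fst c)) (snd c)) \<and>
     (\<forall>c\<in>charts M. \<forall>d\<in>charts M.
        smooth_on (snd c ` (fst c \<inter> fst d)) (snd d \<circ> chart_inv c))"

definition euclid :: "('e, 'e::euclidean_space) manifold" where
  "euclid = \<lparr> mtop = euclidean, charts = {(UNIV, id)} \<rparr>"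

definition smooth_map_on ::
  "('m, 'e::euclidean_space) manifold \<Rightarrow> ('n, 'f::euclidean_space) manifold \<Rightarrow> 'm set \<Rightarrow> ('m \<Rightarrow> 'n) \<Rightarrow> bool" where
  "smooth_map_on M N S f \<longleftrightarrow> openin (mtop M) S \<and>
     continuous_map (subtopology (mtop M) S) (mtop N) f \<and>
     (\<forall>c\<in>charts M. \<forall>d\<in>charts N.
        smooth_on (snd c ` {p \<in> S \<inter> fst c. f p \<in> fst d}) (snd d \<circ> f \<circ> chart_inv c))"


section \<open>The tangent bundle\<close>

text \<open>A tangent vector at \<open>p\<close> is the point \<open>p\<close> together with the family of its coordinate vectors
  in all charts around \<open>p\<close>, related by the derivatives of the coordinate changes (and \<open>0\<close> for the
  remaining charts). Hence \<open>fst\<close> is the projection \<open>\<pi>\<close>, and \<open>snd v c\<close> is the coordinate vector of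
  \<open>v\<close> in the chart \<open>c\<close>.\<close>

type_synonym ('m, 'e) tvec = "'m \<times> (('m, 'e) chart \<Rightarrow> 'e)"

definition tangent_space :: "('m, 'e::euclidean_space) manifold \<Rightarrow> 'm \<Rightarrow> ('m, 'e) tvec set" where
  "tangent_space M p = {v. fst v = p \<and> p \<in> points M \<and>
     (\<forall>c. c \<notin> charts_at M p \<longrightarrow> snd v c = 0) \<and>
     (\<forall>c\<in>charts_at M p. \<forall>d\<in>charts_at M p.
        snd v d = frechet_derivative (snd d \<circ> chart_inv c) (at (snd c p)) (snd v c))}"

definition tangent_vectors :: "('m, 'e::euclidean_space) manifold \<Rightarrow> ('m, 'e) tvec set" where
  "tangent_vectors M = (\<Union>p\<in>points M. tangent_space M p)"

definition tzero :: "'m \<Rightarrow> ('m, 'e::euclidean_space) tvec" where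
  "tzero p = (p, \<lambda>c. 0)"

definition tadd :: "('m, 'e::euclidean_space) tvec \<Rightarrow> ('m, 'e) tvec \<Rightarrow> ('m, 'e) tvec" where
  "tadd v w = (fst v, \<lambda>c. snd v c + snd w c)"

definition tscale :: "real \<Rightarrow> ('m, 'e::euclidean_space) tvec \<Rightarrow> ('m, 'e) tvec" where
  "tscale a v = (fst v, \<lambda>c. a *\<^sub>R snd v c)"

definition tchart :: "('m, 'e::euclidean_space) manifold \<Rightarrow> ('m, 'e) chart \<Rightarrow> (('m, 'e) tvec, 'e \<times> 'e) chart" where
  "tchart M c = ({v \<in> tangent_vectors M. fst v \<in> fst c}, \<lambda>v. (snd c (fst v), snd v c))"

definition tangent_bundle :: "('m, 'e::euclidean_space) manifold \<Rightarrow> (('m, 'e) tvec, 'e \<times> 'e) manifold" where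
  "tangent_bundle M =
     \<lparr> mtop = topology (\<lambda>W. W \<subseteq> tangent_vectors M \<and>
                (\<forall>c\<in>charts M. open (snd (tchart M c) ` (W \<inter> fst (tchart M c))))),
       charts = tchart M ` charts M \<rparr>"

text \<open>The differential of \<open>f\<close>; by the chain rule it does not depend on the chart chosen at the
  source point.\<close>

definition tmap ::
  "('m, 'e::euclidean_space) manifold \<Rightarrow> ('n, 'f::euclidean_space) manifold \<Rightarrow> ('m \<Rightarrow> 'n) \<Rightarrow>
     ('m, 'e) tvec \<Rightarrow> ('n, 'f) tvec" where
  "tmap M N f v = (let p = fst v; c = (SOME c. c \<in> charts_at M p) in
     (f p, \<lambda>d. if d \<in> charts_at N (f p)
               then frechet_derivative (snd d \<circ> f \<circ> chart_inv c) (at (snd c p)) (snd v c)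
               else 0))"

text \<open>The derivative \<open>v(f)\<close> of a real function in the direction of a tangent vector.\<close>

definition tderiv :: "('m, 'e::euclidean_space) manifold \<Rightarrow> ('m, 'e) tvec \<Rightarrow> ('m \<Rightarrow> real) \<Rightarrow> real" where
  "tderiv M v f = (let c = (SOME c. c \<in> charts_at M (fst v)) in
     frechet_derivative (f \<circ> chart_inv c) (at (snd c (fst v))) (snd v c))"


section \<open>Vector fields and curves\<close>

text \<open>Vector fields on an open set \<open>\<Omega>\<close>; their values outside \<open>\<Omega>\<close> are irrelevant.\<close>

definition vector_fields :: "('m, 'e::euclidean_space) manifold \<Rightarrow> 'm set \<Rightarrow> ('m \<Rightarrow> ('m, 'e) tvec) set" where
  "vector_fields M \<Omega> = {X. smooth_map_on M (tangent_bundle M) \<Omega> X \<and> (\<forall>p\<in>\<Omega>. X p \<in> tangent_space M p)}"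

text \<open>In a chart, \<open>[X,Y]\<^sup>k = \<Sum>\<^sub>i X\<^sup>i \<partial>\<^sub>i Y\<^sup>k - Y\<^sup>i \<partial>\<^sub>i X\<^sup>k\<close>.\<close>

definition lie_bracket ::
  "('m, 'e::euclidean_space) manifold \<Rightarrow> ('m \<Rightarrow> ('m, 'e) tvec) \<Rightarrow> ('m \<Rightarrow> ('m, 'e) tvec) \<Rightarrow> 'm \<Rightarrow> ('m, 'e) tvec" where
  "lie_bracket M X Y p = (p, \<lambda>c. if c \<in> charts_at M p
     then frechet_derivative (\<lambda>x. snd (Y (chart_inv c x)) c) (at (snd c p)) (snd (X p) c)
        - frechet_derivative (\<lambda>x. snd (X (chart_inv c x)) c) (at (snd c p)) (snd (Y p) c)
     else 0)"

definition coord_field ::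
  "('m, 'e::euclidean_space) manifold \<Rightarrow> ('m, 'e) chart \<Rightarrow> 'e \<Rightarrow> 'm \<Rightarrow> ('m, 'e) tvec" where
  "coord_field M c i p = (p, \<lambda>d. if d \<in> charts_at M p
     then frechet_derivative (snd d \<circ> chart_inv c) (at (snd c p)) i else 0)"

definition open_interval :: "real set \<Rightarrow> bool" where
  "open_interval I \<longleftrightarrow> open I \<and> is_interval I \<and> I \<noteq> {}"

definition smooth_curve :: "('m, 'e::euclidean_space) manifold \<Rightarrow> real set \<Rightarrow> (real \<Rightarrow> 'm) \<Rightarrow> bool" where
  "smooth_curve M I \<gamma> \<longleftrightarrow> open_interval I \<and> smooth_map_on euclid M I \<gamma>"

definition velocity :: "('m, 'e::euclidean_space) manifold \<Rightarrow> (real \<Rightarrow> 'm) \<Rightarrow> real \<Rightarrow> ('m, 'e) tvec" where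
  "velocity M \<gamma> t = (\<gamma> t, \<lambda>c. if c \<in> charts_at M (\<gamma> t)
     then vector_derivative (snd c \<circ> \<gamma>) (at t) else 0)"


section \<open>Conic pseudo-Finslerian metrics\<close>

definition conic_domain :: "('m, 'e::euclidean_space) manifold \<Rightarrow> ('m, 'e) tvec set \<Rightarrow> bool" where
  "conic_domain M U \<longleftrightarrow> openin (mtop (tangent_bundle M)) U \<and>
     (\<forall>v\<in>U. v \<noteq> tzero (fst v)) \<and>
     (\<forall>v\<in>U. \<forall>a>0. tscale a v \<in> U)"

definition fund_tensor ::
  "(('m, 'e::euclidean_space) tvec \<Rightarrow> real) \<Rightarrow> ('m, 'e) tvec \<Rightarrow> ('m, 'e) tvec \<Rightarrow> ('m, 'e) tvec \<Rightarrow> real" where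
  "fund_tensor L v u w =
     1/2 * deriv (\<lambda>t. deriv (\<lambda>s. L (tadd (tadd v (tscale t u)) (tscale s w))) 0) 0"

definition cartan_tensor ::
  "(('m, 'e::euclidean_space) tvec \<Rightarrow> real) \<Rightarrow> ('m, 'e) tvec \<Rightarrow> ('m, 'e) tvec \<Rightarrow> ('m, 'e) tvec \<Rightarrow> ('m, 'e) tvec \<Rightarrow> real" where
  "cartan_tensor L v u1 u2 u3 =
     1/2 * deriv (\<lambda>t. fund_tensor L (tadd v (tscale t u1)) u2 u3) 0"

definition nondegenerate_on :: "'v set \<Rightarrow> 'v \<Rightarrow> ('v \<Rightarrow> 'v \<Rightarrow> real) \<Rightarrow> bool" where
  "nondegenerate_on E z b \<longleftrightarrow> (\<forall>u\<in>E. (\<forall>w\<in>E. b u w = 0) \<longrightarrow> u = z)"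

definition conic_pseudo_finsler ::
  "('m, 'e::euclidean_space) manifold \<Rightarrow> ('m, 'e) tvec set \<Rightarrow> (('m, 'e) tvec \<Rightarrow> real) \<Rightarrow> bool" where
  "conic_pseudo_finsler M U L \<longleftrightarrow> conic_domain M U \<and>
     smooth_map_on (tangent_bundle M) euclid U L \<and>
     (\<forall>v\<in>U. \<forall>a>0. L (tscale a v) = a\<^sup>2 * L v) \<and>
     (\<forall>v\<in>U. nondegenerate_on (tangent_space M (fst v)) (tzero (fst v)) (fund_tensor L v))"

definition anisotropic_vector_field ::
  "('m, 'e::euclidean_space) manifold \<Rightarrow> ('m, 'e) tvec set \<Rightarrow> (('m, 'e) tvec \<Rightarrow> ('m, 'e) tvec) \<Rightarrow> bool" where
  "anisotropic_vector_field M U X \<longleftrightarrow>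
     smooth_map_on (tangent_bundle M) (tangent_bundle M) U X \<and>
     (\<forall>v\<in>U. X v \<in> tangent_space M (fst v))"


section \<open>Anisotropic linear connections and the Chern connection\<close>

text \<open>Linear connections are local operators, and the coordinate fields and the field \<open>V\<close> below are
  only locally defined. Therefore connections are applied to vector fields on arbitrary open sets;
  the first clause says that \<open>\<nabla>\<close> only depends on the restrictions of its arguments to \<open>\<Omega>\<close>.\<close>

definition linear_connection ::
  "('m, 'e::euclidean_space) manifold \<Rightarrow> 'm set \<Rightarrow>
     (('m \<Rightarrow> ('m, 'e) tvec) \<Rightarrow> ('m \<Rightarrow> ('m, 'e) tvec) \<Rightarrow> 'm \<Rightarrow> ('m, 'e) tvec) \<Rightarrow> bool" where
  "linear_connection M \<Omega> nab \<longleftrightarrow>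
     (\<forall>X\<in>vector_fields M \<Omega>. \<forall>X'\<in>vector_fields M \<Omega>. \<forall>Y\<in>vector_fields M \<Omega>. \<forall>Y'\<in>vector_fields M \<Omega>.
        (\<forall>q\<in>\<Omega>. X q = X' q \<and> Y q = Y' q) \<longrightarrow> (\<forall>p\<in>\<Omega>. nab X Y p = nab X' Y' p)) \<and>
     (\<forall>X\<in>vector_fields M \<Omega>. \<forall>Y\<in>vector_fields M \<Omega>. nab X Y \<in> vector_fields M \<Omega>) \<and>
     (\<forall>X\<in>vector_fields M \<Omega>. \<forall>X'\<in>vector_fields M \<Omega>. \<forall>Y\<in>vector_fields M \<Omega>. \<forall>p\<in>\<Omega>.
        nab (\<lambda>q. tadd (X q) (X' q)) Y p = tadd (nab X Y p) (nab X' Y p)) \<and>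
     (\<forall>X\<in>vector_fields M \<Omega>. \<forall>Y\<in>vector_fields M \<Omega>. \<forall>Y'\<in>vector_fields M \<Omega>. \<forall>p\<in>\<Omega>.
        nab X (\<lambda>q. tadd (Y q) (Y' q)) p = tadd (nab X Y p) (nab X Y' p)) \<and>
     (\<forall>f X Y. smooth_map_on M euclid \<Omega> f \<and> X \<in> vector_fields M \<Omega> \<and> Y \<in> vector_fields M \<Omega> \<longrightarrow>
        (\<forall>p\<in>\<Omega>. nab (\<lambda>q. tscale (f q) (X q)) Y p = tscale (f p) (nab X Y p) \<and>
           nab X (\<lambda>q. tscale (f q) (Y q)) p =
             tadd (tscale (tderiv M (X p) f) (Y p)) (tscale (f p) (nab X Y p))))"

definition anisotropic_connection ::
  "('m, 'e::euclidean_space) manifold \<Rightarrow> ('m, 'e) tvec set \<Rightarrow>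
     (('m, 'e) tvec \<Rightarrow> ('m \<Rightarrow> ('m, 'e) tvec) \<Rightarrow> ('m \<Rightarrow> ('m, 'e) tvec) \<Rightarrow> ('m, 'e) tvec) \<Rightarrow> bool" where
  "anisotropic_connection M U nab \<longleftrightarrow>
     (\<forall>\<Omega>. \<forall>X\<in>vector_fields M \<Omega>. \<forall>Y\<in>vector_fields M \<Omega>.
        anisotropic_vector_field M {v \<in> U. fst v \<in> \<Omega>} (\<lambda>v. nab v X Y)) \<and>
     (\<forall>\<Omega>. \<forall>V\<in>vector_fields M \<Omega>. V ` \<Omega> \<subseteq> U \<longrightarrow>
        linear_connection M \<Omega> (\<lambda>X Y p. nab (V p) X Y))"

definition chern_connection ::
  "('m, 'e::euclidean_space) manifold \<Rightarrow> ('m, 'e) tvec set \<Rightarrow> (('m, 'e) tvec \<Rightarrow> real) \<Rightarrow>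
     (('m, 'e) tvec \<Rightarrow> ('m \<Rightarrow> ('m, 'e) tvec) \<Rightarrow> ('m \<Rightarrow> ('m, 'e) tvec) \<Rightarrow> ('m, 'e) tvec) \<Rightarrow> bool" where
  "chern_connection M U L nab \<longleftrightarrow> anisotropic_connection M U nab \<and>
     (\<forall>\<Omega>. \<forall>X\<in>vector_fields M \<Omega>. \<forall>Y\<in>vector_fields M \<Omega>. \<forall>v\<in>U. fst v \<in> \<Omega> \<longrightarrow>
        tadd (nab v X Y) (tscale (-1) (nab v Y X)) = lie_bracket M X Y (fst v)) \<and>
     (\<forall>\<Omega>. \<forall>V\<in>vector_fields M \<Omega>. \<forall>X\<in>vector_fields M \<Omega>. \<forall>Y\<in>vector_fields M \<Omega>. \<forall>Z\<in>vector_fields M \<Omega>.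
        V ` \<Omega> \<subseteq> U \<longrightarrow> (\<forall>p\<in>\<Omega>.
          tderiv M (X p) (\<lambda>q. fund_tensor L (V q) (Y q) (Z q)) =
            fund_tensor L (V p) (nab (V p) X Y) (Z p) +
            fund_tensor L (V p) (Y p) (nab (V p) X Z) +
            2 * cartan_tensor L (V p) (Y p) (Z p) (nab (V p) X V)))"

text \<open>The Christoffel symbols \<open>\<Gamma>\<^sup>k\<^sub>i\<^sub>j(v)\<close> in the chart \<open>c\<close>, indexed by the standard basis of the model
  space.\<close>

definition christoffel ::
  "('m, 'e::euclidean_space) manifold \<Rightarrow>
     (('m, 'e) tvec \<Rightarrow> ('m \<Rightarrow> ('m, 'e) tvec) \<Rightarrow> ('m \<Rightarrow> ('m, 'e) tvec) \<Rightarrow> ('m, 'e) tvec) \<Rightarrow>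
     ('m, 'e) chart \<Rightarrow> 'e \<Rightarrow> 'e \<Rightarrow> 'e \<Rightarrow> ('m, 'e) tvec \<Rightarrow> real" where
  "christoffel M nab c k i j v = snd (nab v (coord_field M c i) (coord_field M c j)) c \<bullet> k"

definition cov_deriv ::
  "('m, 'e::euclidean_space) manifold \<Rightarrow>
     (('m, 'e) tvec \<Rightarrow> ('m \<Rightarrow> ('m, 'e) tvec) \<Rightarrow> ('m \<Rightarrow> ('m, 'e) tvec) \<Rightarrow> ('m, 'e) tvec) \<Rightarrow>
     (real \<Rightarrow> 'm) \<Rightarrow> (real \<Rightarrow> ('m, 'e) tvec) \<Rightarrow> real \<Rightarrow> ('m, 'e) tvec" where
  "cov_deriv M nab \<gamma> X t = (\<gamma> t, \<lambda>c. if c \<in> charts_at M (\<gamma> t)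
     then (\<Sum>k\<in>Basis. (deriv (\<lambda>s. snd (X s) c \<bullet> k) t +
             (\<Sum>i\<in>Basis. \<Sum>j\<in>Basis. christoffel M nab c k i j (velocity M \<gamma> t) *
                (snd (velocity M \<gamma> t) c \<bullet> i) * (snd (X t) c \<bullet> j))) *\<^sub>R k)
     else 0)"


section \<open>Mechanical systems\<close>

text \<open>The kinetic energy of the system is \<open>L/2\<close>.\<close>

definition mechanical_system ::
  "('m, 'e::euclidean_space) manifold \<Rightarrow> ('m, 'e) tvec set \<Rightarrow> (('m, 'e) tvec \<Rightarrow> real) \<Rightarrow>
     (('m, 'e) tvec \<Rightarrow> ('m, 'e) tvec) \<Rightarrow> bool" where
  "mechanical_system M U L F \<longleftrightarrow>
     smooth_manifold M \<and> conic_pseudo_finsler M U L \<and> anisotropic_vector_field M U F"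

text \<open>Motions of the system with force \<open>F\<close>, where \<open>nab\<close> is the Chern connection of the metric.\<close>

definition motion ::
  "('m, 'e::euclidean_space) manifold \<Rightarrow> ('m, 'e) tvec set \<Rightarrow>
     (('m, 'e) tvec \<Rightarrow> ('m \<Rightarrow> ('m, 'e) tvec) \<Rightarrow> ('m \<Rightarrow> ('m, 'e) tvec) \<Rightarrow> ('m, 'e) tvec) \<Rightarrow>
     (('m, 'e) tvec \<Rightarrow> ('m, 'e) tvec) \<Rightarrow> real set \<Rightarrow> (real \<Rightarrow> 'm) \<Rightarrow> bool" where
  "motion M U nab F I \<gamma> \<longleftrightarrow> smooth_curve M I \<gamma> \<and>
     (\<forall>t\<in>I. velocity M \<gamma> t \<in> U \<and> cov_deriv M nab \<gamma> (velocity M \<gamma>) t = F (velocity M \<gamma> t))"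


section \<open>Submanifolds\<close>

text \<open>An embedded submanifold: a subset of \<open>M\<close> with the subspace topology, carrying a smooth structure
  for which the inclusion is an immersion.\<close>

definition tincl ::
  "('m, 'e::euclidean_space) manifold \<Rightarrow> ('m, 'f::euclidean_space) manifold \<Rightarrow> ('m, 'f) tvec \<Rightarrow> ('m, 'e) tvec" where
  "tincl M N = tmap N M (\<lambda>p. p)"

definition submanifold ::
  "('m, 'e::euclidean_space) manifold \<Rightarrow> ('m, 'f::euclidean_space) manifold \<Rightarrow> bool" where
  "submanifold M N \<longleftrightarrow> smooth_manifold N \<and> points N \<subseteq> points M \<and>
     mtop N = subtopology (mtop M) (points N) \<and>
     smooth_map_on N M (points N) (\<lambda>p. p) \<and>
     (\<forall>p\<in>points N. inj_on (tincl M N) (tangent_space N p))"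

definition holonomic_constraint ::
  "('m, 'e::euclidean_space) manifold \<Rightarrow> ('m, 'f::euclidean_space) manifold \<Rightarrow> bool" where
  "holonomic_constraint M N \<longleftrightarrow> submanifold M N \<and> DIM('f) < DIM('e)"

text \<open>\<open>T\<^sub>pN\<close> and \<open>TN\<close>, regarded as subsets of \<open>T\<^sub>pM\<close> and \<open>TM\<close>.\<close>

definition sub_tangent_space ::
  "('m, 'e::euclidean_space) manifold \<Rightarrow> ('m, 'f::euclidean_space) manifold \<Rightarrow> 'm \<Rightarrow> ('m, 'e) tvec set" where
  "sub_tangent_space M N p = tincl M N ` tangent_space N p"

definition sub_tangent_vectors ::
  "('m, 'e::euclidean_space) manifold \<Rightarrow> ('m, 'f::euclidean_space) manifold \<Rightarrow> ('m, 'e) tvec set" where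
  "sub_tangent_vectors M N = (\<Union>p\<in>points N. sub_tangent_space M N p)"

definition nondegenerate_subspace ::
  "('m, 'e::euclidean_space) tvec set \<Rightarrow> (('m, 'e) tvec \<Rightarrow> real) \<Rightarrow> ('m, 'e) tvec set \<Rightarrow> bool" where
  "nondegenerate_subspace U L E \<longleftrightarrow> U \<inter> E \<noteq> {} \<and>
     (\<forall>v\<in>U \<inter> E. nondegenerate_on E (tzero (fst v)) (fund_tensor L v))"

definition conic_pseudo_finsler_submanifold ::
  "('m, 'e::euclidean_space) manifold \<Rightarrow> ('m, 'e) tvec set \<Rightarrow> (('m, 'e) tvec \<Rightarrow> real) \<Rightarrow>
     ('m, 'f::euclidean_space) manifold \<Rightarrow> bool" where
  "conic_pseudo_finsler_submanifold M U L N \<longleftrightarrow> submanifold M N \<and>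
     (\<forall>p\<in>points N. nondegenerate_subspace U L (sub_tangent_space M N p))"

text \<open>The orthogonal complement of \<open>E\<close> in \<open>T\<^bsub>\<pi>(v)\<^esub>M\<close> and the projection onto \<open>E\<close> along it.\<close>

definition orth_compl ::
  "('m, 'e::euclidean_space) manifold \<Rightarrow> (('m, 'e) tvec \<Rightarrow> real) \<Rightarrow> ('m, 'e) tvec set \<Rightarrow> ('m, 'e) tvec \<Rightarrow> ('m, 'e) tvec set" where
  "orth_compl M L E v = {w \<in> tangent_space M (fst v). \<forall>u\<in>E. fund_tensor L v w u = 0}"

definition orth_proj ::
  "('m, 'e::euclidean_space) manifold \<Rightarrow> (('m, 'e) tvec \<Rightarrow> real) \<Rightarrow> ('m, 'e) tvec set \<Rightarrow> ('m, 'e) tvec \<Rightarrow>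
     ('m, 'e) tvec \<Rightarrow> ('m, 'e) tvec" where
  "orth_proj M L E v w = (THE u. u \<in> E \<and> (\<exists>z\<in>orth_compl M L E v. w = tadd u z))"

text \<open>\<open>\<U> \<inter> TN\<close>, \<open>L\<close> restricted to it, and \<open>v \<mapsto> P\<^sub>v(F(v))\<close>, as objects on the manifold \<open>N\<close> itself.\<close>

definition induced_domain ::
  "('m, 'e::euclidean_space) manifold \<Rightarrow> ('m, 'f::euclidean_space) manifold \<Rightarrow> ('m, 'e) tvec set \<Rightarrow> ('m, 'f) tvec set" where
  "induced_domain M N U = {v \<in> tangent_vectors N. tincl M N v \<in> U}"

definition induced_metric ::
  "('m, 'e::euclidean_space) manifold \<Rightarrow> ('m, 'f::euclidean_space) manifold \<Rightarrow> (('m, 'e) tvec \<Rightarrow> real) \<Rightarrow> ('m, 'f) tvec \<Rightarrow> real" where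
  "induced_metric M N L v = L (tincl M N v)"

definition induced_force ::
  "('m, 'e::euclidean_space) manifold \<Rightarrow> ('m, 'f::euclidean_space) manifold \<Rightarrow> (('m, 'e) tvec \<Rightarrow> real) \<Rightarrow>
     (('m, 'e) tvec \<Rightarrow> ('m, 'e) tvec) \<Rightarrow> ('m, 'f) tvec \<Rightarrow> ('m, 'f) tvec" where
  "induced_force M N L F v = inv_into (tangent_space N (fst v)) (tincl M N)
     (orth_proj M L (sub_tangent_space M N (fst v)) (tincl M N v) (F (tincl M N v)))"


section \<open>Reaction forces\<close>

text \<open>Solutions \<open>\<gamma> : I \<rightarrow> N\<close> of the generalized Newton equation, \<open>nab\<close> being the Chern connection
  of the ambient system.\<close>

definition newton_solution ::
  "('m, 'e::euclidean_space) manifold \<Rightarrow> ('m, 'e) tvec set \<Rightarrow>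
     (('m, 'e) tvec \<Rightarrow> ('m \<Rightarrow> ('m, 'e) tvec) \<Rightarrow> ('m \<Rightarrow> ('m, 'e) tvec) \<Rightarrow> ('m, 'e) tvec) \<Rightarrow>
     (('m, 'e) tvec \<Rightarrow> ('m, 'e) tvec) \<Rightarrow> ('m, 'f::euclidean_space) manifold \<Rightarrow>
     (('m, 'e) tvec \<Rightarrow> ('m, 'e) tvec) \<Rightarrow> real set \<Rightarrow> (real \<Rightarrow> 'm) \<Rightarrow> bool" where
  "newton_solution M U nab F N R I \<gamma> \<longleftrightarrow> smooth_curve N I \<gamma> \<and>
     (\<forall>t\<in>I. velocity M \<gamma> t \<in> U \<and>
        cov_deriv M nab \<gamma> (velocity M \<gamma>) t = tadd (F (velocity M \<gamma> t)) (R (velocity M \<gamma> t)))"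

definition reaction_force ::
  "('m, 'e::euclidean_space) manifold \<Rightarrow> ('m, 'e) tvec set \<Rightarrow>
     (('m, 'e) tvec \<Rightarrow> ('m \<Rightarrow> ('m, 'e) tvec) \<Rightarrow> ('m \<Rightarrow> ('m, 'e) tvec) \<Rightarrow> ('m, 'e) tvec) \<Rightarrow>
     (('m, 'e) tvec \<Rightarrow> ('m, 'e) tvec) \<Rightarrow> ('m, 'f::euclidean_space) manifold \<Rightarrow>
     (('m, 'e) tvec \<Rightarrow> ('m, 'e) tvec) \<Rightarrow> bool" where
  "reaction_force M U nab F N R \<longleftrightarrow>
     smooth_map_on (tangent_bundle N) (tangent_bundle M) (induced_domain M N U) (R \<circ> tincl M N) \<and>
     (\<forall>v\<in>U \<inter> sub_tangent_vectors M N. R v \<in> tangent_space M (fst v)) \<and>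
     (\<forall>v\<in>U \<inter> sub_tangent_vectors M N. \<exists>I \<gamma>.
        newton_solution M U nab F N R I \<gamma> \<and> 0 \<in> I \<and> velocity M \<gamma> 0 = v)"

definition d_alembert ::
  "('m, 'e::euclidean_space) manifold \<Rightarrow> ('m, 'e) tvec set \<Rightarrow> (('m, 'e) tvec \<Rightarrow> real) \<Rightarrow>
     ('m, 'f::euclidean_space) manifold \<Rightarrow> (('m, 'e) tvec \<Rightarrow> ('m, 'e) tvec) \<Rightarrow> bool" where
  "d_alembert M U L N R \<longleftrightarrow>
     (\<forall>v\<in>U \<inter> sub_tangent_vectors M N. \<forall>w\<in>sub_tangent_space M N (fst v). fund_tensor L v (R v) w = 0)"

end

theory Submission
  imports Defs
begin

text \<open>In a chart with coordinates \<open>(x, y)\<close> on the tangent bundle, torsion-freeness and metric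
  compatibility give \<open>2 g(x'' + \<Gamma>(x', x'), w) = d/dt L_y(w) - L_x(w)\<close>: the covariant
  acceleration of a curve, paired with \<open>w\<close>, is its Euler--Lagrange expression. Only the coordinate
  fields \<open>V = Y = y\<close> and \<open>X, Z \<in> {y, w}\<close> are needed for this, because the Cartan tensor vanishes when
  its first argument is the base vector. The Euler--Lagrange expression is natural under smooth
  maps, so for a curve in \<open>N\<close> and \<open>w\<close> tangent to \<open>N\<close> it is the same whether it is computed from \<open>L\<close>
  or from the restriction of \<open>L\<close> to \<open>TN\<close>. Hence the motions on \<open>N\<close> are exactly the curves in \<open>N\<close> that
  satisfy Newton's equation modulo the orthogonal complement of \<open>TN\<close>, and these are exactly the
  solutions for any reaction force obeying d'Alembert's principle. By nondegeneracy they solve a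
  smooth second-order equation on \<open>N\<close>; so they exist for all initial velocities, and their covariant
  acceleration in \<open>M\<close> is a smooth function of the velocity, which determines the reaction force.\<close>

section \<open>Calculus of smooth maps\<close>

text \<open>The Chern connections are known only through their axioms, so no formula and no
  transformation law for the Christoffel symbols is at hand. Since \<open>cov_deriv\<close> is given
  by a separate formula in each chart, even the fact that it yields a tangent vector needs proof. It
  follows because its pairing with w is the Euler--Lagrange expression, which is natural under
  changes of charts, and because g is nondegenerate. A second principle recurs: the solution of a
  smooth family of injective linear equations is smooth (\<open>linear_equations\<close>). It yields
  smoothness of the induced force, of the acceleration on N and of the reaction force. These objects
  may therefore be introduced by \<open>THE\<close>, by \<open>SOME\<close>, or through an
  arbitrarily chosen motion; their regularity is read off from the equations that they satisfy. The
  choice of the motion is immaterial because motions with a common velocity have the same covariant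
  acceleration there.\<close>

abbreviation Df :: "('a::euclidean_space \<Rightarrow> 'b::euclidean_space) \<Rightarrow> 'a \<Rightarrow> 'a \<Rightarrow> 'b" where
  "Df f x \<equiv> frechet_derivative f (at x)"

lemma frechet_derivative_eqI:
  "(f has_derivative f') (at x) \<Longrightarrow> Df f x = f'"
  by (metis frechet_derivative_at)

text \<open>\<open>frechet_derivative\<close> is a choice among all derivatives at the point, so the
  equality holds even where neither function is differentiable.\<close>

lemma frechet_derivative_cong_open:
  assumes "open S" "x \<in> S" "\<And>y. y \<in> S \<Longrightarrow> f y = g y"
  shows "Df f x = Df g x"
proof -
  have "(f has_derivative D) (at x) \<longleftrightarrow> (g has_derivative D) (at x)" for D
    using assms has_derivative_transform_within_open[of f D x UNIV S g]
      has_derivative_transform_within_open[of g D x UNIV S f] by auto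
  then show ?thesis unfolding frechet_derivative_def by simp
qed

lemma differentiable_cong_open:
  assumes "open S" "x \<in> S" "\<And>y. y \<in> S \<Longrightarrow> f y = g y" "f differentiable (at x)"
  shows "g differentiable (at x)"
  using assms has_derivative_transform_within_open[of f _ x UNIV S g]
  unfolding differentiable_def by auto

section \<open>Functions of class C^k\<close>

lemma Ck_on_cong:
  assumes "open S" "\<And>x. x \<in> S \<Longrightarrow> f x = g x" "Ck_on k S f"
  shows "Ck_on k S g"
  using assms(2,3)
proof (induction k arbitrary: f g)
  case 0 then show ?case using continuous_on_cong by (metis Ck_on.simps(1))
next
  case (Suc k)
  have 1: "\<forall>x\<in>S. g differentiable (at x)"
    using differentiable_cong_open[OF assms(1) _ Suc.prems(1)] Suc.prems(2) by simp
  have 2: "Ck_on k S (\<lambda>x. Df g x h)" for h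
  proof (rule Suc.IH)
    show "Ck_on k S (\<lambda>x. Df f x h)" using Suc.prems by simp
    show "Df f x h = Df g x h" if "x \<in> S" for x
      using frechet_derivative_cong_open[OF assms(1) that] Suc.prems(1) by metis
  qed
  show ?case using 1 2 by simp
qed

lemma Ck_on_subset: "Ck_on k S f \<Longrightarrow> T \<subseteq> S \<Longrightarrow> Ck_on k T f"
  by (induction k arbitrary: f) (auto intro: continuous_on_subset)

lemma Ck_on_SucD: "Ck_on (Suc k) S f \<Longrightarrow> Ck_on k S f"
proof (induction k arbitrary: f)
  case 0 then show ?case
    by (auto intro!: continuous_at_imp_continuous_on differentiable_imp_continuous_within)
next
  case (Suc k)
  from Suc.prems have "\<forall>x\<in>S. f differentiable at x"
    and "\<And>h. Ck_on (Suc k) S (\<lambda>x. Df f x h)"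
    by (auto simp del: Ck_on.simps(2) simp: Ck_on.simps(2)[of "Suc k"])
  with Suc.IH show ?case by (simp del: Ck_on.simps(2) add: Ck_on.simps(2)[of k])
qed

text \<open>\<open>Df f x\<close> does not mention S, so passing from f to its directional
  derivatives keeps the same neighbourhoods T and the induction goes through.\<close>

lemma Ck_on_local:
  assumes "\<And>x. x \<in> S \<Longrightarrow> \<exists>T. open T \<and> x \<in> T \<and> Ck_on k T f"
  shows "Ck_on k S f"
  using assms
proof (induction k arbitrary: f)
  case 0
  show ?case
    unfolding Ck_on.simps
    by (rule continuous_at_imp_continuous_on) (metis 0 Ck_on.simps(1) continuous_on_eq_continuous_at)
next
  case (Suc k)
  have 1: "\<forall>x\<in>S. f differentiable (at x)" using Suc.prems by (metis Ck_on.simps(2))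
  have 2: "Ck_on k S (\<lambda>x. Df f x h)" for h
    by (rule Suc.IH) (metis Suc.prems Ck_on.simps(2))
  show ?case using 1 2 by simp
qed

lemma Ck_on_const: "Ck_on k S (\<lambda>x. c)"
  by (induction k arbitrary: c) auto

lemma Ck_on_linear:
  assumes "bounded_linear f" shows "Ck_on k S f"
proof (cases k)
  case 0 then show ?thesis using assms by (simp add: linear_continuous_on)
next
  case (Suc n)
  have "Df f x = f" for x
    using assms by (intro frechet_derivative_eqI bounded_linear_imp_has_derivative)
  then show ?thesis using Suc assms
    by (auto simp: Ck_on_const bounded_linear_imp_differentiable)
qed

lemma Ck_on_add:
  assumes "open S" "Ck_on k S f" "Ck_on k S g"
  shows "Ck_on k S (\<lambda>x. f x + g x)"
  using assms(2,3)
proof (induction k arbitrary: f g)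
  case 0 then show ?case by (auto intro: continuous_on_add)
next
  case (Suc k)
  have "Ck_on k S (\<lambda>x. Df (\<lambda>x. f x + g x) x h)" for h
  proof (rule Ck_on_cong[OF assms(1)])
    show "Ck_on k S (\<lambda>x. Df f x h + Df g x h)"
      using Suc by simp
    show "Df f x h + Df g x h =
       Df (\<lambda>x. f x + g x) x h" if "x \<in> S" for x
      using Suc.prems that
      by (subst frechet_derivative_eqI[OF has_derivative_add[OF frechet_derivative_works[THEN iffD1] frechet_derivative_works[THEN iffD1]]])
         auto
  qed
  then show ?case using Suc.prems by (simp add: differentiable_add)
qed

text \<open>By the product rule the derivative is a sum of two bilinear terms of the same kind; in
  each of them one factor is undifferentiated and is first lowered to class C^k by
  \<open>Ck_on_SucD\<close>.\<close>

lemma Ck_on_bilinear: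
  assumes "open S" "bounded_bilinear bil" "Ck_on k S f" "Ck_on k S g"
  shows "Ck_on k S (\<lambda>x. bil (f x) (g x))"
  using assms(3,4)
proof (induction k arbitrary: f g)
  case 0 then show ?case using bounded_bilinear.continuous_on[OF assms(2)] by auto
next
  case (Suc k)
  have D: "((\<lambda>x. bil (f x) (g x)) has_derivative (\<lambda>h. bil (f x) (Df g x h) +
        bil (Df f x h) (g x))) (at x)" if "x \<in> S" for x
    using Suc.prems that
    by (intro bounded_bilinear.FDERIV[OF assms(2)]) (auto intro: frechet_derivative_works[THEN iffD1])
  have "Ck_on k S (\<lambda>x. Df (\<lambda>x. bil (f x) (g x)) x h)" for h
  proof (rule Ck_on_cong[OF assms(1)])
    show "Ck_on k S (\<lambda>x. bil (f x) (Df g x h) + bil (Df f x h) (g x))"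
      using Suc.prems Suc.prems[THEN Ck_on_SucD] by (intro Ck_on_add assms Suc.IH) simp_all
    show "bil (f x) (Df g x h) + bil (Df f x h) (g x) =
       Df (\<lambda>x. bil (f x) (g x)) x h" if "x \<in> S" for x
      by (simp add: frechet_derivative_eqI[OF D[OF that]])
  qed
  then show ?case using D unfolding Ck_on.simps differentiable_def by blast
qed

lemma Ck_on_linear_comp:
  assumes "open S" "bounded_linear L" "Ck_on k S f"
  shows "Ck_on k S (\<lambda>x. L (f x))"
  using assms(3)
proof (induction k arbitrary: f)
  case 0 then show ?case using bounded_linear.continuous_on[OF assms(2)] by auto
next
  case (Suc k)
  have D: "((\<lambda>x. L (f x)) has_derivative (\<lambda>h. L (Df f x h))) (at x)" if "x \<in> S" for x
    using Suc.prems that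
    by (intro bounded_linear.has_derivative[OF assms(2)]) (auto intro: frechet_derivative_works[THEN iffD1])
  have "Ck_on k S (\<lambda>x. Df (\<lambda>x. L (f x)) x h)" for h
  proof (rule Ck_on_cong[OF assms(1)])
    show "Ck_on k S (\<lambda>x. L (Df f x h))" using Suc by auto
    show "L (Df f x h) = Df (\<lambda>x. L (f x)) x h" if "x \<in> S" for x
      by (simp add: frechet_derivative_eqI[OF D[OF that]])
  qed
  then show ?case using D unfolding Ck_on.simps differentiable_def by blast
qed

lemma Ck_on_sum:
  assumes "open S" "\<And>i. i \<in> A \<Longrightarrow> Ck_on k S (f i)"
  shows "Ck_on k S (\<lambda>x. \<Sum>i\<in>A. f i x)"
  using assms(2)
  by (induction A rule: infinite_finite_induct) (auto simp: Ck_on_const intro: Ck_on_add[OF assms(1)])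

text \<open>Used to turn a derivative in a variable direction into a finite combination of
  derivatives in fixed directions, the only ones that \<open>Ck_on\<close> speaks of.\<close>

lemma linear_sum_Basis:
  fixes f :: "'a::euclidean_space \<Rightarrow> 'b::real_vector"
  assumes "linear f"
  shows "f v = (\<Sum>b\<in>Basis. (v \<bullet> b) *\<^sub>R f b)"
proof -
  have "f v = f (\<Sum>b\<in>Basis. (v \<bullet> b) *\<^sub>R b)" by (simp add: euclidean_representation)
  also have "\<dots> = (\<Sum>b\<in>Basis. (v \<bullet> b) *\<^sub>R f b)" using assms by (simp add: linear_sum linear_cmul)
  finally show ?thesis .
qed

text \<open>In the chain rule the direction \<open>Df f x h\<close> varies with x. Expanding it in
  the standard basis leaves finitely many products, and the induction hypothesis applies to each map
  \<open>Df g _ b\<close> in place of g.\<close>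

lemma Ck_on_compose:
  fixes f :: "'a::euclidean_space \<Rightarrow> 'b::euclidean_space" and g :: "'b \<Rightarrow> 'c::euclidean_space"
  assumes "open S" "f ` S \<subseteq> T" "Ck_on k S f" "Ck_on k T g"
  shows "Ck_on k S (\<lambda>x. g (f x))"
  using assms(3,4)
proof (induction k arbitrary: g)
  case 0 then show ?case using assms(2) by (auto intro: continuous_on_compose2)
next
  case (Suc k)
  have D: "((\<lambda>x. g (f x)) has_derivative (\<lambda>h. Df g (f x) (Df f x h))) (at x)"
    if "x \<in> S" for x
    using Suc.prems that assms(2)
    by (intro has_derivative_compose[of f _ x UNIV g]) (auto intro!: frechet_derivative_works[THEN iffD1])
  have "Ck_on k S (\<lambda>x. Df (\<lambda>x. g (f x)) x h)" for h
  proof (rule Ck_on_cong[OF assms(1)])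
    have f: "Ck_on k S f" using Suc.prems Ck_on_SucD by blast
    have 1: "Ck_on k S (\<lambda>x. Df g (f x) b)" for b
      using Suc.prems by (intro Suc.IH[OF f]) simp
    have 2: "Ck_on k S (\<lambda>x. Df f x h \<bullet> b)" for b
      using Suc.prems by (intro Ck_on_linear_comp[OF assms(1) bounded_linear_inner_left]) simp
    show "Ck_on k S (\<lambda>x. \<Sum>b\<in>Basis. (Df f x h \<bullet> b) *\<^sub>R Df g (f x) b)"
      by (rule Ck_on_sum[OF assms(1) Ck_on_bilinear[OF assms(1) bounded_bilinear_scaleR 2 1]])
    show "(\<Sum>b\<in>Basis. (Df f x h \<bullet> b) *\<^sub>R Df g (f x) b) =
       Df (\<lambda>x. g (f x)) x h" if "x \<in> S" for x
    proof -
      have "linear (Df g (f x))"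
        using Suc.prems that assms(2) by (intro linear_frechet_derivative) auto
      then show ?thesis
        by (simp add: frechet_derivative_eqI[OF D[OF that]] linear_sum_Basis[symmetric])
    qed
  qed
  then show ?case using D unfolding Ck_on.simps differentiable_def by blast
qed

lemma Ck_on_Pair:
  assumes "open S" "Ck_on k S f" "Ck_on k S g"
  shows "Ck_on k S (\<lambda>x. (f x, g x))"
proof -
  have "Ck_on k S (\<lambda>x. (f x, 0) + (0, g x))"
    by (intro Ck_on_add assms Ck_on_linear_comp[of _ "\<lambda>x. (x, 0)"] Ck_on_linear_comp[of _ "\<lambda>x. (0, x)"]
         bounded_linear_Pair bounded_linear_zero bounded_linear_ident)
  then show ?thesis by simp
qed

section \<open>Closure properties of smooth functions\<close>

lemma smooth_on_cong:
  "open S \<Longrightarrow> (\<And>x. x \<in> S \<Longrightarrow> f x = g x) \<Longrightarrow> smooth_on S f \<Longrightarrow> smooth_on S g"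
  unfolding smooth_on_def using Ck_on_cong by blast

lemma smooth_on_subset: "smooth_on S f \<Longrightarrow> T \<subseteq> S \<Longrightarrow> smooth_on T f"
  unfolding smooth_on_def using Ck_on_subset by blast

lemma smooth_on_local:
  "(\<And>x. x \<in> S \<Longrightarrow> \<exists>T. open T \<and> x \<in> T \<and> smooth_on T f) \<Longrightarrow> smooth_on S f"
  unfolding smooth_on_def by (metis Ck_on_local)

lemma smooth_on_const: "smooth_on S (\<lambda>x. c)"
  unfolding smooth_on_def by (simp add: Ck_on_const)

lemma smooth_on_linear: "bounded_linear f \<Longrightarrow> smooth_on S f"
  unfolding smooth_on_def by (simp add: Ck_on_linear)

lemma smooth_on_id: "smooth_on S (\<lambda>x. x)"
  by (intro smooth_on_linear bounded_linear_ident)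

lemma smooth_on_add:
  "open S \<Longrightarrow> smooth_on S f \<Longrightarrow> smooth_on S g \<Longrightarrow> smooth_on S (\<lambda>x. f x + g x)"
  unfolding smooth_on_def by (simp add: Ck_on_add)

lemma smooth_on_bilinear:
  "open S \<Longrightarrow> bounded_bilinear bil \<Longrightarrow> smooth_on S f \<Longrightarrow> smooth_on S g \<Longrightarrow> smooth_on S (\<lambda>x. bil (f x) (g x))"
  unfolding smooth_on_def by (simp add: Ck_on_bilinear)

lemma smooth_on_linear_comp:
  "open S \<Longrightarrow> bounded_linear L \<Longrightarrow> smooth_on S f \<Longrightarrow> smooth_on S (\<lambda>x. L (f x))"
  unfolding smooth_on_def by (simp add: Ck_on_linear_comp)

lemma smooth_on_minus:
  "open S \<Longrightarrow> smooth_on S f \<Longrightarrow> smooth_on S (\<lambda>x. - f x)"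
  by (rule smooth_on_linear_comp[OF _ bounded_linear_minus[OF bounded_linear_ident]])

lemma smooth_on_diff:
  "open S \<Longrightarrow> smooth_on S f \<Longrightarrow> smooth_on S g \<Longrightarrow> smooth_on S (\<lambda>x. f x - g x)"
  using smooth_on_add[of S f "\<lambda>x. - g x"] smooth_on_minus[of S g] by simp

lemma smooth_on_scaleR:
  "open S \<Longrightarrow> smooth_on S f \<Longrightarrow> smooth_on S g \<Longrightarrow> smooth_on S (\<lambda>x. f x *\<^sub>R g x)"
  by (rule smooth_on_bilinear[OF _ bounded_bilinear_scaleR])

lemma smooth_on_inner:
  "open S \<Longrightarrow> smooth_on S f \<Longrightarrow> smooth_on S g \<Longrightarrow> smooth_on S (\<lambda>x. f x \<bullet> g x)"
  by (rule smooth_on_bilinear[OF _ bounded_bilinear_inner])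

lemma smooth_on_sum:
  "open S \<Longrightarrow> (\<And>i. i \<in> A \<Longrightarrow> smooth_on S (f i)) \<Longrightarrow> smooth_on S (\<lambda>x. \<Sum>i\<in>A. f i x)"
  unfolding smooth_on_def by (simp add: Ck_on_sum)

lemma smooth_on_compose:
  "open S \<Longrightarrow> f ` S \<subseteq> T \<Longrightarrow> smooth_on S f \<Longrightarrow> smooth_on T g \<Longrightarrow> smooth_on S (\<lambda>x. g (f x))"
  unfolding smooth_on_def using Ck_on_compose by blast

lemma smooth_on_Pair:
  "open S \<Longrightarrow> smooth_on S f \<Longrightarrow> smooth_on S g \<Longrightarrow> smooth_on S (\<lambda>x. (f x, g x))"
  unfolding smooth_on_def by (simp add: Ck_on_Pair)

lemma smooth_on_fst: "open S \<Longrightarrow> smooth_on S f \<Longrightarrow> smooth_on S (\<lambda>x. fst (f x))"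
  by (rule smooth_on_linear_comp[OF _ bounded_linear_fst])

lemma smooth_on_snd: "open S \<Longrightarrow> smooth_on S f \<Longrightarrow> smooth_on S (\<lambda>x. snd (f x))"
  by (rule smooth_on_linear_comp[OF _ bounded_linear_snd])

lemma smooth_on_imp_differentiable: "smooth_on S f \<Longrightarrow> x \<in> S \<Longrightarrow> f differentiable (at x)"
  unfolding smooth_on_def by (metis Ck_on.simps(2))

lemma smooth_on_imp_has_derivative:
  "smooth_on S f \<Longrightarrow> x \<in> S \<Longrightarrow> (f has_derivative Df f x) (at x)"
  by (simp add: smooth_on_imp_differentiable frechet_derivative_works[THEN iffD1])

lemma smooth_on_imp_continuous_on: "smooth_on S f \<Longrightarrow> continuous_on S f"
  unfolding smooth_on_def by (metis Ck_on.simps(1))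

lemma continuous_on_open_tendsto_nhds:
  fixes f :: "'a::t2_space \<Rightarrow> 'b::topological_space"
  assumes "continuous_on S f" "open S" "x \<in> S"
  shows "(f \<longlongrightarrow> f x) (nhds x)"
  using assms continuous_on_eq_continuous_at[of S f] tendsto_at_iff_tendsto_nhds[of f x]
  by (simp add: continuous_at)

lemma smooth_on_frechet: "smooth_on S f \<Longrightarrow> smooth_on S (\<lambda>x. Df f x h)"
  unfolding smooth_on_def by (metis Ck_on.simps(2))

lemma smooth_on_linear_frechet: "smooth_on S f \<Longrightarrow> x \<in> S \<Longrightarrow> linear (Df f x)"
  by (simp add: smooth_on_imp_differentiable linear_frechet_derivative)

text \<open>The same basis expansion as for compositions, now with point and direction both moving;
  it is what makes second-order expressions visibly smooth.\<close>

lemma smooth_on_frechet_apply: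
  assumes "open S" "smooth_on T f" "smooth_on S g" "g ` S \<subseteq> T" "smooth_on S h"
  shows "smooth_on S (\<lambda>x. Df f (g x) (h x))"
proof (rule smooth_on_cong[OF assms(1)])
  show "smooth_on S (\<lambda>x. \<Sum>b\<in>Basis. (h x \<bullet> b) *\<^sub>R Df f (g x) b)"
    by (rule smooth_on_sum[OF assms(1)], rule smooth_on_scaleR[OF assms(1)],
        rule smooth_on_inner[OF assms(1,5) smooth_on_const],
        rule smooth_on_compose[OF assms(1,4,3) smooth_on_frechet[OF assms(2)]])
  show "(\<Sum>b\<in>Basis. (h x \<bullet> b) *\<^sub>R Df f (g x) b) = Df f (g x) (h x)"
    if "x \<in> S" for x
    using linear_sum_Basis[OF smooth_on_linear_frechet[OF assms(2)], of "g x" "h x"] that assms(4) by auto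
qed

text \<open>A product rule for evaluating \<open>Df f\<close> at a moving point in a moving
  direction. It is proved for the finite sum over basis directions and then reassembled by
  linearity.\<close>

lemma has_derivative_frechet_apply:
  assumes T: "open T" and f: "smooth_on T f" and x: "g x \<in> T"
    and g: "(g has_derivative g') (at x)" and h: "(h has_derivative h') (at x)"
  shows "((\<lambda>y. Df f (g y) (h y)) has_derivative
    (\<lambda>v. Df (\<lambda>p. Df f p (h x)) (g x) (g' v)
       + Df f (g x) (h' v))) (at x)"
proof -
  let ?D = "\<lambda>p. Df f p"
  let ?D2 = "\<lambda>u. Df (\<lambda>p. ?D p u) (g x)"
  have lin: "?D p u = (\<Sum>b\<in>Basis. (u \<bullet> b) *\<^sub>R ?D p b)" if "p \<in> T" for p u
    by (rule linear_sum_Basis) (rule smooth_on_linear_frechet[OF f that])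
  have d2: "((\<lambda>p. ?D p u) has_derivative ?D2 u) (at (g x))" for u
    by (rule smooth_on_imp_has_derivative[OF smooth_on_frechet[OF f] x])
  have "((\<lambda>p. \<Sum>b\<in>Basis. (u \<bullet> b) *\<^sub>R ?D p b) has_derivative (\<lambda>v. \<Sum>b\<in>Basis. (u \<bullet> b) *\<^sub>R ?D2 b v)) (at (g x))" for u
    by (intro has_derivative_sum has_derivative_scaleR_right d2)
  then have "((\<lambda>p. ?D p u) has_derivative (\<lambda>v. \<Sum>b\<in>Basis. (u \<bullet> b) *\<^sub>R ?D2 b v)) (at (g x))" for u
    by (rule has_derivative_transform_within_open[OF _ T x]) (simp add: lin[symmetric])
  then have lin2: "?D2 u v = (\<Sum>b\<in>Basis. (u \<bullet> b) *\<^sub>R ?D2 b v)" for u v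
    by (rule fun_cong[OF frechet_derivative_eqI])
  have "\<forall>\<^sub>F y in nhds x. g y \<in> T"
    using has_derivative_continuous[OF g] T x
    by (simp add: topological_tendstoD continuous_at tendsto_at_iff_tendsto_nhds)
  then obtain S where S: "open S" "x \<in> S" "\<And>y. y \<in> S \<Longrightarrow> g y \<in> T"
    unfolding eventually_nhds by metis
  have db: "((\<lambda>y. ?D (g y) b) has_derivative (\<lambda>v. ?D2 b (g' v))) (at x)" for b
    by (rule has_derivative_compose[OF g d2])
  have "((\<lambda>y. \<Sum>b\<in>Basis. (h y \<bullet> b) *\<^sub>R ?D (g y) b) has_derivative
      (\<lambda>v. \<Sum>b\<in>Basis. (h x \<bullet> b) *\<^sub>R ?D2 b (g' v) + (h' v \<bullet> b) *\<^sub>R ?D (g x) b)) (at x)"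
    by (intro has_derivative_sum has_derivative_scaleR db has_derivative_inner_left h)
  then have "((\<lambda>y. ?D (g y) (h y)) has_derivative
      (\<lambda>v. \<Sum>b\<in>Basis. (h x \<bullet> b) *\<^sub>R ?D2 b (g' v) + (h' v \<bullet> b) *\<^sub>R ?D (g x) b)) (at x)"
    by (rule has_derivative_transform_within_open[OF _ S(1,2)]) (simp add: lin[OF S(3), symmetric])
  then show ?thesis
    by (simp only: sum.distrib lin2[symmetric] lin[OF x, symmetric])
qed

section \<open>Symmetry of second derivatives\<close>

lemma smooth_on_line_derivative:
  fixes f :: "'a::euclidean_space \<Rightarrow> real"
  assumes "smooth_on S f" "a + t *\<^sub>R w \<in> S"
  shows "((\<lambda>t. f (a + t *\<^sub>R w)) has_field_derivative Df f (a + t *\<^sub>R w) w) (at t)"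
proof -
  have "((\<lambda>t. f (a + t *\<^sub>R w)) has_derivative (\<lambda>h. Df f (a + t *\<^sub>R w) (h *\<^sub>R w))) (at t)"
    by (rule has_derivative_compose[where f = "\<lambda>t. a + t *\<^sub>R w" and g = f,
          OF _ smooth_on_imp_has_derivative[OF assms]])
       (auto intro!: derivative_eq_intros)
  then show ?thesis
    by (simp add: has_field_derivative_def linear_cmul[OF smooth_on_linear_frechet[OF assms]] mult.commute[of _ "frechet_derivative f _ _"])
qed

text \<open>The mean value theorem is applied twice to the second difference over the parallelogram
  with sides s u and s v: along v to the difference of f between two opposite sides, then along u to
  \<open>Df f _ v\<close>.\<close>

lemma second_difference_mean_value:
  fixes f :: "'a::euclidean_space \<Rightarrow> real"
  assumes f: "smooth_on S f" and s: "s > 0"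
    and S: "\<And>\<sigma> \<tau>. 0 \<le> \<sigma> \<Longrightarrow> \<sigma> \<le> s \<Longrightarrow> 0 \<le> \<tau> \<Longrightarrow> \<tau> \<le> s \<Longrightarrow> x + \<sigma> *\<^sub>R u + \<tau> *\<^sub>R v \<in> S"
  shows "\<exists>\<sigma> \<tau>. 0 < \<sigma> \<and> \<sigma> < s \<and> 0 < \<tau> \<and> \<tau> < s \<and>
    f (x + s *\<^sub>R u + s *\<^sub>R v) - f (x + s *\<^sub>R u) - f (x + s *\<^sub>R v) + f x =
    s * s * Df (\<lambda>y. Df f y v) (x + \<sigma> *\<^sub>R u + \<tau> *\<^sub>R v) u"
proof -
  let ?D = "\<lambda>y. Df f y v"
  have 1: "((\<lambda>\<tau>. f ((x + s *\<^sub>R u) + \<tau> *\<^sub>R v) - f (x + \<tau> *\<^sub>R v)) has_field_derivative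
      ?D (x + s *\<^sub>R u + \<tau> *\<^sub>R v) - ?D (x + \<tau> *\<^sub>R v)) (at \<tau>)" if "0 \<le> \<tau>" "\<tau> \<le> s" for \<tau>
    using S[of s \<tau>] S[of 0 \<tau>] that s
    by (intro DERIV_diff smooth_on_line_derivative[OF f]) auto
  obtain \<tau> where \<tau>: "0 < \<tau>" "\<tau> < s" and eq1:
    "f (x + s *\<^sub>R u + s *\<^sub>R v) - f (x + s *\<^sub>R v) - (f (x + s *\<^sub>R u) - f x) =
      s * (?D (x + s *\<^sub>R u + \<tau> *\<^sub>R v) - ?D (x + \<tau> *\<^sub>R v))"
    using MVT2[OF s 1] by auto
  have "((\<lambda>\<sigma>. ?D ((x + \<tau> *\<^sub>R v) + \<sigma> *\<^sub>R u)) has_field_derivative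
      Df ?D (x + \<tau> *\<^sub>R v + \<sigma> *\<^sub>R u) u) (at \<sigma>)" if "0 \<le> \<sigma>" "\<sigma> \<le> s" for \<sigma>
    using S[of \<sigma> \<tau>] that \<tau>
    by (intro smooth_on_line_derivative[OF smooth_on_frechet[OF f]]) (auto simp: algebra_simps)
  from MVT2[OF s this] obtain \<sigma> where "0 < \<sigma>" "\<sigma> < s"
    "?D (x + \<tau> *\<^sub>R v + s *\<^sub>R u) - ?D (x + \<tau> *\<^sub>R v) =
      s * Df ?D (x + \<tau> *\<^sub>R v + \<sigma> *\<^sub>R u) u" by auto
  with \<tau> eq1 show ?thesis
    by (intro exI[of _ \<sigma>] exI[of _ \<tau>]) (simp add: algebra_simps)
qed

text \<open>The second difference is symmetric in u and v. Hence the two mixed derivatives agree at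
  suitable nearby points of the parallelogram, and continuity brings both points back to x.\<close>

lemma symmetric_derivative_real:
  fixes f :: "'a::euclidean_space \<Rightarrow> real"
  assumes S: "open S" and f: "smooth_on S f" and x: "x \<in> S"
  shows "Df (\<lambda>y. Df f y u) x v =
    Df (\<lambda>y. Df f y v) x u"
    (is "?P x = ?Q x")
proof -
  have cont: "(?P \<longlongrightarrow> ?P x) (nhds x)" "(?Q \<longlongrightarrow> ?Q x) (nhds x)"
    by (rule continuous_on_open_tendsto_nhds[OF smooth_on_imp_continuous_on[OF
          smooth_on_frechet[OF smooth_on_frechet[OF f]]] S x])+
  have le: "\<bar>?P x - ?Q x\<bar> \<le> e" if "e > 0" for e
  proof -
    have "\<forall>\<^sub>F y in nhds x. \<bar>?P y - ?P x\<bar> < e/2 \<and> \<bar>?Q y - ?Q x\<bar> < e/2 \<and> y \<in> S"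
      using tendstoD[OF cont(1), of "e/2"] tendstoD[OF cont(2), of "e/2"] that
        eventually_nhds_in_open[OF S x]
      unfolding dist_real_def by (simp only: eventually_conj_iff half_gt_zero simp_thms)
    then obtain d where d: "d > 0" "\<And>y. dist y x < d \<Longrightarrow> \<bar>?P y - ?P x\<bar> < e/2 \<and> \<bar>?Q y - ?Q x\<bar> < e/2 \<and> y \<in> S"
      unfolding eventually_nhds_metric by blast
    \<comment> \<open>The summand 1 keeps the denominator positive when u and v vanish. With this s
      the whole parallelogram lies in the ball of radius d.\<close>
    define s where "s = d / (2 * (norm u + norm v + 1))"
    have pos: "2 * (norm u + norm v + 1) > 0" by (smt (verit) norm_ge_zero)
    have s: "s > 0" using d pos by (simp add: s_def)
    have "s * (norm u + norm v + 1) = d / 2" using pos unfolding s_def by (simp add: field_simps)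
    then have sd: "s * norm u + s * norm v < d" using d s by (simp add: algebra_simps)
    have near: "dist (x + \<sigma> *\<^sub>R a + \<tau> *\<^sub>R b) x < d"
      if "0 \<le> \<sigma>" "\<sigma> \<le> s" "0 \<le> \<tau>" "\<tau> \<le> s" "(a, b) = (u, v) \<or> (a, b) = (v, u)" for \<sigma> \<tau> a b
    proof -
      have "dist (x + \<sigma> *\<^sub>R a + \<tau> *\<^sub>R b) x = norm (\<sigma> *\<^sub>R a + \<tau> *\<^sub>R b)" by (simp add: dist_norm)
      also have "\<dots> \<le> \<sigma> * norm a + \<tau> * norm b"
        using norm_triangle_ineq[of "\<sigma> *\<^sub>R a" "\<tau> *\<^sub>R b"] that by simp
      also have "\<dots> \<le> s * norm a + s * norm b" using that by (intro add_mono mult_right_mono) auto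
      also have "\<dots> < d" using sd that(5) by auto
      finally show ?thesis .
    qed
    obtain \<sigma> \<tau> where A: "0 < \<sigma>" "\<sigma> < s" "0 < \<tau>" "\<tau> < s"
      "f (x + s *\<^sub>R u + s *\<^sub>R v) - f (x + s *\<^sub>R u) - f (x + s *\<^sub>R v) + f x = s * s * ?Q (x + \<sigma> *\<^sub>R u + \<tau> *\<^sub>R v)"
      using second_difference_mean_value[OF f s, of x u v] d near by blast
    obtain \<sigma>' \<tau>' where B: "0 < \<sigma>'" "\<sigma>' < s" "0 < \<tau>'" "\<tau>' < s"
      "f (x + s *\<^sub>R v + s *\<^sub>R u) - f (x + s *\<^sub>R v) - f (x + s *\<^sub>R u) + f x = s * s * ?P (x + \<sigma>' *\<^sub>R v + \<tau>' *\<^sub>R u)"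
      using second_difference_mean_value[OF f s, of x v u] d near by blast
    have "s * s * ?Q (x + \<sigma> *\<^sub>R u + \<tau> *\<^sub>R v) = s * s * ?P (x + \<sigma>' *\<^sub>R v + \<tau>' *\<^sub>R u)"
      using A(5) B(5) by (simp add: algebra_simps)
    then have "?Q (x + \<sigma> *\<^sub>R u + \<tau> *\<^sub>R v) = ?P (x + \<sigma>' *\<^sub>R v + \<tau>' *\<^sub>R u)" using s by simp
    moreover have "\<bar>?Q (x + \<sigma> *\<^sub>R u + \<tau> *\<^sub>R v) - ?Q x\<bar> < e/2" using d(2)[OF near] A by simp
    moreover have "\<bar>?P (x + \<sigma>' *\<^sub>R v + \<tau>' *\<^sub>R u) - ?P x\<bar> < e/2" using d(2)[OF near] B by simp
    ultimately show ?thesis by linarith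
  qed
  have "\<bar>?P x - ?Q x\<bar> \<le> 0"
  proof (rule field_le_epsilon)
    fix e :: real assume "e > 0"
    from le[OF this] show "\<bar>?P x - ?Q x\<bar> \<le> 0 + e" by linarith
  qed
  then show ?thesis by linarith
qed

lemma symmetric_derivative:
  fixes f :: "'a::euclidean_space \<Rightarrow> 'b::euclidean_space"
  assumes S: "open S" and f: "smooth_on S f" and x: "x \<in> S"
  shows "Df (\<lambda>y. Df f y u) x v =
    Df (\<lambda>y. Df f y v) x u"
proof (rule euclidean_eqI)
  fix b :: 'b assume "b \<in> Basis"
  have fb: "smooth_on S (\<lambda>y. f y \<bullet> b)" by (rule smooth_on_inner[OF S f smooth_on_const])
  have 1: "Df (\<lambda>y. g y \<bullet> b) y w = Df g y w \<bullet> b"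
    if "smooth_on S g" "y \<in> S" for g w y
    using frechet_derivative_eqI[OF has_derivative_inner_left[OF smooth_on_imp_has_derivative[OF that]]]
    by metis
  have 2: "Df (\<lambda>y. Df f y u) x v \<bullet> b =
    Df (\<lambda>y. Df (\<lambda>y. f y \<bullet> b) y u) x v" for u v
  proof -
    have "Df (\<lambda>y. Df f y u) x v \<bullet> b =
      Df (\<lambda>y. Df f y u \<bullet> b) x v"
      using 1[OF smooth_on_frechet[OF f] x] by simp
    also have "\<dots> = Df (\<lambda>y. Df (\<lambda>y. f y \<bullet> b) y u) x v"
      by (intro fun_cong[OF frechet_derivative_cong_open[OF S x]]) (simp add: 1[OF f])
    finally show ?thesis .
  qed
  show "Df (\<lambda>y. Df f y u) x v \<bullet> b =
    Df (\<lambda>y. Df f y v) x u \<bullet> b"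
    unfolding 2 by (rule symmetric_derivative_real[OF S fb x])
qed

section \<open>Smooth families of linear equations\<close>

text \<open>The sum over the basis serves as a substitute for the operator norm: it dominates it,
  and it tends to 0 as soon as each \<open>A y b\<close> tends to \<open>A x b\<close>.\<close>

lemma linear_family_operator_bound:
  fixes A :: "'a::euclidean_space \<Rightarrow> 'b::euclidean_space \<Rightarrow> 'c::euclidean_space"
  assumes "linear (A x)" "linear (A y)"
  shows "norm (A x w - A y w) \<le> (\<Sum>b\<in>Basis. norm (A x b - A y b)) * norm w"
proof -
  have "A x w - A y w = (\<Sum>b\<in>Basis. (w \<bullet> b) *\<^sub>R (A x b - A y b))"
    using linear_sum_Basis[OF assms(1), of w] linear_sum_Basis[OF assms(2), of w]
    by (simp add: scaleR_diff_right sum_subtractf)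
  also have "norm \<dots> \<le> (\<Sum>b\<in>Basis. norm ((w \<bullet> b) *\<^sub>R (A x b - A y b)))" by (rule norm_sum)
  also have "\<dots> \<le> (\<Sum>b\<in>Basis. norm w * norm (A x b - A y b))"
    by (intro sum_mono) (auto intro!: mult_right_mono Basis_le_norm)
  finally show ?thesis by (simp add: sum_distrib_left mult.commute)
qed

text \<open>Smooth dependence of an inverse operator on a parameter, phrased through solutions u of
  \<open>A x (u x) = b x\<close>, so that no space of operators has to be handled.\<close>

locale linear_equations =
  fixes S :: "'a::euclidean_space set" and A :: "'a \<Rightarrow> 'b::euclidean_space \<Rightarrow> 'b"
  assumes S: "open S" and smooth: "\<And>u. smooth_on S (\<lambda>x. A x u)"
    and lin: "\<And>x. x \<in> S \<Longrightarrow> linear (A x)"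
    and inj: "\<And>x u. x \<in> S \<Longrightarrow> A x u = 0 \<Longrightarrow> u = 0"
begin

lemma operator_tendsto:
  assumes x: "x \<in> S"
  shows "((\<lambda>y. \<Sum>b\<in>Basis. norm (A y b - A x b)) \<longlongrightarrow> 0) (nhds x)"
proof -
  have "((\<lambda>y. A y b) \<longlongrightarrow> A x b) (nhds x)" for b
    by (rule continuous_on_open_tendsto_nhds[OF smooth_on_imp_continuous_on[OF smooth] S x])
  then show ?thesis by (intro tendsto_null_sum tendsto_norm_zero LIM_zero)
qed

text \<open>An injective linear map is bounded below by some B > 0, and operators within B/2 of it
  are bounded below by B/2. Applied to u y - u x, this bounds the increment of u by the residual of
  the old value u x in the equation at y.\<close>

lemma solution_estimate:
  assumes x: "x \<in> S"
  shows "\<exists>B>0. (\<forall>w. B * norm w \<le> norm (A x w)) \<and>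
    (\<forall>b u. (\<forall>y\<in>S. A y (u y) = b y) \<longrightarrow>
      (\<forall>\<^sub>F y in nhds x. norm (u y - u x) \<le> 2 / B * norm (b y - A y (u x))))"
proof -
  have "inj (A x)" using lin[OF x] inj[OF x] by (simp add: linear_injective_0)
  then obtain B where B: "B > 0" "\<And>w. B * norm w \<le> norm (A x w)"
    using linear_inj_bounded_below_pos[OF lin[OF x]] by blast
  note lim = operator_tendsto[OF x]
  have "\<forall>\<^sub>F y in nhds x. norm (u y - u x) \<le> 2 / B * norm (b y - A y (u x))"
    if eq: "\<And>y. y \<in> S \<Longrightarrow> A y (u y) = b y" for b u
  proof -
    have "\<forall>\<^sub>F y in nhds x. (\<Sum>b\<in>Basis. norm (A y b - A x b)) < B / 2 \<and> y \<in> S"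
      using order_tendstoD(2)[OF lim, of "B / 2"] B eventually_nhds_in_open[OF S x]
      by (simp only: eventually_conj_iff half_gt_zero simp_thms)
    then show ?thesis
    proof (rule eventually_mono)
      fix y assume y: "(\<Sum>b\<in>Basis. norm (A y b - A x b)) < B / 2 \<and> y \<in> S"
      define w where "w = u y - u x"
      have Aw: "A y w = b y - A y (u x)" using y eq by (simp add: w_def linear_diff lin)
      have "norm (A x w) \<le> norm (A y w) + norm (A y w - A x w)"
        by (metis norm_minus_commute norm_triangle_sub)
      also have "norm (A y w - A x w) \<le> (\<Sum>b\<in>Basis. norm (A y b - A x b)) * norm w"
        using linear_family_operator_bound[of A y x w] lin x y by blast
      also have "\<dots> \<le> B / 2 * norm w" using y by (intro mult_right_mono) auto
      finally have "B / 2 * norm w \<le> norm (A y w)" using B(2)[of w] by simp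
      then show "norm (u y - u x) \<le> 2 / B * norm (b y - A y (u x))"
        using B(1) by (simp add: Aw w_def[symmetric] field_simps)
    qed
  qed
  with B show ?thesis by blast
qed

lemma solution_continuous:
  assumes b: "continuous_on S b" and eq: "\<And>y. y \<in> S \<Longrightarrow> A y (u y) = b y"
  shows "continuous_on S u"
proof (rule continuous_at_imp_continuous_on, rule ballI)
  fix x assume x: "x \<in> S"
  obtain B where B: "\<forall>\<^sub>F y in nhds x. norm (u y - u x) \<le> 2 / B * norm (b y - A y (u x))"
    using solution_estimate[OF x] eq by blast
  have 1: "((\<lambda>y. b y - A y (u x)) \<longlongrightarrow> b x - A x (u x)) (nhds x)"
    by (intro tendsto_diff continuous_on_open_tendsto_nhds[OF smooth_on_imp_continuous_on[OF smooth] S x]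
          continuous_on_open_tendsto_nhds[OF b S x])
  have "((\<lambda>y. 2 / B * norm (b y - A y (u x))) \<longlongrightarrow> 2 / B * norm (b x - A x (u x))) (nhds x)"
    by (intro tendsto_mult_left tendsto_norm 1)
  then have "((\<lambda>y. 2 / B * norm (b y - A y (u x))) \<longlongrightarrow> 0) (nhds x)" using eq[OF x] by simp
  then have "((\<lambda>y. u y - u x) \<longlongrightarrow> 0) (nhds x)"
    by (rule Lim_null_comparison[OF B])
  then have "(u \<longlongrightarrow> u x) (nhds x)" by (rule LIM_zero_cancel)
  then show "isCont u x" by (simp add: continuous_at tendsto_at_iff_tendsto_nhds)
qed

text \<open>Implicit differentiation. The residual r of the fixed value u x in the equation at y is
  differentiable and vanishes at x; the derivative of u is the inverse of \<open>A x\<close> applied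
  to that of r.\<close>

lemma solution_derivative:
  assumes b: "b differentiable (at x)" and eq: "\<And>y. y \<in> S \<Longrightarrow> A y (u y) = b y" and x: "x \<in> S"
  obtains u' where "(u has_derivative u') (at x)"
    "\<And>h. A x (u' h) = Df b x h - Df (\<lambda>y. A y (u x)) x h"
proof -
  define r where "r y = b y - A y (u x)" for y
  define r' where "r' h = Df b x h - Df (\<lambda>y. A y (u x)) x h" for h
  have r: "(r has_derivative r') (at x)"
    unfolding r_def r'_def using b x
    by (intro has_derivative_diff smooth_on_imp_has_derivative[OF smooth]) (auto simp: frechet_derivative_works)
  have rx: "r x = 0" using eq[OF x] by (simp add: r_def)
  have r'lin: "bounded_linear r'" using r by (rule has_derivative_bounded_linear)
  obtain B where B: "B > 0" "\<And>w. B * norm w \<le> norm (A x w)"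
    and B3: "\<forall>\<^sub>F y in nhds x. norm (u y - u x) \<le> 2 / B * norm (b y - A y (u x))"
    using solution_estimate[OF x] eq by blast
  have B3: "\<forall>\<^sub>F y in nhds x. norm (u y - u x) \<le> 2 / B * norm (r y)"
    using B3 by (simp only: r_def)
  note lim = operator_tendsto[OF x]
  define N where "N y = (\<Sum>b\<in>Basis. norm (A y b - A x b))" for y
  have "inj (A x)" using lin[OF x] inj[OF x] by (simp add: linear_injective_0)
  then obtain g where g: "linear g" "\<And>w. A x (g w) = w"
    using linear_injective_isomorphism[OF lin[OF x]] by metis
  define u' where "u' h = g (r' h)" for h
  have Au': "A x (u' h) = r' h" for h by (simp add: u'_def g)
  have u'lin: "bounded_linear u'"
    unfolding u'_def using g r'lin by (simp add: bounded_linear_compose linear_conv_bounded_linear)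
  define \<rho> where "\<rho> y = norm (r y - r x - r' (y - x)) / norm (y - x)" for y
  have \<rho>: "(\<rho> \<longlongrightarrow> 0) (at x)" using r by (simp add: has_derivative_iff_norm \<rho>_def[abs_def])
  obtain K where K: "\<And>h. norm (r' h) \<le> norm h * K" using bounded_linear.bounded[OF r'lin] by blast
  have Nlim: "(N \<longlongrightarrow> 0) (at x)"
    using filterlim_mono[OF lim order_refl, of "at x"] by (simp add: N_def[abs_def] at_within_def inf.coboundedI1)
  have "((\<lambda>y. (1/B) * (\<rho> y + N y * (2/B) * (\<rho> y + K))) \<longlongrightarrow> (1/B) * (0 + 0 * (2/B) * (0 + K))) (at x)"
    by (intro tendsto_intros \<rho> Nlim)
  then have lim0: "((\<lambda>y. (1/B) * (\<rho> y + N y * (2/B) * (\<rho> y + K))) \<longlongrightarrow> 0) (at x)" by simp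
  have "\<forall>\<^sub>F y in at x. y \<in> S \<and> norm (u y - u x) \<le> 2 / B * norm (r y) \<and> y \<noteq> x"
    using eventually_conj[OF eventually_nhds_in_open[OF S x] B3]
    by (simp add: eventually_at_filter eventually_mono)
  then have "\<forall>\<^sub>F y in at x. norm (norm (u y - u x - u' (y - x)) / norm (y - x)) \<le> (1/B) * (\<rho> y + N y * (2/B) * (\<rho> y + K))"
  proof (rule eventually_mono)
    fix y assume y: "y \<in> S \<and> norm (u y - u x) \<le> 2 / B * norm (r y) \<and> y \<noteq> x"
    define h where "h = y - x"
    define w where "w = u y - u x"
    have h: "norm h > 0" using y by (simp add: h_def)
    have rb: "norm (r y) \<le> norm h * (\<rho> y + K)"
    proof -
      have "norm (r y) \<le> norm (r' h) + norm (r y - r' h)" by (rule norm_triangle_sub)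
      also have "norm (r y - r' h) = norm h * \<rho> y" using h rx by (simp add: \<rho>_def h_def)
      finally show ?thesis using K[of h] by (simp add: algebra_simps)
    qed
    have "r y = A y w" using y eq by (simp add: r_def w_def linear_diff lin)
    \<comment> \<open>The first bracket is o(h), since r' is the derivative of r and r x = 0. The
      second is at most \<open>N y * norm w\<close>, where N y tends to 0 and w is of order h by
      \<open>solution_estimate\<close>. The lower bound B for \<open>A x\<close> transfers both to w
      - u' h.\<close>
    then have "A x (w - u' h) = (r y - r' h) - (A y w - A x w)"
      by (simp add: linear_diff lin x Au')
    then have "norm (A x (w - u' h)) \<le> norm (r y - r' h) + norm (A y w - A x w)"
      by (metis norm_triangle_ineq4)
    also have "norm (A y w - A x w) \<le> N y * norm w"
      unfolding N_def using linear_family_operator_bound[of A y x w] lin x y by blast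
    also have "N y * norm w \<le> N y * (2 / B * (norm h * (\<rho> y + K)))"
    proof (rule mult_left_mono)
      show "0 \<le> N y" by (simp add: N_def sum_nonneg)
      have "norm w \<le> 2 / B * norm (r y)" using y by (simp add: w_def)
      also have "\<dots> \<le> 2 / B * (norm h * (\<rho> y + K))" using rb B by (intro mult_left_mono) auto
      finally show "norm w \<le> 2 / B * (norm h * (\<rho> y + K))" .
    qed
    also have "norm (r y - r' h) = norm h * \<rho> y" using h rx by (simp add: \<rho>_def h_def)
    also have "norm h * \<rho> y + N y * (2 / B * (norm h * (\<rho> y + K))) =
        norm h * (\<rho> y + N y * (2/B) * (\<rho> y + K))" by (simp add: algebra_simps add_divide_distrib)
    finally have "B * norm (w - u' h) \<le> norm h * (\<rho> y + N y * (2/B) * (\<rho> y + K))"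
      using B(2)[of "w - u' h"] by linarith
    then have "norm (w - u' h) / norm h \<le> (1/B) * (\<rho> y + N y * (2/B) * (\<rho> y + K))"
      using h B(1) by (simp add: field_simps)
    then show "norm (norm (u y - u x - u' (y - x)) / norm (y - x)) \<le> (1/B) * (\<rho> y + N y * (2/B) * (\<rho> y + K))"
      by (simp add: w_def h_def)
  qed
  from Lim_null_comparison[OF this lim0]
  have "(u has_derivative u') (at x)" by (simp add: has_derivative_iff_norm u'lin)
  with Au' show ?thesis using that unfolding r'_def by blast
qed

text \<open>Bootstrapping: each directional derivative of u solves an equation with the same
  operators, and its right-hand side involves u itself but not the derivative of u. So it is C^k
  once u is, and the induction runs over all b and u at once.\<close>

lemma solution_Ck:
  assumes "Ck_on k S b" "\<And>y. y \<in> S \<Longrightarrow> A y (u y) = b y"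
  shows "Ck_on k S u"
  using assms
proof (induction k arbitrary: b u)
  case 0 then show ?case using solution_continuous by simp
next
  case (Suc k)
  have b: "Ck_on k S b" using Suc.prems(1) by (rule Ck_on_SucD)
  have uk: "Ck_on k S u" by (rule Suc.IH[OF b Suc.prems(2)])
  have D: "u differentiable (at x) \<and> A x (Df u x h) =
      Df b x h - Df (\<lambda>y. A y (u x)) x h" if "x \<in> S" for x h
  proof -
    have "b differentiable (at x)" using Suc.prems(1) that by simp
    from solution_derivative[OF this Suc.prems(2) that] obtain u' where u': "(u has_derivative u') (at x)"
      "\<And>h. A x (u' h) = Df b x h - Df (\<lambda>y. A y (u x)) x h" by metis
    then show ?thesis using frechet_derivative_eqI[OF u'(1)] by (auto simp: differentiable_def)
  qed
  have "Ck_on k S (\<lambda>x. Df u x h)" for h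
  proof (rule Suc.IH)
    show "A x (Df u x h) =
      Df b x h - Df (\<lambda>y. A y (u x)) x h" if "x \<in> S" for x
      using D[OF that] by blast
    \<comment> \<open>In \<open>Df (\<lambda>y. A y (u x)) x h\<close> the vector u x is frozen
      during differentiation. The basis expansion separates it from the operators and leaves
      products of components of u with smooth functions.\<close>
    have "Ck_on k S (\<lambda>x. \<Sum>c\<in>Basis. (u x \<bullet> c) *\<^sub>R Df (\<lambda>y. A y c) x h)"
      using smooth_on_frechet[OF smooth]
      by (intro Ck_on_sum[OF S] Ck_on_bilinear[OF S bounded_bilinear_scaleR]
            Ck_on_linear_comp[OF S bounded_linear_inner_left uk]) (simp add: smooth_on_def)
    then have 1: "Ck_on k S (\<lambda>x. Df (\<lambda>y. A y (u x)) x h)"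
    proof (rule Ck_on_cong[OF S, rotated])
      fix x assume x: "x \<in> S"
      have "((\<lambda>y. \<Sum>c\<in>Basis. (u x \<bullet> c) *\<^sub>R A y c) has_derivative
          (\<lambda>h. \<Sum>c\<in>Basis. (u x \<bullet> c) *\<^sub>R Df (\<lambda>y. A y c) x h)) (at x)"
        by (intro has_derivative_sum has_derivative_scaleR_right smooth_on_imp_has_derivative[OF smooth x])
      then have "((\<lambda>y. A y (u x)) has_derivative
          (\<lambda>h. \<Sum>c\<in>Basis. (u x \<bullet> c) *\<^sub>R Df (\<lambda>y. A y c) x h)) (at x)"
        by (rule has_derivative_transform_within_open[OF _ S x]) (simp add: linear_sum_Basis[OF lin, symmetric])
      from fun_cong[OF frechet_derivative_eqI[OF this], of h]
      show "(\<Sum>c\<in>Basis. (u x \<bullet> c) *\<^sub>R Df (\<lambda>y. A y c) x h) =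
         Df (\<lambda>y. A y (u x)) x h" by (rule sym)
    qed
    have "Ck_on k S (\<lambda>x. - Df (\<lambda>y. A y (u x)) x h)"
      by (rule Ck_on_linear_comp[OF S bounded_linear_minus[OF bounded_linear_ident] 1])
    moreover have "Ck_on k S (\<lambda>x. Df b x h)" using Suc.prems(1) by simp
    ultimately show "Ck_on k S (\<lambda>x. Df b x h - Df (\<lambda>y. A y (u x)) x h)"
      using Ck_on_add[OF S] by fastforce
  qed
  then show ?case using D by simp
qed

lemma solution_smooth:
  assumes "smooth_on S b" "\<And>y. y \<in> S \<Longrightarrow> A y (u y) = b y"
  shows "smooth_on S u"
  using assms solution_Ck unfolding smooth_on_def by blast

end

section \<open>Local solutions of smooth ordinary differential equations\<close>

text \<open>Finitely many continuous partial derivatives are bounded on the compact ball, and its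
  convexity permits the mean value inequality.\<close>

lemma smooth_on_lipschitz_cball:
  fixes f :: "'a::euclidean_space \<Rightarrow> 'b::euclidean_space"
  assumes W: "cball a r \<subseteq> W" and f: "smooth_on W f"
  shows "\<exists>C\<ge>0. \<forall>x\<in>cball a r. \<forall>y\<in>cball a r. norm (f x - f y) \<le> C * norm (x - y)"
proof -
  have "\<exists>K\<ge>0. \<forall>x\<in>cball a r. norm (Df f x b) \<le> K" for b
  proof -
    have "compact ((\<lambda>x. Df f x b) ` cball a r)"
      using smooth_on_imp_continuous_on[OF smooth_on_frechet[OF f]] W
      by (intro compact_continuous_image) (auto intro: continuous_on_subset)
    then obtain K where K: "\<forall>z\<in>(\<lambda>x. Df f x b) ` cball a r. norm z \<le> K"
      using compact_imp_bounded bounded_iff by metis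
    then have "\<forall>x\<in>cball a r. norm (Df f x b) \<le> max 0 K" by force
    then show ?thesis by (metis max.cobounded1)
  qed
  then obtain K where K: "\<And>b. K b \<ge> 0" "\<And>b x. x \<in> cball a r \<Longrightarrow> norm (Df f x b) \<le> K b"
    by metis
  have on: "onorm (Df f x) \<le> (\<Sum>b\<in>Basis. K b)" if x: "x \<in> cball a r" for x
  proof (rule onorm_bound)
    show "0 \<le> (\<Sum>b\<in>Basis. K b)" using K by (simp add: sum_nonneg)
    fix v
    have "Df f x v = (\<Sum>b\<in>Basis. (v \<bullet> b) *\<^sub>R Df f x b)"
      using W x by (intro linear_sum_Basis smooth_on_linear_frechet[OF f]) auto
    also have "norm \<dots> \<le> (\<Sum>b\<in>Basis. norm ((v \<bullet> b) *\<^sub>R Df f x b))" by (rule norm_sum)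
    also have "\<dots> \<le> (\<Sum>b\<in>Basis. norm v * K b)"
      using K x by (intro sum_mono) (auto intro!: mult_mono Basis_le_norm)
    finally show "norm (Df f x v) \<le> (\<Sum>b\<in>Basis. K b) * norm v"
      by (simp add: sum_distrib_left mult.commute)
  qed
  have "norm (f x - f y) \<le> (\<Sum>b\<in>Basis. K b) * norm (x - y)" if "x \<in> cball a r" "y \<in> cball a r" for x y
  proof (rule differentiable_bound[where f' = "\<lambda>x. Df f x", OF convex_cball _ _ that])
    show "onorm (Df f z) \<le> (\<Sum>b\<in>Basis. K b)" if "z \<in> cball a r" for z
      by (rule on[OF that])
    show "(f has_derivative Df f z) (at z within cball a r)" if "z \<in> cball a r" for z
      by (rule has_derivative_at_withinI[OF smooth_on_imp_has_derivative[OF f subsetD[OF W that]]])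
  qed
  moreover have "0 \<le> (\<Sum>b\<in>Basis. K b)" using K by (simp add: sum_nonneg)
  ultimately show ?thesis by blast
qed

text \<open>For a globally bounded and Lipschitz right-hand side the contraction acts on all bounded
  continuous functions, so no invariant ball has to be set up; the bound on u is read off from the
  fixed-point equation.\<close>

lemma picard_lindelof_lipschitz:
  fixes g :: "'a::euclidean_space \<Rightarrow> 'a"
  assumes K: "K \<ge> 0" "\<And>x. norm (g x) \<le> K" and C: "C \<ge> 0" "\<And>x y. norm (g x - g y) \<le> C * norm (x - y)"
    and e: "e > 0" "4 * e * C \<le> 1/2"
  obtains u where "u 0 = u0" "\<And>t. norm (u t - u0) \<le> 4 * e * K"
    "\<And>t. t \<in> {-e<..<e} \<Longrightarrow> (u has_vector_derivative g (u t)) (at t)"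
proof -
  \<comment> \<open>Time is clamped to the interval from -e to e, so that the Picard operator maps
    into bounded continuous functions on the whole line, a complete space.\<close>
  define c where "c t = max (-e) (min e t)" for t :: real
  \<comment> \<open>Both integrals start at -e, so their difference is the oriented integral from 0
    to c t for either sign of t. Each runs over a length of at most 2 e, which is the origin of the
    factor 4 e.\<close>
  define P where "P y t = u0 + integral {-e..c t} (\<lambda>s. g (y s)) - integral {-e..0} (\<lambda>s. g (y s))"
    for y :: "real \<Rightarrow> 'a" and t
  have c: "c t \<in> {-e..e}" for t using e by (auto simp: c_def)
  have gc: "continuous_on UNIV g"
  proof (rule continuous_on_iff[THEN iffD2], intro ballI allI impI)
    fix x d assume "(d::real) > 0"
    show "\<exists>\<delta>>0. \<forall>x'\<in>UNIV. dist x' x < \<delta> \<longrightarrow> dist (g x') (g x) < d"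
    proof (intro exI[of _ "d / (C + 1)"] conjI ballI impI)
      show "d / (C + 1) > 0" using \<open>d > 0\<close> C by simp
      fix x' assume *: "dist x' x < d / (C + 1)"
      have "dist (g x') (g x) \<le> C * dist x' x" using C(2) by (simp add: dist_norm)
      also have "\<dots> \<le> (C + 1) * dist x' x" by (intro mult_right_mono) auto
      also have "\<dots> < d" using * C(1) by (simp add: field_simps)
      finally show "dist (g x') (g x) < d" .
    qed
  qed
  have gy: "continuous_on T (\<lambda>s. g (y s))" if "continuous_on UNIV y" for y :: "real \<Rightarrow> 'a" and T
    using continuous_on_compose2[OF gc that] continuous_on_subset by blast
  have int: "(\<lambda>s. g (y s)) integrable_on {-e..t}" if "continuous_on UNIV y" for y :: "real \<Rightarrow> 'a" and t
    by (rule integrable_continuous_real[OF gy[OF that]])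
  have Ib: "norm (integral {-e..t} h) \<le> 2 * e * B"
    if "t \<in> {-e..e}" "continuous_on {-e..t} h" "\<And>s. norm (h s) \<le> B" "B \<ge> 0" for t B and h :: "real \<Rightarrow> 'a"
  proof -
    have "norm (integral {-e..t} h) \<le> B * (t - (-e))" using that by (intro integral_bound) auto
    also have "\<dots> \<le> B * (2 * e)" using that by (intro mult_left_mono) auto
    finally show ?thesis by (simp add: mult.commute)
  qed
  have Pb: "norm (P y t - u0) \<le> 4 * e * K" if y: "continuous_on UNIV y" for y t
  proof -
    have "P y t - u0 = integral {-e..c t} (\<lambda>s. g (y s)) - integral {-e..0} (\<lambda>s. g (y s))"
      by (simp add: P_def)
    then have "norm (P y t - u0) \<le> norm (integral {-e..c t} (\<lambda>s. g (y s))) + norm (integral {-e..0} (\<lambda>s. g (y s)))"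
      by (simp only: norm_triangle_ineq4)
    also have "\<dots> \<le> 2 * e * K + 2 * e * K"
      using e c K by (intro add_mono Ib gy[OF y]) auto
    finally show ?thesis by (simp add: mult_ac)
  qed
  have Pc: "continuous_on UNIV (P y)" if y: "continuous_on UNIV y" for y
  proof -
    have "continuous_on {-e..e} (\<lambda>t. integral {-e..t} (\<lambda>s. g (y s)))"
      by (rule indefinite_integral_continuous_1[OF int[OF y]])
    moreover have "continuous_on UNIV c" unfolding c_def by (intro continuous_intros)
    ultimately have "continuous_on UNIV (\<lambda>t. integral {-e..c t} (\<lambda>s. g (y s)))"
      by (rule continuous_on_compose2) (use c in auto)
    then show ?thesis unfolding P_def[abs_def] by (intro continuous_intros)
  qed
  have Pin: "P y \<in> bcontfun" if y: "continuous_on UNIV y" for y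
  proof (rule bcontfun_normI[OF Pc[OF y]])
    show "norm (P y t) \<le> norm u0 + 4 * e * K" for t
      using Pb[OF y, of t] norm_triangle_sub[of "P y t" u0] by linarith
  qed
  define T where "T y = Bcontfun (P (apply_bcontfun y))" for y :: "real \<Rightarrow>\<^sub>C 'a"
  have cy: "continuous_on UNIV (apply_bcontfun y)" for y :: "real \<Rightarrow>\<^sub>C 'a" by simp
  have T: "apply_bcontfun (T y) = P (apply_bcontfun y)" for y
    unfolding T_def by (rule Bcontfun_inverse[OF Pin[OF cy]])
  have contr: "dist (T y) (T z) \<le> 1/2 * dist y z" for y z
  proof (rule dist_bound)
    fix t
    let ?h = "\<lambda>s. g (y s) - g (z s)"
    have hb: "norm (?h s) \<le> C * dist y z" for s
    proof -
      have "norm (?h s) \<le> C * norm (y s - z s)" by (rule C(2))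
      also have "\<dots> \<le> C * dist y z" using C(1) dist_bounded[of y s z] by (intro mult_left_mono) (auto simp: dist_norm)
      finally show ?thesis .
    qed
    have hc: "continuous_on A ?h" for A by (intro continuous_on_diff gy cy)
    have "P y t - P z t = integral {-e..c t} ?h - integral {-e..0} ?h"
      unfolding P_def by (simp add: integral_diff int[OF cy])
    then have "norm (P y t - P z t) \<le> norm (integral {-e..c t} ?h) + norm (integral {-e..0} ?h)"
      by (metis norm_triangle_ineq4)
    also have "\<dots> \<le> 2 * e * (C * dist y z) + 2 * e * (C * dist y z)"
      using e c C hb by (intro add_mono Ib hc) auto
    also have "\<dots> = (4 * e * C) * dist y z" by simp
    also have "\<dots> \<le> 1/2 * dist y z" using e by (intro mult_right_mono) auto
    finally show "dist (apply_bcontfun (T y) t) (apply_bcontfun (T z) t) \<le> 1/2 * dist y z"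
      by (simp add: T dist_norm)
  qed
  obtain y where y: "T y = y" using banach_fix_type[of "1/2" T] contr by auto
  have fixpt: "apply_bcontfun y t = P y t" for t using T[of y] y by metis
  show ?thesis
  proof (rule that[of "apply_bcontfun y"])
    show "apply_bcontfun y 0 = u0" using e unfolding fixpt[of 0] by (simp add: P_def c_def)
    show "norm (y t - u0) \<le> 4 * e * K" for t unfolding fixpt[of t] by (rule Pb[OF cy])
    show "(apply_bcontfun y has_vector_derivative g (y t)) (at t)" if t: "t \<in> {-e<..<e}" for t
    proof -
      have "((\<lambda>t. integral {-e..t} (\<lambda>s. g (y s))) has_vector_derivative g (y t)) (at t within {-e..e})"
        using t by (intro integral_has_vector_derivative gy cy) auto
      then have "((\<lambda>t. integral {-e..t} (\<lambda>s. g (y s))) has_vector_derivative g (y t)) (at t)"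
        using t by (metis at_within_Icc_at greaterThanLessThan_iff)
      then have "((\<lambda>t. u0 + integral {-e..t} (\<lambda>s. g (y s)) - integral {-e..0} (\<lambda>s. g (y s))) has_vector_derivative g (y t)) (at t)"
        by (auto intro!: derivative_eq_intros)
      then show ?thesis
      proof (rule has_vector_derivative_transform_within_open[OF _ open_greaterThanLessThan t])
        fix s assume "s \<in> {-e<..<e}"
        then show "u0 + integral {-e..s} (\<lambda>s. g (y s)) - integral {-e..0} (\<lambda>s. g (y s)) = apply_bcontfun y s"
          unfolding fixpt[of s] P_def by (simp add: c_def)
      qed
    qed
  qed
qed

text \<open>The derivative of u is f composed with u, so u gains one order of differentiability in
  each round.\<close>

lemma ode_solution_smooth:
  fixes u :: "real \<Rightarrow> 'a::euclidean_space"
  assumes f: "smooth_on W f" and I: "open I" and uO: "u ` I \<subseteq> W"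
    and u: "\<And>t. t \<in> I \<Longrightarrow> (u has_vector_derivative f (u t)) (at t)"
  shows "smooth_on I u"
proof -
  have D: "(u has_derivative (\<lambda>h. h *\<^sub>R f (u t))) (at t)" if "t \<in> I" for t
    using u[OF that] by (simp add: has_vector_derivative_def)
  have "Ck_on k I u" for k
  proof (induction k)
    case 0
    show ?case using u by (auto intro!: continuous_at_imp_continuous_on has_vector_derivative_continuous)
  next
    case (Suc k)
    have "Ck_on k I (\<lambda>t. Df u t h)" for h
    proof (rule Ck_on_cong[OF I])
      have "Ck_on k I (\<lambda>t. f (u t))" using f by (intro Ck_on_compose[OF I uO Suc]) (simp add: smooth_on_def)
      then show "Ck_on k I (\<lambda>t. h *\<^sub>R f (u t))" by (rule Ck_on_linear_comp[OF I bounded_linear_scaleR_right])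
      show "h *\<^sub>R f (u t) = Df u t h" if "t \<in> I" for t
        by (simp add: frechet_derivative_eqI[OF D[OF that]])
    qed
    then show ?case using D by (auto simp: differentiable_def)
  qed
  then show ?thesis by (simp add: smooth_on_def)
qed

text \<open>Composing f with the nearest-point retraction onto a closed ball, which is 1-Lipschitz,
  makes it globally bounded and Lipschitz. The interval is so short that the solution stays in the
  ball, where the retraction is the identity.\<close>

theorem smooth_ode_local_solution:
  fixes f :: "'a::euclidean_space \<Rightarrow> 'a"
  assumes W: "open W" and f: "smooth_on W f" and u0: "u0 \<in> W"
  obtains e u where "e > 0" "u 0 = u0" "u ` {-e<..<e} \<subseteq> W" "smooth_on {-e<..<e} u"
    "\<And>t. t \<in> {-e<..<e} \<Longrightarrow> (u has_vector_derivative f (u t)) (at t)"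
proof -
  obtain r where r: "r > 0" "cball u0 r \<subseteq> W" using W u0 open_contains_cball by blast
  obtain C where C: "C \<ge> 0" "\<And>x y. x \<in> cball u0 r \<Longrightarrow> y \<in> cball u0 r \<Longrightarrow> norm (f x - f y) \<le> C * norm (x - y)"
    using smooth_on_lipschitz_cball[OF r(2) f] by blast
  define p where "p = closest_point (cball u0 r)"
  have p: "p x \<in> cball u0 r" for x unfolding p_def using r by (intro closest_point_in_set) auto
  have pl: "norm (p x - p y) \<le> norm (x - y)" for x y
    using closest_point_lipschitz[of "cball u0 r" x y] r by (simp add: p_def dist_norm)
  define K where "K = norm (f u0) + C * r"
  have K: "norm (f (p x)) \<le> K" for x
  proof -
    have "norm (f (p x)) \<le> norm (f u0) + norm (f (p x) - f u0)" by (rule norm_triangle_sub)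
    also have "norm (f (p x) - f u0) \<le> C * norm (p x - u0)" using C(2) p r by simp
    also have "\<dots> \<le> C * r" using p[of x] C(1) by (intro mult_left_mono) (auto simp: dist_norm norm_minus_commute)
    finally show ?thesis by (simp add: K_def)
  qed
  have K0: "K \<ge> 0" using C r by (simp add: K_def)
  \<comment> \<open>The first entry makes the contraction factor 4 e C at most 1/2, the second keeps
    the displacement 4 e K within r. The added ones avoid division by zero.\<close>
  define e where "e = min (1 / (8 * (C + 1))) (r / (4 * (K + 1)))"
  have e: "e > 0" using C K0 r by (simp add: e_def)
  have "e \<le> 1 / (8 * (C + 1))" by (simp add: e_def)
  then have "e * (8 * (C + 1)) \<le> 1" using C(1) by (simp add: field_simps)
  then have eC: "4 * e * C \<le> 1/2" using e by (simp add: algebra_simps)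
  have "e \<le> r / (4 * (K + 1))" by (simp add: e_def)
  then have "e * (4 * (K + 1)) \<le> r" using K0 by (simp add: field_simps)
  then have eK: "4 * e * K \<le> r" using e by (simp add: algebra_simps)
  have lip: "norm (f (p x) - f (p y)) \<le> C * norm (x - y)" for x y
    using C(2)[OF p p] pl mult_left_mono[OF pl C(1)] order_trans by blast
  obtain u where u: "u 0 = u0" "\<And>t. norm (u t - u0) \<le> 4 * e * K"
    "\<And>t. t \<in> {-e<..<e} \<Longrightarrow> (u has_vector_derivative f (p (u t))) (at t)"
    by (rule picard_lindelof_lipschitz[of K "\<lambda>x. f (p x)" C e u0, OF K0 K C(1) lip e eC]) blast
  have ub: "u t \<in> cball u0 r" for t
    using u(2)[of t] eK by (simp add: dist_norm norm_minus_commute)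
  have "p (u t) = u t" for t unfolding p_def by (rule closest_point_self[OF ub])
  with u(3) have u3: "\<And>t. t \<in> {-e<..<e} \<Longrightarrow> (u has_vector_derivative f (u t)) (at t)" by simp
  have uO: "u ` {-e<..<e} \<subseteq> W" using ub r by blast
  show ?thesis
    by (rule that[OF e u(1) uO ode_solution_smooth[OF f _ uO u3] u3]) auto
qed

section \<open>Euler--Lagrange expressions\<close>

text \<open>For a curve \<open>x\<close> with velocity \<open>y\<close> and acceleration \<open>z\<close> this is
  \<open>d/dt (\<partial>l/\<partial>y) w - (\<partial>l/\<partial>x) w\<close>, written as a function of the 2-jet of the curve.\<close>

definition euler_lagrange ::
  "('a::euclidean_space \<times> 'a \<Rightarrow> real) \<Rightarrow> 'a \<times> 'a \<Rightarrow> 'a \<Rightarrow> 'a \<Rightarrow> real" where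
  "euler_lagrange l q z w =
     Df (\<lambda>q. Df l q (0, w)) q (snd q, z)
     - Df l q (w, 0)"

text \<open>The coordinate form of the tangent map of \<phi>.\<close>

definition tangent_lift :: "('a::euclidean_space \<Rightarrow> 'b::euclidean_space) \<Rightarrow> 'a \<times> 'a \<Rightarrow> 'b \<times> 'b" where
  "tangent_lift \<phi> q = (\<phi> (fst q), Df \<phi> (fst q) (snd q))"

text \<open>In the direction \<open>(snd q, z)\<close> the second component is the transformation
  law of accelerations: the image of z plus a term quadratic in the velocity.\<close>

lemma has_derivative_tangent_lift:
  assumes S: "open S" and \<phi>: "smooth_on S \<phi>" and q: "fst q \<in> S"
  shows "(tangent_lift \<phi> has_derivative (\<lambda>k. (Df \<phi> (fst q) (fst k),
     Df (\<lambda>p. Df \<phi> p (snd q)) (fst q) (fst k)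
       + Df \<phi> (fst q) (snd k)))) (at q)"
  unfolding tangent_lift_def[abs_def]
proof (rule has_derivative_Pair)
  have fst: "(fst has_derivative fst) (at q)" by (rule has_derivative_fst[OF has_derivative_ident])
  show "((\<lambda>q. \<phi> (fst q)) has_derivative (\<lambda>k. Df \<phi> (fst q) (fst k))) (at q)"
    by (rule has_derivative_compose[OF fst smooth_on_imp_has_derivative[OF \<phi> q]])
  show "((\<lambda>q. Df \<phi> (fst q) (snd q)) has_derivative (\<lambda>k.
     Df (\<lambda>p. Df \<phi> p (snd q)) (fst q) (fst k)
       + Df \<phi> (fst q) (snd k))) (at q)"
    by (rule has_derivative_frechet_apply[where g = fst and h = snd, OF S \<phi> q fst
          has_derivative_snd[OF has_derivative_ident]])
qed

lemma smooth_on_tangent_lift: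
  assumes "open S" "smooth_on S \<phi>" "open T" "fst ` T \<subseteq> S"
  shows "smooth_on T (tangent_lift \<phi>)"
  unfolding tangent_lift_def[abs_def]
  by (rule smooth_on_Pair[OF assms(3) smooth_on_compose[OF assms(3,4) smooth_on_fst[OF assms(3) smooth_on_id] assms(2)]
        smooth_on_frechet_apply[OF assms(3,2) smooth_on_fst[OF assms(3) smooth_on_id] assms(4) smooth_on_snd[OF assms(3) smooth_on_id]]])

text \<open>Differentiating l composed with the tangent lift produces an extra term with the second
  derivative of \<phi> on each side of the difference: once in the direction y with w frozen, once
  in the direction w with y frozen. Symmetry of second derivatives makes the two cancel.\<close>

lemma euler_lagrange_natural:
  fixes \<phi> :: "'f::euclidean_space \<Rightarrow> 'e::euclidean_space"
  assumes S: "open S" and \<phi>: "smooth_on S \<phi>" and W: "open W" and l: "smooth_on W l"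
    and W': "open W'" "(x, y) \<in> W'"
    and l': "\<And>q. q \<in> W' \<Longrightarrow> fst q \<in> S \<and> tangent_lift \<phi> q \<in> W \<and> l' q = l (tangent_lift \<phi> q)"
  shows "euler_lagrange l' (x, y) z w = euler_lagrange l (tangent_lift \<phi> (x, y))
    (Df (\<lambda>p. Df \<phi> p y) x y + Df \<phi> x z)
    (Df \<phi> x w)"
proof -
  let ?\<Phi> = "tangent_lift \<phi>"
  let ?D = "\<lambda>p. Df \<phi> p"
  let ?D2 = "\<lambda>x v. Df (\<lambda>p. Df \<phi> p v) x"
  let ?Dl = "\<lambda>q. Df l q"
  have D\<Phi>: "(?\<Phi> has_derivative (\<lambda>k. (?D (fst q) (fst k), ?D2 (fst q) (snd q) (fst k) + ?D (fst q) (snd k)))) (at q)"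
    if "q \<in> W'" for q
    using has_derivative_tangent_lift[OF S \<phi>] l'[OF that] by blast
  have Dlin: "linear (?D p)" if "p \<in> S" for p by (rule smooth_on_linear_frechet[OF \<phi> that])
  have D2lin: "linear (?D2 p v)" if "p \<in> S" for p v
    by (rule smooth_on_linear_frechet[OF smooth_on_frechet[OF \<phi>] that])
  have Dl': "Df l' q k =
      ?Dl (?\<Phi> q) (?D (fst q) (fst k), ?D2 (fst q) (snd q) (fst k) + ?D (fst q) (snd k))"
    if q: "q \<in> W'" for q k
  proof -
    have "((\<lambda>q. l (?\<Phi> q)) has_derivative
      (\<lambda>k. ?Dl (?\<Phi> q) (?D (fst q) (fst k), ?D2 (fst q) (snd q) (fst k) + ?D (fst q) (snd k)))) (at q)"
      using l'[OF q] by (intro has_derivative_compose[OF D\<Phi>[OF q] smooth_on_imp_has_derivative[OF l]]) auto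
    then have "(l' has_derivative
      (\<lambda>k. ?Dl (?\<Phi> q) (?D (fst q) (fst k), ?D2 (fst q) (snd q) (fst k) + ?D (fst q) (snd k)))) (at q)"
      by (rule has_derivative_transform_within_open[OF _ W'(1) q]) (simp add: l')
    from frechet_derivative_eqI[OF this] show ?thesis by (rule fun_cong)
  qed
  have xS: "x \<in> S" and \<Phi>W: "?\<Phi> (x, y) \<in> W" using l'[OF W'(2)] by auto
  have h: "((\<lambda>q. (0, ?D (fst q) w)) has_derivative (\<lambda>k. (0, ?D2 x w (fst k)))) (at (x, y))"
    by (rule has_derivative_Pair[OF has_derivative_const
          has_derivative_compose[where f = fst and g = "\<lambda>p. ?D p w", OF has_derivative_fst[OF has_derivative_ident]]])
       (simp add: smooth_on_imp_has_derivative[OF smooth_on_frechet[OF \<phi>] xS])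
  have "((\<lambda>q. ?Dl (?\<Phi> q) (0, ?D (fst q) w)) has_derivative (\<lambda>k.
      Df (\<lambda>p. ?Dl p (0, ?D x w)) (?\<Phi> (x, y)) (?D x (fst k), ?D2 x y (fst k) + ?D x (snd k))
      + ?Dl (?\<Phi> (x, y)) (0, ?D2 x w (fst k)))) (at (x, y))"
    using has_derivative_frechet_apply[OF W l \<Phi>W D\<Phi>[OF W'(2)] h] by simp
  then have "((\<lambda>q. Df l' q (0, w)) has_derivative (\<lambda>k.
      Df (\<lambda>p. ?Dl p (0, ?D x w)) (?\<Phi> (x, y)) (?D x (fst k), ?D2 x y (fst k) + ?D x (snd k))
      + ?Dl (?\<Phi> (x, y)) (0, ?D2 x w (fst k)))) (at (x, y))"
    by (rule has_derivative_transform_within_open[OF _ W'])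
       (simp add: Dl' l' linear_0[OF Dlin] linear_0[OF D2lin])
  from fun_cong[OF frechet_derivative_eqI[OF this], of "(y, z)"]
  have 1: "Df (\<lambda>q. Df l' q (0, w)) (x, y) (y, z) =
      Df (\<lambda>p. ?Dl p (0, ?D x w)) (?\<Phi> (x, y)) (?D x y, ?D2 x y y + ?D x z)
      + ?Dl (?\<Phi> (x, y)) (0, ?D2 x w y)" by simp
  have "Df l' (x, y) (w, 0) = ?Dl (?\<Phi> (x, y)) ((?D x w, 0) + (0, ?D2 x y w))"
    by (simp add: Dl'[OF W'(2)] linear_0[OF Dlin[OF xS]])
  also have "\<dots> = ?Dl (?\<Phi> (x, y)) (?D x w, 0) + ?Dl (?\<Phi> (x, y)) (0, ?D2 x y w)"
    by (rule linear_add[OF smooth_on_linear_frechet[OF l \<Phi>W]])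
  also have "?D2 x y w = ?D2 x w y" by (rule symmetric_derivative[OF S \<phi> xS])
  finally show ?thesis using 1 by (simp add: euler_lagrange_def tangent_lift_def)
qed

lemma smooth_on_euler_lagrange:
  assumes W: "open W" and l: "smooth_on W l" and T: "open T" and q: "smooth_on T q" "q ` T \<subseteq> W"
    and z: "smooth_on T z"
  shows "smooth_on T (\<lambda>p. euler_lagrange l (q p) (z p) w)"
  unfolding euler_lagrange_def
  by (rule smooth_on_diff[OF T
        smooth_on_frechet_apply[OF T smooth_on_frechet[OF l] q smooth_on_Pair[OF T smooth_on_snd[OF T q(1)] z]]
        smooth_on_frechet_apply[OF T l q smooth_on_const]])

text \<open>The part that is linear in the acceleration is the fibre Hessian of l. In this way the
  Hessian inherits naturality from the Euler--Lagrange expression.\<close>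

lemma euler_lagrange_acceleration:
  assumes "smooth_on W l" "q \<in> W"
  shows "euler_lagrange l q (z + a) w = euler_lagrange l q z w
    + Df (\<lambda>q. Df l q (0, w)) q (0, a)"
proof -
  have "Df (\<lambda>q. Df l q (0, w)) q ((snd q, z) + (0, a)) =
    Df (\<lambda>q. Df l q (0, w)) q (snd q, z) +
    Df (\<lambda>q. Df l q (0, w)) q (0, a)"
    by (rule linear_add[OF smooth_on_linear_frechet[OF smooth_on_frechet[OF assms(1)] assms(2)]])
  then show ?thesis by (simp add: euler_lagrange_def)
qed

text \<open>Used with n = 2 for the metric function in a chart and with n = 1 for its fibre
  derivatives.\<close>

locale fibrewise_homogeneous =
  fixes W :: "('a::euclidean_space \<times> 'a) set" and k :: "'a \<times> 'a \<Rightarrow> real" and n :: nat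
  assumes W: "open W" and smooth: "smooth_on W k"
    and cone: "\<And>x y t. (x, y) \<in> W \<Longrightarrow> t > 0 \<Longrightarrow> (x, t *\<^sub>R y) \<in> W"
    and hom: "\<And>x y t. (x, y) \<in> W \<Longrightarrow> t > 0 \<Longrightarrow> k (x, t *\<^sub>R y) = t ^ n * k (x, y)"
begin

text \<open>Euler's theorem on homogeneous functions: k is differentiated along the ray through y at
  the parameter 1.\<close>

lemma euler_identity:
  assumes xy: "(x, y) \<in> W"
  shows "Df k (x, y) (0, y) = real n * k (x, y)"
proof -
  have "((\<lambda>t. k ((x, 0) + t *\<^sub>R (0, y))) has_field_derivative
      Df k ((x, 0) + 1 *\<^sub>R (0, y)) (0, y)) (at 1)"
    using xy by (intro smooth_on_line_derivative[OF smooth]) simp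
  then have "((\<lambda>t. k (x, t *\<^sub>R y)) has_field_derivative Df k (x, y) (0, y)) (at 1)"
    by simp
  then have "((\<lambda>t. t ^ n * k (x, y)) has_field_derivative Df k (x, y) (0, y)) (at 1)"
    by (rule has_field_derivative_transform_within_open[where S = "{0<..}"]) (auto simp: hom[OF xy])
  moreover have "((\<lambda>t. t ^ n * k (x, y)) has_field_derivative real n * k (x, y)) (at 1)"
    by (auto intro!: derivative_eq_intros)
  ultimately show ?thesis by (rule DERIV_unique)
qed

text \<open>The homogeneity relation is differentiated along the fibre. The factor t from the chain
  rule stays on the left, which avoids the exponent n - 1.\<close>

lemma derivative_scaled:
  assumes xy: "(x, y) \<in> W" and t: "t > 0"
  shows "t * Df k (x, t *\<^sub>R y) (0, w) = t ^ n * Df k (x, y) (0, w)"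
proof -
  have "((\<lambda>q. (fst q, t *\<^sub>R snd q)) has_derivative (\<lambda>q. (fst q, t *\<^sub>R snd q))) (at (x, y))"
    by (auto intro!: derivative_eq_intros)
  then have "((\<lambda>q. k (fst q, t *\<^sub>R snd q)) has_derivative
      (\<lambda>q. Df k (x, t *\<^sub>R y) (fst q, t *\<^sub>R snd q))) (at (x, y))"
    using has_derivative_compose[where f = "\<lambda>q. (fst q, t *\<^sub>R snd q)" and g = k]
      smooth_on_imp_has_derivative[OF smooth cone[OF xy t]] by fastforce
  then have "((\<lambda>q. t ^ n * k q) has_derivative
      (\<lambda>q. Df k (x, t *\<^sub>R y) (fst q, t *\<^sub>R snd q))) (at (x, y))"
    by (rule has_derivative_transform_within_open[OF _ W xy]) (use hom[OF _ t] in auto)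
  moreover have "((\<lambda>q. t ^ n * k q) has_derivative (\<lambda>q. t ^ n * Df k (x, y) q)) (at (x, y))"
    by (rule has_derivative_mult_right[OF smooth_on_imp_has_derivative[OF smooth xy]])
  ultimately have "(\<lambda>q. Df k (x, t *\<^sub>R y) (fst q, t *\<^sub>R snd q)) =
      (\<lambda>q. t ^ n * Df k (x, y) q)" by (rule has_derivative_unique)
  from fun_cong[OF this, of "(0, w)"]
  have "Df k (x, t *\<^sub>R y) (t *\<^sub>R (0, w)) = t ^ n * Df k (x, y) (0, w)"
    by simp
  then show ?thesis
    by (simp only: linear_cmul[OF smooth_on_linear_frechet[OF smooth cone[OF xy t]]]) simp
qed

lemma fibrewise_homogeneous_derivative:
  assumes n: "n = Suc m"
  shows "fibrewise_homogeneous W (\<lambda>q. Df k q (0, w)) m"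
proof
  show "Df k (x, t *\<^sub>R y) (0, w) = t ^ m * Df k (x, y) (0, w)"
    if "(x, y) \<in> W" "t > 0" for x y t
    using derivative_scaled[OF that, of w] that(2) by (simp add: n)
qed (use W smooth cone smooth_on_frechet in auto)

end

section \<open>Charts, the tangent bundle and smooth maps\<close>

text \<open>The part of the manifold structure that the tangent bundle shares with its base.\<close>

definition charted :: "('m, 'e::euclidean_space) manifold \<Rightarrow> bool" where
  "charted M \<longleftrightarrow> (\<Union>c\<in>charts M. fst c) = points M \<and>
     (\<forall>c\<in>charts M. openin (mtop M) (fst c) \<and> inj_on (snd c) (fst c)) \<and>
     (\<forall>W. openin (mtop M) W \<longleftrightarrow> W \<subseteq> points M \<and> (\<forall>c\<in>charts M. open (snd c ` (W \<inter> fst c))))"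

lemma chart_inv_chart: "inj_on (snd c) (fst c) \<Longrightarrow> p \<in> fst c \<Longrightarrow> chart_inv c (snd c p) = p"
  by (simp add: chart_inv_def)

lemma chart_chart_inv: "x \<in> snd c ` fst c \<Longrightarrow> snd c (chart_inv c x) = x"
  by (simp add: chart_inv_def f_inv_into_f)

lemma chart_inv_in: "x \<in> snd c ` fst c \<Longrightarrow> chart_inv c x \<in> fst c"
  by (simp add: chart_inv_def inv_into_into)

lemma charted_inj: "charted M \<Longrightarrow> c \<in> charts M \<Longrightarrow> inj_on (snd c) (fst c)"
  by (simp add: charted_def)

lemma charted_openin_chart: "charted M \<Longrightarrow> c \<in> charts M \<Longrightarrow> openin (mtop M) (fst c)"
  unfolding charted_def by blast

lemma charted_open_image: "charted M \<Longrightarrow> c \<in> charts M \<Longrightarrow> openin (mtop M) W \<Longrightarrow> open (snd c ` (W \<inter> fst c))"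
  unfolding charted_def by blast

lemma charted_openinI:
  "charted M \<Longrightarrow> W \<subseteq> points M \<Longrightarrow> (\<And>c. c \<in> charts M \<Longrightarrow> open (snd c ` (W \<inter> fst c))) \<Longrightarrow> openin (mtop M) W"
  unfolding charted_def by blast

lemma charted_chart_subset: "charted M \<Longrightarrow> c \<in> charts M \<Longrightarrow> fst c \<subseteq> points M"
  unfolding charted_def by blast

lemma charted_ex_chart: "charted M \<Longrightarrow> p \<in> points M \<Longrightarrow> \<exists>c\<in>charts M. p \<in> fst c"
  unfolding charted_def by blast

lemma charted_ex_charts_at: "charted M \<Longrightarrow> p \<in> points M \<Longrightarrow> \<exists>c. c \<in> charts_at M p"
  unfolding charts_at_def using charted_ex_chart by fastforce

lemma charted_chart_image_open: "charted M \<Longrightarrow> c \<in> charts M \<Longrightarrow> open (snd c ` fst c)"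
  using charted_open_image[OF _ _ charted_openin_chart] by fastforce

text \<open>The chart domains form an open cover, and each coordinate map is a homeomorphism onto an
  open set; so openness can be tested on coordinate images.\<close>

lemma smooth_manifold_charted:
  assumes "smooth_manifold M" shows "charted M"
  unfolding charted_def
proof (intro conjI ballI allI)
  show U: "(\<Union>c\<in>charts M. fst c) = points M" using assms by (simp add: smooth_manifold_def)
  have chart: "openin (mtop M) (fst c)" "open (snd c ` fst c)"
    "homeomorphic_map (subtopology (mtop M) (fst c)) (top_of_set (snd c ` fst c)) (snd c)"
    if "c \<in> charts M" for c using assms that by (auto simp: smooth_manifold_def)
  have top: "topspace (subtopology (mtop M) (fst c)) = fst c" if "c \<in> charts M" for c
    using openin_subset[OF chart(1)[OF that]] by auto
  show "openin (mtop M) (fst c)" if "c \<in> charts M" for c using chart that by blast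
  show "inj_on (snd c) (fst c)" if "c \<in> charts M" for c
    using chart(3)[OF that] top[OF that] homeomorphic_imp_injective_map by metis
  have iff: "openin (mtop M) (W \<inter> fst c) \<longleftrightarrow> open (snd c ` (W \<inter> fst c))" if c: "c \<in> charts M" for W c
  proof -
    have "openin (mtop M) (W \<inter> fst c) \<longleftrightarrow> openin (subtopology (mtop M) (fst c)) (W \<inter> fst c)"
      using openin_open_subtopology[OF chart(1)[OF c]] by simp
    also have "\<dots> \<longleftrightarrow> openin (top_of_set (snd c ` fst c)) (snd c ` (W \<inter> fst c))"
      using homeomorphic_map_openness[OF chart(3)[OF c], of "W \<inter> fst c"] unfolding top[OF c] by simp
    also have "\<dots> \<longleftrightarrow> open (snd c ` (W \<inter> fst c))"
      by (simp add: openin_open_eq[OF chart(2)[OF c]] image_mono)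
    finally show ?thesis .
  qed
  show "openin (mtop M) W \<longleftrightarrow> W \<subseteq> points M \<and> (\<forall>c\<in>charts M. open (snd c ` (W \<inter> fst c)))" for W
  proof
    assume W: "openin (mtop M) W"
    then show "W \<subseteq> points M \<and> (\<forall>c\<in>charts M. open (snd c ` (W \<inter> fst c)))"
      using openin_subset[OF W] by (simp add: points_def iff[symmetric] chart(1) openin_Int)
  next
    assume W: "W \<subseteq> points M \<and> (\<forall>c\<in>charts M. open (snd c ` (W \<inter> fst c)))"
    then have "W = (\<Union>c\<in>charts M. W \<inter> fst c)" using U by auto
    moreover have "openin (mtop M) (\<Union>c\<in>charts M. W \<inter> fst c)"
      by (rule openin_Union) (use W iff in auto)
    ultimately show "openin (mtop M) W" by simp
  qed
qed

lemma charted_euclid: "charted (euclid :: ('e, 'e::euclidean_space) manifold)"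
  by (auto simp: charted_def euclid_def points_def)

text \<open>Continuity is a separate clause of \<open>smooth_map_on\<close>, but it follows from the
  coordinate expressions as soon as their domains are known to be open.\<close>

lemma smooth_map_onI:
  fixes A :: "('m, 'e::euclidean_space) manifold" and B :: "('n, 'f::euclidean_space) manifold"
  assumes A: "charted A" and B: "charted B" and S: "openin (mtop A) S" and f: "f ` S \<subseteq> points B"
    and loc: "\<And>c d. c \<in> charts A \<Longrightarrow> d \<in> charts B \<Longrightarrow> open (snd c ` {p \<in> S \<inter> fst c. f p \<in> fst d}) \<and>
       smooth_on (snd c ` {p \<in> S \<inter> fst c. f p \<in> fst d}) (\<lambda>x. snd d (f (chart_inv c x)))"
  shows "smooth_map_on A B S f"
  unfolding smooth_map_on_def
proof (intro conjI ballI)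
  show "openin (mtop A) S" by (rule S)
  show "smooth_on (snd c ` {p \<in> S \<inter> fst c. f p \<in> fst d}) (snd d \<circ> f \<circ> chart_inv c)"
    if "c \<in> charts A" "d \<in> charts B" for c d using loc[OF that] by (simp add: comp_def)
  have top: "topspace (subtopology (mtop A) S) = S" using openin_subset[OF S] by auto
  show "continuous_map (subtopology (mtop A) S) (mtop B) f"
    unfolding continuous_map_def top
  proof (intro conjI allI impI)
    show "f \<in> S \<rightarrow> topspace (mtop B)" using f by (auto simp: points_def)
    fix U assume U: "openin (mtop B) U"
    have "openin (mtop A) {p \<in> S. f p \<in> U}"
    proof (rule charted_openinI[OF A])
      show "{p \<in> S. f p \<in> U} \<subseteq> points A" using openin_subset[OF S] by (auto simp: points_def)
      fix c assume c: "c \<in> charts A"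
      define Z where "Z d = snd c ` {p \<in> S \<inter> fst c. f p \<in> fst d}" for d :: "('n, 'f) chart"
      define g where "g d x = snd d (f (chart_inv c x))" for d :: "('n, 'f) chart" and x
      note inv = chart_inv_chart[OF charted_inj[OF A c]]
      \<comment> \<open>Seen in the chart c, the preimage of U is the union over the target charts d
        of preimages under the coordinate expressions \<open>g d\<close>, each of which is
        continuous on the open set \<open>Z d\<close>.\<close>
      have "snd c ` ({p \<in> S. f p \<in> U} \<inter> fst c) = (\<Union>d\<in>charts B. Z d \<inter> g d -` (snd d ` (U \<inter> fst d)))"
        (is "?L = ?R")
      proof
        show "?L \<subseteq> ?R"
        proof
          fix x assume "x \<in> ?L"
          then obtain p where p: "p \<in> S" "f p \<in> U" "p \<in> fst c" "x = snd c p" by auto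
          then have "f p \<in> points B" using f by auto
          then obtain d where "d \<in> charts B" "f p \<in> fst d" using charted_ex_chart[OF B] by blast
          then show "x \<in> ?R" using p by (auto simp: Z_def g_def inv)
        qed
        show "?R \<subseteq> ?L"
        proof
          fix x assume "x \<in> ?R"
          then obtain d p where d: "d \<in> charts B" and p: "p \<in> S" "p \<in> fst c" "f p \<in> fst d" "x = snd c p"
            and "g d x \<in> snd d ` (U \<inter> fst d)" by (auto simp: Z_def)
          then obtain q where q: "q \<in> U" "q \<in> fst d" "snd d (f p) = snd d q" by (auto simp: g_def inv)
          then have "f p = q" using charted_inj[OF B d] p(3) by (auto dest: inj_onD)
          then show "x \<in> ?L" using p q by auto
        qed
      qed
      moreover have "open (Z d \<inter> g d -` (snd d ` (U \<inter> fst d)))" if d: "d \<in> charts B" for d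
        using loc[OF c d] charted_open_image[OF B d U] unfolding Z_def[symmetric] g_def[symmetric]
        by (intro continuous_open_preimage smooth_on_imp_continuous_on) auto
      ultimately show "open (snd c ` ({p \<in> S. f p \<in> U} \<inter> fst c))" by auto
    qed
    then show "openin (subtopology (mtop A) S) {p \<in> S. f p \<in> U}"
      using openin_open_subtopology[OF S] by auto
  qed
qed

lemma smooth_map_on_openin: "smooth_map_on A B S f \<Longrightarrow> openin (mtop A) S"
  by (simp add: smooth_map_on_def)

lemma smooth_map_on_openin_preimage:
  assumes "smooth_map_on A B S f" "openin (mtop B) U"
  shows "openin (mtop A) {p \<in> S. f p \<in> U}"
proof -
  have S: "openin (mtop A) S" using assms(1) by (rule smooth_map_on_openin)
  have top: "topspace (subtopology (mtop A) S) = S" using openin_subset[OF S] by auto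
  have "continuous_map (subtopology (mtop A) S) (mtop B) f" using assms(1) by (simp add: smooth_map_on_def)
  from openin_continuous_map_preimage[OF this assms(2)]
  show ?thesis unfolding top openin_open_subtopology[OF S] by blast
qed

lemma smooth_map_on_chart:
  assumes A: "charted A" and B: "charted B" and f: "smooth_map_on A B S f"
    and c: "c \<in> charts A" and d: "d \<in> charts B"
  shows "open (snd c ` {p \<in> S \<inter> fst c. f p \<in> fst d})"
    "smooth_on (snd c ` {p \<in> S \<inter> fst c. f p \<in> fst d}) (\<lambda>x. snd d (f (chart_inv c x)))"
proof -
  have "open (snd c ` ({p \<in> S. f p \<in> fst d} \<inter> fst c))"
    using charted_open_image[OF A c smooth_map_on_openin_preimage[OF f charted_openin_chart[OF B d]]] .
  moreover have "{p \<in> S. f p \<in> fst d} \<inter> fst c = {p \<in> S \<inter> fst c. f p \<in> fst d}" by auto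
  ultimately show "open (snd c ` {p \<in> S \<inter> fst c. f p \<in> fst d})" by simp
  show "smooth_on (snd c ` {p \<in> S \<inter> fst c. f p \<in> fst d}) (\<lambda>x. snd d (f (chart_inv c x)))"
    using f c d unfolding smooth_map_on_def comp_def by blast
qed

text \<open>The three model spaces are independent types. So the same chain rule serves a change of
  charts on N before passing to M, a change of charts on M afterwards, and, with a real function as
  the third coordinate map, directional derivatives.\<close>

lemma coordinate_change_chain:
  fixes a :: "('m, 'a::euclidean_space) chart" and b :: "('m, 'b::euclidean_space) chart"
    and e :: "('m, 'c::euclidean_space) chart"
  assumes "inj_on (snd a) (fst a)" "inj_on (snd b) (fst b)" "open (snd a ` (fst a \<inter> fst b))"
    and p: "p \<in> fst a" "p \<in> fst b"
    and d1: "(snd b \<circ> chart_inv a) differentiable (at (snd a p))"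
    and d2: "(snd e \<circ> chart_inv b) differentiable (at (snd b p))"
  shows "Df (snd e \<circ> chart_inv a) (snd a p) y =
    Df (snd e \<circ> chart_inv b) (snd b p)
      (Df (snd b \<circ> chart_inv a) (snd a p) y)"
proof -
  have bp: "(snd b \<circ> chart_inv a) (snd a p) = snd b p" using assms by (simp add: chart_inv_chart)
  have "((\<lambda>x. (snd e \<circ> chart_inv b) ((snd b \<circ> chart_inv a) x)) has_derivative
     (\<lambda>h. Df (snd e \<circ> chart_inv b) (snd b p)
       (Df (snd b \<circ> chart_inv a) (snd a p) h))) (at (snd a p))"
    using d1 d2 unfolding frechet_derivative_works bp[symmetric] by (rule has_derivative_compose)
  then have "((snd e \<circ> chart_inv a) has_derivative
     (\<lambda>h. Df (snd e \<circ> chart_inv b) (snd b p)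
       (Df (snd b \<circ> chart_inv a) (snd a p) h))) (at (snd a p))"
    by (rule has_derivative_transform_within_open[OF _ assms(3)])
       (use assms(1,2) p in \<open>auto simp: chart_inv_chart\<close>)
  from fun_cong[OF frechet_derivative_eqI[OF this]] show ?thesis .
qed

text \<open>Covers both a submanifold \<open>N\<close> of \<open>M\<close> and, for \<open>N = M\<close>, changes of charts.\<close>

locale inclusion =
  fixes M :: "('m, 'e::euclidean_space) manifold" and N :: "('m, 'f::euclidean_space) manifold"
  assumes M: "smooth_manifold M" and N: "smooth_manifold N" and inc: "smooth_map_on N M (points N) (\<lambda>p. p)"
    and sub: "points N \<subseteq> points M"
begin

lemma chM: "charted M" and chN: "charted N"
  using M N by (simp_all add: smooth_manifold_charted)

lemma transition_open: "c \<in> charts N \<Longrightarrow> d \<in> charts M \<Longrightarrow> open (snd c ` (fst c \<inter> fst d))"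
  and transition_smooth: "c \<in> charts N \<Longrightarrow> d \<in> charts M \<Longrightarrow>
    smooth_on (snd c ` (fst c \<inter> fst d)) (snd d \<circ> chart_inv c)"
proof -
  assume c: "c \<in> charts N" and d: "d \<in> charts M"
  have eq: "{p \<in> points N \<inter> fst c. p \<in> fst d} = fst c \<inter> fst d"
    using charted_chart_subset[OF chN c] by auto
  show "open (snd c ` (fst c \<inter> fst d))" "smooth_on (snd c ` (fst c \<inter> fst d)) (snd d \<circ> chart_inv c)"
    using smooth_map_on_chart[OF chN chM inc c d] unfolding eq by (simp_all add: comp_def)
qed

lemma transition_differentiable:
  "c \<in> charts_at N p \<Longrightarrow> d \<in> charts_at M p \<Longrightarrow> (snd d \<circ> chart_inv c) differentiable (at (snd c p))"
  by (rule smooth_on_imp_differentiable[OF transition_smooth]) (auto simp: charts_at_def)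

lemma openin_inclusion: "openin (mtop M) W \<Longrightarrow> openin (mtop N) (W \<inter> points N)"
  using smooth_map_on_openin_preimage[OF inc] by (simp add: Int_def conj_commute)

end

lemma inclusion_refl: assumes M: "smooth_manifold M" shows "inclusion M M"
proof
  have ch: "charted M" using M by (rule smooth_manifold_charted)
  show "smooth_map_on M M (points M) (\<lambda>p. p)"
  proof (rule smooth_map_onI[OF ch ch])
    show "openin (mtop M) (points M)" by (simp add: points_def)
    fix c d assume c: "c \<in> charts M" and d: "d \<in> charts M"
    have "{p \<in> points M \<inter> fst c. p \<in> fst d} = fst d \<inter> fst c" "fst d \<inter> fst c = fst c \<inter> fst d"
      using charted_chart_subset[OF ch c] by auto
    then show "open (snd c ` {p \<in> points M \<inter> fst c. p \<in> fst d}) \<and>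
      smooth_on (snd c ` {p \<in> points M \<inter> fst c. p \<in> fst d}) (\<lambda>x. snd d (chart_inv c x))"
      using M c d charted_open_image[OF ch c charted_openin_chart[OF ch d]]
      by (auto simp: smooth_manifold_def comp_def)
  qed simp
qed (use M in auto)

lemma submanifold_inclusion:
  "smooth_manifold M \<Longrightarrow> submanifold M N \<Longrightarrow> inclusion M N"
  by (simp add: inclusion_def submanifold_def)

lemma (in inclusion) transition_chain_source:
  assumes "a \<in> charts_at N p" "b \<in> charts_at N p" "e \<in> charts_at M p"
  shows "Df (snd e \<circ> chart_inv a) (snd a p) y =
    Df (snd e \<circ> chart_inv b) (snd b p)
      (Df (snd b \<circ> chart_inv a) (snd a p) y)"
proof -
  interpret NN: inclusion N N by (rule inclusion_refl[OF N])
  show ?thesis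
    using assms charted_inj[OF chN] NN.transition_open
    by (intro coordinate_change_chain NN.transition_differentiable transition_differentiable)
       (auto simp: charts_at_def)
qed

lemma (in inclusion) transition_chain_target:
  assumes "a \<in> charts_at N p" "b \<in> charts_at M p" "e \<in> charts_at M p"
  shows "Df (snd e \<circ> chart_inv a) (snd a p) y =
    Df (snd e \<circ> chart_inv b) (snd b p)
      (Df (snd b \<circ> chart_inv a) (snd a p) y)"
proof -
  interpret MM: inclusion M M by (rule inclusion_refl[OF M])
  show ?thesis
    using assms charted_inj[OF chN] charted_inj[OF chM] transition_open
    by (intro coordinate_change_chain MM.transition_differentiable transition_differentiable)
       (auto simp: charts_at_def)
qed

lemma transition_refl:
  assumes ch: "charted M" and c: "c \<in> charts_at M p"
  shows "Df (snd c \<circ> chart_inv c) (snd c p) y = y"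
proof -
  have c': "c \<in> charts M" "p \<in> fst c" using c by (auto simp: charts_at_def)
  have "Df (snd c \<circ> chart_inv c) (snd c p) = Df (\<lambda>x. x) (snd c p)"
    by (rule frechet_derivative_cong_open[OF charted_chart_image_open[OF ch c'(1)]])
       (use c' in \<open>auto simp: chart_chart_inv\<close>)
  then show ?thesis by simp
qed

section \<open>Tangent vectors in a chart\<close>

lemma tadd_simps [simp]: "fst (tadd v w) = fst v" "snd (tadd v w) c = snd v c + snd w c"
  and tscale_simps [simp]: "fst (tscale a v) = fst v" "snd (tscale a v) c = a *\<^sub>R snd v c"
  and tzero_simps [simp]: "fst (tzero p) = p" "snd (tzero p) c = 0"
  and coord_field_fst [simp]: "fst (coord_field M d y p) = p"
  by (simp_all add: tadd_def tscale_def tzero_def coord_field_def)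

lemma tvec_eqI: "fst v = fst w \<Longrightarrow> (\<And>c. snd v c = snd w c) \<Longrightarrow> v = w"
  by (simp add: prod_eq_iff ext)

lemma coord_field_snd:
  "d \<in> charts_at M p \<Longrightarrow> snd (coord_field M c y p) d = Df (snd d \<circ> chart_inv c) (snd c p) y"
  by (simp add: coord_field_def)

locale smooth_mfd = fixes M :: "('m, 'e::euclidean_space) manifold" assumes M: "smooth_manifold M"
begin

sublocale MM: inclusion M M by (rule inclusion_refl[OF M])

lemma ch: "charted M" by (rule MM.chM)

lemma charts_at_points: "c \<in> charts_at M p \<Longrightarrow> p \<in> points M"
  using charted_chart_subset[OF ch] unfolding charts_at_def by blast

lemma coord_field_self [simp]: "c \<in> charts_at M p \<Longrightarrow> snd (coord_field M c y p) c = y"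
  by (simp add: coord_field_snd transition_refl[OF ch])

lemma coord_field_in: "c \<in> charts_at M p \<Longrightarrow> coord_field M c y p \<in> tangent_space M p"
  unfolding tangent_space_def mem_Collect_eq
proof (intro conjI allI impI ballI)
  assume c: "c \<in> charts_at M p"
  then show "p \<in> points M" by (rule charts_at_points)
  show "snd (coord_field M c y p) d = 0" if "d \<notin> charts_at M p" for d
    using that by (simp add: coord_field_def)
  show "snd (coord_field M c y p) d =
      Df (snd d \<circ> chart_inv b) (snd b p) (snd (coord_field M c y p) b)"
    if "b \<in> charts_at M p" "d \<in> charts_at M p" for b d
    using that by (simp only: coord_field_snd MM.transition_chain_target[OF c that])
qed simp

lemma tangent_space_snd:
  "v \<in> tangent_space M p \<Longrightarrow> c \<in> charts_at M p \<Longrightarrow> d \<in> charts_at M p \<Longrightarrow>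
    snd v d = Df (snd d \<circ> chart_inv c) (snd c p) (snd v c)"
  unfolding tangent_space_def by blast

lemma tangent_space_snd_zero: "v \<in> tangent_space M p \<Longrightarrow> c \<notin> charts_at M p \<Longrightarrow> snd v c = 0"
  unfolding tangent_space_def by blast

lemma tangent_space_fst: "v \<in> tangent_space M p \<Longrightarrow> fst v = p"
  unfolding tangent_space_def by blast

lemma tangent_space_points: "v \<in> tangent_space M p \<Longrightarrow> p \<in> points M"
  unfolding tangent_space_def by blast

lemma tangent_spaceI:
  "fst v = p \<Longrightarrow> p \<in> points M \<Longrightarrow> (\<And>c. c \<notin> charts_at M p \<Longrightarrow> snd v c = 0) \<Longrightarrow>
    (\<And>c d. c \<in> charts_at M p \<Longrightarrow> d \<in> charts_at M p \<Longrightarrow>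
        snd v d = Df (snd d \<circ> chart_inv c) (snd c p) (snd v c)) \<Longrightarrow>
    v \<in> tangent_space M p"
  unfolding tangent_space_def by blast

lemma tangent_vector_eq:
  assumes "v \<in> tangent_space M p" "c \<in> charts_at M p"
  shows "v = coord_field M c (snd v c) p"
proof (rule tvec_eqI)
  show "fst v = fst (coord_field M c (snd v c) p)" using tangent_space_fst[OF assms(1)] by simp
  show "snd v d = snd (coord_field M c (snd v c) p) d" for d
    using tangent_space_snd[OF assms] tangent_space_snd_zero[OF assms(1)]
    by (cases "d \<in> charts_at M p") (simp_all add: coord_field_def)
qed

lemma tangent_space_eqI:
  assumes "v \<in> tangent_space M p" "w \<in> tangent_space M p" "c \<in> charts_at M p" "snd v c = snd w c"
  shows "v = w"
  by (metis assms tangent_vector_eq)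

lemma transition_linear:
  "c \<in> charts_at M p \<Longrightarrow> d \<in> charts_at M p \<Longrightarrow> linear (Df (snd d \<circ> chart_inv c) (snd c p))"
  by (rule linear_frechet_derivative[OF MM.transition_differentiable])

lemma coord_field_add:
  "c \<in> charts_at M p \<Longrightarrow> tadd (coord_field M c y p) (coord_field M c z p) = coord_field M c (y + z) p"
  by (rule tvec_eqI) (auto simp: coord_field_def linear_add[OF transition_linear])

lemma coord_field_scale:
  "c \<in> charts_at M p \<Longrightarrow> tscale a (coord_field M c y p) = coord_field M c (a *\<^sub>R y) p"
  by (rule tvec_eqI) (auto simp: coord_field_def linear_cmul[OF transition_linear])

lemma tangent_space_add: "v \<in> tangent_space M p \<Longrightarrow> w \<in> tangent_space M p \<Longrightarrow> tadd v w \<in> tangent_space M p"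
  by (rule tangent_spaceI)
     (simp_all add: tangent_space_fst tangent_space_points tangent_space_snd_zero,
      metis linear_add[OF transition_linear] tangent_space_snd)

lemma tangent_space_scale: "v \<in> tangent_space M p \<Longrightarrow> tscale a v \<in> tangent_space M p"
  by (rule tangent_spaceI)
     (simp_all add: tangent_space_fst tangent_space_points tangent_space_snd_zero,
      metis linear_cmul[OF transition_linear] tangent_space_snd)

lemma tangent_space_imp_vectors: "v \<in> tangent_space M p \<Longrightarrow> v \<in> tangent_vectors M"
  using tangent_space_fst tangent_space_points unfolding tangent_vectors_def by blast

lemma tangent_vectors_space: "v \<in> tangent_vectors M \<Longrightarrow> v \<in> tangent_space M (fst v)"
  using tangent_space_fst tangent_space_points unfolding tangent_vectors_def by blast

lemma tangent_vectors_fst: "v \<in> tangent_vectors M \<Longrightarrow> fst v \<in> points M"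
  using tangent_space_fst tangent_space_points unfolding tangent_vectors_def by blast

text \<open>The inverse of the bundle chart of c, given explicitly instead of through
  \<open>inv_into\<close>; \<open>tchart_inv\<close> identifies the two over the coordinate
  domain.\<close>

definition tinv :: "('m, 'e) chart \<Rightarrow> 'e \<times> 'e \<Rightarrow> ('m, 'e) tvec" where
  "tinv c z = coord_field M c (snd z) (chart_inv c (fst z))"

text \<open>By \<open>tchart_image\<close> this is the image of W under the bundle chart, written as
  a preimage under \<open>tinv\<close>, so that it commutes with unions and intersections.\<close>

definition tdom :: "('m, 'e) chart \<Rightarrow> ('m, 'e) tvec set \<Rightarrow> ('e \<times> 'e) set" where
  "tdom c W = {z. fst z \<in> snd c ` fst c \<and> tinv c z \<in> W}"

lemma chart_inv_charts_at: "c \<in> charts M \<Longrightarrow> x \<in> snd c ` fst c \<Longrightarrow> c \<in> charts_at M (chart_inv c x)"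
  by (simp add: charts_at_def chart_inv_in)

lemma tinv_fst [simp]: "fst (tinv c z) = chart_inv c (fst z)"
  by (simp add: tinv_def)

lemma tinv_in: "c \<in> charts M \<Longrightarrow> fst z \<in> snd c ` fst c \<Longrightarrow> tinv c z \<in> tangent_space M (chart_inv c (fst z))"
  unfolding tinv_def by (rule coord_field_in[OF chart_inv_charts_at])

lemma tinv_snd: "c \<in> charts M \<Longrightarrow> fst z \<in> snd c ` fst c \<Longrightarrow> snd (tinv c z) c = snd z"
  unfolding tinv_def by (simp add: chart_inv_charts_at)

lemma tinv_chart: "v \<in> tangent_space M p \<Longrightarrow> c \<in> charts_at M p \<Longrightarrow> tinv c (snd c p, snd v c) = v"
  using tangent_vector_eq[of v p c] charted_inj[OF ch]
  by (simp add: tinv_def charts_at_def chart_inv_chart)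

section \<open>Bundle charts and the topology of the tangent bundle\<close>

lemma fst_tchart: "fst (tchart M c) = {v \<in> tangent_vectors M. fst v \<in> fst c}"
  and snd_tchart: "snd (tchart M c) v = (snd c (fst v), snd v c)"
  by (simp_all add: tchart_def)

lemma tchart_inj: "c \<in> charts M \<Longrightarrow> inj_on (snd (tchart M c)) (fst (tchart M c))"
proof (rule inj_onI)
  fix v w assume c: "c \<in> charts M" and v: "v \<in> fst (tchart M c)" and w: "w \<in> fst (tchart M c)"
    and eq: "snd (tchart M c) v = snd (tchart M c) w"
  have "fst v = fst w" using eq v w charted_inj[OF ch c] by (auto simp: snd_tchart fst_tchart dest: inj_onD)
  then show "v = w"
    using v w eq c tangent_vectors_space[of v] tangent_vectors_space[of w]
    by (intro tangent_space_eqI[of v "fst v" w c]) (auto simp: fst_tchart snd_tchart charts_at_def)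
qed

lemma tchart_image:
  assumes c: "c \<in> charts M" and W: "W \<subseteq> tangent_vectors M"
  shows "snd (tchart M c) ` (W \<inter> fst (tchart M c)) = tdom c W"
proof
  show "snd (tchart M c) ` (W \<inter> fst (tchart M c)) \<subseteq> tdom c W"
  proof
    fix z assume "z \<in> snd (tchart M c) ` (W \<inter> fst (tchart M c))"
    then obtain v where v: "v \<in> W" "v \<in> tangent_vectors M" "fst v \<in> fst c" "z = (snd c (fst v), snd v c)"
      by (auto simp: fst_tchart snd_tchart)
    then show "z \<in> tdom c W"
      using c tinv_chart[OF tangent_vectors_space[OF v(2)], of c] by (auto simp: tdom_def charts_at_def)
  qed
  show "tdom c W \<subseteq> snd (tchart M c) ` (W \<inter> fst (tchart M c))"
  proof
    fix z assume z: "z \<in> tdom c W"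
    then have "z = snd (tchart M c) (tinv c z)"
      using c by (simp add: snd_tchart tdom_def tinv_snd chart_chart_inv)
    moreover have "tinv c z \<in> W \<inter> fst (tchart M c)"
      using z W c by (auto simp: tdom_def fst_tchart chart_inv_in)
    ultimately show "z \<in> snd (tchart M c) ` (W \<inter> fst (tchart M c))" by (rule image_eqI)
  qed
qed

lemma tchart_inv:
  assumes "c \<in> charts M" "fst z \<in> snd c ` fst c"
  shows "chart_inv (tchart M c) z = tinv c z"
proof -
  have "tinv c z \<in> fst (tchart M c)"
    using assms by (auto simp: fst_tchart tangent_space_imp_vectors[OF tinv_in] chart_inv_in)
  moreover have "snd (tchart M c) (tinv c z) = z"
    using assms by (simp add: snd_tchart tinv_snd chart_chart_inv)
  ultimately show ?thesis using chart_inv_chart[OF tchart_inj[OF assms(1)]] by metis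
qed

text \<open>The topology of the tangent bundle is introduced by an open-set predicate, which may be
  used only after it has been checked to be a topology.\<close>

lemma openin_tangent_bundle:
  "openin (mtop (tangent_bundle M)) W \<longleftrightarrow> W \<subseteq> tangent_vectors M \<and> (\<forall>c\<in>charts M. open (tdom c W))"
proof -
  let ?P = "\<lambda>W. W \<subseteq> tangent_vectors M \<and>
                (\<forall>c\<in>charts M. open (snd (tchart M c) ` (W \<inter> fst (tchart M c))))"
  have eq: "?P W \<longleftrightarrow> W \<subseteq> tangent_vectors M \<and> (\<forall>c\<in>charts M. open (tdom c W))" for W
    using tchart_image by auto
  have "istopology ?P"
    unfolding istopology_def
  proof (rule conjI; intro allI impI)
    fix S T assume "?P S" "?P T"
    moreover have "tdom c (S \<inter> T) = tdom c S \<inter> tdom c T" for c by (auto simp: tdom_def)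
    ultimately show "?P (S \<inter> T)" unfolding eq by auto
  next
    fix K assume "\<forall>S\<in>K. ?P S"
    moreover have "tdom c (\<Union>K) = (\<Union>S\<in>K. tdom c S)" for c by (auto simp: tdom_def)
    ultimately show "?P (\<Union>K)" unfolding eq by auto
  qed
  then show ?thesis by (simp add: tangent_bundle_def topology_inverse' eq)
qed

lemma charts_tangent_bundle: "charts (tangent_bundle M) = tchart M ` charts M"
  by (simp add: tangent_bundle_def)

lemma tdom_chart:
  assumes c: "c \<in> charts M" and d: "d \<in> charts M"
  shows "tdom c (fst (tchart M d)) = snd c ` (fst c \<inter> fst d) \<times> UNIV"
proof -
  have "z \<in> tdom c (fst (tchart M d)) \<longleftrightarrow> fst z \<in> snd c ` (fst c \<inter> fst d)" for z
    using tangent_space_imp_vectors[OF tinv_in[OF c], of z]  chart_chart_inv[of "fst z" c] chart_inv_in[of "fst z" c]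
      chart_inv_chart[OF charted_inj[OF ch c]]
    by (auto simp: tdom_def fst_tchart)
  then show ?thesis by auto
qed

lemma openin_tchart: "d \<in> charts M \<Longrightarrow> openin (mtop (tangent_bundle M)) (fst (tchart M d))"
  unfolding openin_tangent_bundle
proof (intro conjI ballI)
  show "fst (tchart M d) \<subseteq> tangent_vectors M" by (auto simp: fst_tchart)
  show "open (tdom c (fst (tchart M d)))" if "d \<in> charts M" "c \<in> charts M" for c
    using that by (simp add: tdom_chart open_Times MM.transition_open)
qed

lemma points_tangent_bundle: "points (tangent_bundle M) = tangent_vectors M"
proof
  show "points (tangent_bundle M) \<subseteq> tangent_vectors M"
    using openin_tangent_bundle openin_topspace unfolding points_def by blast
  show "tangent_vectors M \<subseteq> points (tangent_bundle M)"
  proof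
    fix v assume v: "v \<in> tangent_vectors M"
    then obtain c where "c \<in> charts M" "fst v \<in> fst c"
      using charted_ex_chart[OF ch tangent_vectors_fst] by blast
    then show "v \<in> points (tangent_bundle M)"
      using openin_subset[OF openin_tchart[of c]] v by (auto simp: fst_tchart points_def)
  qed
qed

lemma charted_tangent_bundle: "charted (tangent_bundle M)"
  unfolding charted_def points_tangent_bundle charts_tangent_bundle
proof (intro conjI ballI allI)
  show "(\<Union>c\<in>tchart M ` charts M. fst c) = tangent_vectors M"
    using charted_ex_chart[OF ch tangent_vectors_fst] by (auto simp: fst_tchart)
  show "openin (mtop (tangent_bundle M)) W \<longleftrightarrow> W \<subseteq> tangent_vectors M \<and>
      (\<forall>c\<in>tchart M ` charts M. open (snd c ` (W \<inter> fst c)))" for W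
    unfolding openin_tangent_bundle using tchart_image by auto
qed (use openin_tchart tchart_inj in auto)

end

section \<open>Conic pseudo-Finsler metrics in coordinates\<close>

lemma smooth_map_on_cong:
  assumes A: "charted A" and B: "charted B" and f: "smooth_map_on A B S f" and eq: "\<And>p. p \<in> S \<Longrightarrow> f p = g p"
  shows "smooth_map_on A B S g"
proof (rule smooth_map_onI[OF A B smooth_map_on_openin[OF f]])
  have "continuous_map (subtopology (mtop A) S) (mtop B) f" using f by (simp add: smooth_map_on_def)
  then have "f ` S \<subseteq> points B"
    using openin_subset[OF smooth_map_on_openin[OF f]] by (auto simp: continuous_map_def points_def)
  then show "g ` S \<subseteq> points B" using eq by auto
  fix c d assume c: "c \<in> charts A" and d: "d \<in> charts B"
  have set: "{p \<in> S \<inter> fst c. f p \<in> fst d} = {p \<in> S \<inter> fst c. g p \<in> fst d}" using eq by auto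
  note fs = smooth_map_on_chart[OF A B f c d]
  have "smooth_on (snd c ` {p \<in> S \<inter> fst c. f p \<in> fst d}) (\<lambda>x. snd d (g (chart_inv c x)))"
    by (rule smooth_on_cong[OF fs(1) _ fs(2)]) (auto simp: eq chart_inv_chart[OF charted_inj[OF A c]])
  then show "open (snd c ` {p \<in> S \<inter> fst c. g p \<in> fst d}) \<and>
      smooth_on (snd c ` {p \<in> S \<inter> fst c. g p \<in> fst d}) (\<lambda>x. snd d (g (chart_inv c x)))"
    using fs(1) unfolding set by blast
qed

lemma smooth_map_on_euclidI:
  fixes f :: "'m \<Rightarrow> 'a::euclidean_space"
  assumes A: "charted A" and S: "openin (mtop A) S"
    and loc: "\<And>c. c \<in> charts A \<Longrightarrow> smooth_on (snd c ` (S \<inter> fst c)) (\<lambda>x. f (chart_inv c x))"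
  shows "smooth_map_on A euclid S f"
  by (rule smooth_map_onI[OF A charted_euclid S])
     (use loc charted_open_image[OF A _ S] in \<open>auto simp: euclid_def points_def Int_def\<close>)

lemma smooth_map_on_euclidD:
  fixes f :: "'m \<Rightarrow> 'a::euclidean_space"
  assumes A: "charted A" and f: "smooth_map_on A euclid S f" and c: "c \<in> charts A"
  shows "smooth_on (snd c ` (S \<inter> fst c)) (\<lambda>x. f (chart_inv c x))"
proof -
  have "(UNIV, id) \<in> charts euclid" by (simp add: euclid_def)
  from smooth_map_on_chart(2)[OF A charted_euclid f c this] show ?thesis by (simp add: Int_def)
qed

context smooth_mfd
begin

lemma coord_field_vector_field:
  assumes c: "c \<in> charts M" and \<Omega>: "openin (mtop M) \<Omega>" "\<Omega> \<subseteq> fst c"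
  shows "coord_field M c y \<in> vector_fields M \<Omega>"
  unfolding vector_fields_def mem_Collect_eq
proof
  have in_T: "coord_field M c y p \<in> tangent_space M p" if "p \<in> \<Omega>" for p
    using that \<Omega> c by (intro coord_field_in) (auto simp: charts_at_def)
  then show "\<forall>p\<in>\<Omega>. coord_field M c y p \<in> tangent_space M p" by blast
  show "smooth_map_on M (tangent_bundle M) \<Omega> (coord_field M c y)"
  proof (rule smooth_map_onI[OF ch charted_tangent_bundle \<Omega>(1)])
    show "coord_field M c y ` \<Omega> \<subseteq> points (tangent_bundle M)"
      unfolding points_tangent_bundle by (rule image_subsetI) (rule tangent_space_imp_vectors[OF in_T])
    fix a td assume a: "a \<in> charts M" and "td \<in> charts (tangent_bundle M)"
    then obtain d where d: "d \<in> charts M" "td = tchart M d" by (auto simp: charts_tangent_bundle)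
    have set: "{p \<in> \<Omega> \<inter> fst a. coord_field M c y p \<in> fst td} = (\<Omega> \<inter> fst d) \<inter> fst a"
      using tangent_space_imp_vectors[OF in_T] by (auto simp: d fst_tchart)
    let ?S = "snd a ` ((\<Omega> \<inter> fst d) \<inter> fst a)"
    have op: "open ?S"
      by (rule charted_open_image[OF ch a openin_Int[OF \<Omega>(1) charted_openin_chart[OF ch d(1)]]])
    note inv = chart_inv_chart[OF charted_inj[OF ch a]]
    have 1: "smooth_on ?S (snd d \<circ> chart_inv a)"
      by (rule smooth_on_subset[OF MM.transition_smooth[OF a d(1)]]) auto
    have 2: "smooth_on ?S (snd c \<circ> chart_inv a)"
      by (rule smooth_on_subset[OF MM.transition_smooth[OF a c]]) (use \<Omega>(2) in auto)
    \<comment> \<open>The components of the field in d are computed by passing from the chart a to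
      c, where the field has the constant component vector y, and from there to d.\<close>
    have 3: "smooth_on ?S (\<lambda>x. Df (snd d \<circ> chart_inv c) ((snd c \<circ> chart_inv a) x) y)"
      by (rule smooth_on_frechet_apply[OF op MM.transition_smooth[OF c d(1)] 2 _ smooth_on_const])
         (use \<Omega>(2) in \<open>auto simp: inv\<close>)
    have "smooth_on ?S (\<lambda>x. snd td (coord_field M c y (chart_inv a x)))"
      by (rule smooth_on_cong[OF op _ smooth_on_Pair[OF op 1 3]])
         (auto simp: inv d(2) snd_tchart coord_field_def charts_at_def d(1))
    then show "open (snd a ` {p \<in> \<Omega> \<inter> fst a. coord_field M c y p \<in> fst td}) \<and>
       smooth_on (snd a ` {p \<in> \<Omega> \<inter> fst a. coord_field M c y p \<in> fst td})
         (\<lambda>x. snd td (coord_field M c y (chart_inv a x)))"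
      using op unfolding set by blast
  qed
qed

lemma vector_fields_cong:
  assumes "X \<in> vector_fields M \<Omega>" "\<And>p. p \<in> \<Omega> \<Longrightarrow> X p = Y p"
  shows "Y \<in> vector_fields M \<Omega>"
  using assms smooth_map_on_cong[OF ch charted_tangent_bundle, of \<Omega> X Y]
  by (auto simp: vector_fields_def)

lemma tderiv_coord:
  assumes v: "v \<in> tangent_space M p" and c: "c \<in> charts_at M p"
    and f: "((f \<circ> chart_inv c) has_derivative f') (at (snd c p))"
  shows "tderiv M v f = f' (snd v c)"
proof -
  define a where "a = (SOME c. c \<in> charts_at M p)"
  have a: "a \<in> charts_at M p" unfolding a_def using c by (rule someI)
  \<comment> \<open>The function f is regarded as the coordinate map of a chart on the whole type,
    so that the chain rule for three charts applies; it asks for injectivity only of the first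
    two.\<close>
  have "tderiv M v f = Df (snd (UNIV :: 'm set, f) \<circ> chart_inv a) (snd a p) (snd v a)"
    using tangent_space_fst[OF v] by (simp add: tderiv_def a_def Let_def)
  also have "\<dots> = Df (snd (UNIV :: 'm set, f) \<circ> chart_inv c) (snd c p)
      (Df (snd c \<circ> chart_inv a) (snd a p) (snd v a))"
    using a c f charted_inj[OF ch] MM.transition_open MM.transition_differentiable[OF a c]
    by (intro coordinate_change_chain) (auto simp: charts_at_def differentiable_def)
  also have "\<dots> = f' (snd v c)"
    by (simp add: tangent_space_snd[OF v a c] frechet_derivative_eqI[OF f])
  finally show ?thesis .
qed

lemma tdom_open: "openin (mtop (tangent_bundle M)) W \<Longrightarrow> c \<in> charts M \<Longrightarrow> open (tdom c W)"
  by (simp add: openin_tangent_bundle)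

end

section \<open>The fundamental tensor and the Cartan tensor in a chart\<close>

locale finsler = smooth_mfd M for M :: "('m, 'e::euclidean_space) manifold" +
  fixes U :: "('m, 'e) tvec set" and L :: "('m, 'e) tvec \<Rightarrow> real"
  assumes finsler: "conic_pseudo_finsler M U L"
begin

lemma U_open: "openin (mtop (tangent_bundle M)) U"
  using finsler by (simp add: conic_pseudo_finsler_def conic_domain_def)

lemma U_vectors: "U \<subseteq> tangent_vectors M"
  using U_open by (simp add: openin_tangent_bundle)

lemma U_scale: "v \<in> U \<Longrightarrow> a > 0 \<Longrightarrow> tscale a v \<in> U"
  using finsler by (simp add: conic_pseudo_finsler_def conic_domain_def)

lemma L_scale: "v \<in> U \<Longrightarrow> a > 0 \<Longrightarrow> L (tscale a v) = a\<^sup>2 * L v"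
  using finsler by (simp add: conic_pseudo_finsler_def)

definition Lc :: "('m, 'e) chart \<Rightarrow> 'e \<times> 'e \<Rightarrow> real" where
  "Lc c z = L (tinv c z)"

text \<open>The fundamental tensor in the chart c, as \<open>fund_tensor_coord\<close> shows: half
  the fibre Hessian of \<open>Lc c\<close>, with z the coordinates of the base vector.\<close>

definition gc :: "('m, 'e) chart \<Rightarrow> 'e \<times> 'e \<Rightarrow> 'e \<Rightarrow> 'e \<Rightarrow> real" where
  "gc c z u w = 1/2 * Df (\<lambda>q. Df (Lc c) q (0, w)) z (0, u)"

lemma tinv_scale:
  "c \<in> charts M \<Longrightarrow> fst z \<in> snd c ` fst c \<Longrightarrow> tinv c (fst z, t *\<^sub>R snd z) = tscale t (tinv c z)"
  by (simp add: tinv_def coord_field_scale[OF chart_inv_charts_at])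

lemma Lc_smooth:
  assumes c: "c \<in> charts M" shows "smooth_on (tdom c U) (Lc c)"
proof -
  have L: "smooth_map_on (tangent_bundle M) euclid U L"
    using finsler by (simp add: conic_pseudo_finsler_def)
  have tc: "tchart M c \<in> charts (tangent_bundle M)" using c by (simp add: charts_tangent_bundle)
  from smooth_map_on_euclidD[OF charted_tangent_bundle L tc]
  have "smooth_on (tdom c U) (\<lambda>z. L (chart_inv (tchart M c) z))"
    by (simp add: tchart_image[OF c U_vectors])
  then show ?thesis
    by (rule smooth_on_cong[OF tdom_open[OF U_open c], rotated]) (auto simp: Lc_def tdom_def tchart_inv[OF c])
qed

lemma tdom_U_open: "c \<in> charts M \<Longrightarrow> open (tdom c U)"
  by (rule tdom_open[OF U_open])

lemma fibrewise_homogeneous_Lc: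
  assumes c: "c \<in> charts M" shows "fibrewise_homogeneous (tdom c U) (Lc c) 2"
proof
  show "(x, t *\<^sub>R y) \<in> tdom c U" if "(x, y) \<in> tdom c U" "t > 0" for x y t
    using that tinv_scale[OF c, of "(x, y)" t] U_scale by (simp add: tdom_def)
  show "Lc c (x, t *\<^sub>R y) = t\<^sup>2 * Lc c (x, y)" if "(x, y) \<in> tdom c U" "t > 0" for x y t
    using that tinv_scale[OF c, of "(x, y)" t] L_scale by (simp add: tdom_def Lc_def)
qed (use c tdom_U_open Lc_smooth in auto)

lemma fibrewise_homogeneous_DLc:
  "c \<in> charts M \<Longrightarrow> fibrewise_homogeneous (tdom c U) (\<lambda>q. Df (Lc c) q (0, w)) 1"
  by (rule fibrewise_homogeneous.fibrewise_homogeneous_derivative[OF fibrewise_homogeneous_Lc]) auto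

text \<open>Euler's theorem in degree 1 for the fibre derivatives of \<open>Lc c\<close>, followed
  by degree 2 for \<open>Lc c\<close> itself.\<close>

lemma gc_radial:
  assumes c: "c \<in> charts M" and z: "(x, y) \<in> tdom c U"
  shows "gc c (x, y) y w = 1/2 * Df (Lc c) (x, y) (0, w)"
    "gc c (x, y) y y = Lc c (x, y)"
proof -
  show 1: "gc c (x, y) y w = 1/2 * Df (Lc c) (x, y) (0, w)" for w
    unfolding gc_def using fibrewise_homogeneous.euler_identity[OF fibrewise_homogeneous_DLc[OF c] z] by simp
  show "gc c (x, y) y y = Lc c (x, y)"
    unfolding 1 using fibrewise_homogeneous.euler_identity[OF fibrewise_homogeneous_Lc[OF c] z] by simp
qed

text \<open>Two fibre derivatives lower the degree from 2 to 0. This is what makes the Cartan tensor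
  vanish in the radial direction.\<close>

lemma gc_scale:
  assumes c: "c \<in> charts M" and z: "(x, y) \<in> tdom c U" and t: "t > 0"
  shows "gc c (x, t *\<^sub>R y) u w = gc c (x, y) u w"
  unfolding gc_def
  using fibrewise_homogeneous.derivative_scaled[OF fibrewise_homogeneous_DLc[OF c] z t, of w u] t by simp

lemma gc_linear: "c \<in> charts M \<Longrightarrow> z \<in> tdom c U \<Longrightarrow> linear (\<lambda>u. gc c z u w)"
  unfolding gc_def
  by (intro linear_compose[where f = "\<lambda>u. (0, u)" and g = "frechet_derivative _ _", unfolded comp_def]
      linear_compose_scale_right[where 'b = real, unfolded real_scaleR_def]
      smooth_on_linear_frechet[OF smooth_on_frechet[OF Lc_smooth]]) (auto simp: linear_iff)

lemma gc_sym: "c \<in> charts M \<Longrightarrow> z \<in> tdom c U \<Longrightarrow> gc c z u w = gc c z w u"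
  unfolding gc_def by (simp only: symmetric_derivative[OF tdom_U_open Lc_smooth])

lemma gc_linear_right: "c \<in> charts M \<Longrightarrow> z \<in> tdom c U \<Longrightarrow> linear (\<lambda>w. gc c z u w)"
  by (subst gc_sym) (auto intro: gc_linear)

lemma fund_tensor_coord:
  assumes c: "c \<in> charts M" and z: "z \<in> tdom c U" and p: "p = chart_inv c (fst z)"
  shows "fund_tensor L (tinv c z) (coord_field M c u p) (coord_field M c w p) = gc c z u w"
proof -
  obtain x y where xy: "z = (x, y)" by (cases z)
  have x: "x \<in> snd c ` fst c" using z by (simp add: xy tdom_def)
  have cp: "c \<in> charts_at M p" using x c by (simp add: p xy chart_inv_charts_at)
  have L: "L (tadd (tadd (tinv c z) (tscale t (coord_field M c u p))) (tscale s (coord_field M c w p))) =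
      Lc c ((x, y + t *\<^sub>R u) + s *\<^sub>R (0, w))" for t s
    using cp by (simp add: Lc_def tinv_def xy p coord_field_add coord_field_scale)
  note smooth = Lc_smooth[OF c]
  \<comment> \<open>The inner derivative has the stated value only while the moving base vector
    stays in U. The admissible t form an open set around 0, which is enough for the outer derivative
    at 0.\<close>
  have line: "open ((\<lambda>t. (x, y) + t *\<^sub>R (0, u)) -` tdom c U)" (is "open ?T")
    by (intro open_vimage tdom_U_open c) (intro continuous_intros)
  have T0: "0 \<in> ?T" using z by (simp add: xy)
  have inner: "deriv (\<lambda>s. Lc c ((x, y + t *\<^sub>R u) + s *\<^sub>R (0, w))) 0 =
      Df (Lc c) ((x, y) + t *\<^sub>R (0, u)) (0, w)" if "t \<in> ?T" for t
    using smooth_on_line_derivative[OF smooth, of "(x, y + t *\<^sub>R u)" 0 "(0, w)"] that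
    by (intro DERIV_imp_deriv) simp
  have ev: "\<forall>\<^sub>F t in nhds 0. deriv (\<lambda>s. Lc c ((x, y + t *\<^sub>R u) + s *\<^sub>R (0, w))) 0 =
      Df (Lc c) ((x, y) + t *\<^sub>R (0, u)) (0, w)"
    using eventually_nhds_in_open[OF line T0] by (rule eventually_mono) (rule inner)
  have "fund_tensor L (tinv c z) (coord_field M c u p) (coord_field M c w p) =
      1/2 * deriv (\<lambda>t. Df (Lc c) ((x, y) + t *\<^sub>R (0, u)) (0, w)) 0"
    unfolding fund_tensor_def L by (simp only: deriv_cong_ev[OF ev refl])
  also have "deriv (\<lambda>t. Df (Lc c) ((x, y) + t *\<^sub>R (0, u)) (0, w)) 0 =
      Df (\<lambda>q. Df (Lc c) q (0, w)) ((x, y) + 0 *\<^sub>R (0, u)) (0, u)"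
    using z by (intro DERIV_imp_deriv smooth_on_line_derivative[OF smooth_on_frechet[OF smooth]]) (simp add: xy)
  finally show ?thesis by (simp add: gc_def xy)
qed

lemma gc_nondegenerate:
  assumes c: "c \<in> charts M" and z: "z \<in> tdom c U" and u: "\<And>w. gc c z u w = 0"
  shows "u = 0"
proof -
  define p where "p = chart_inv c (fst z)"
  have cp: "c \<in> charts_at M p" using z c by (simp add: p_def chart_inv_charts_at tdom_def)
  have v: "tinv c z \<in> U" "fst (tinv c z) = p" using z by (auto simp: tdom_def p_def)
  then have "nondegenerate_on (tangent_space M p) (tzero p) (fund_tensor L (tinv c z))"
    using finsler by (auto simp: conic_pseudo_finsler_def)
  moreover have "fund_tensor L (tinv c z) (coord_field M c u p) w = 0" if "w \<in> tangent_space M p" for w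
    by (subst tangent_vector_eq[OF that cp]) (simp add: fund_tensor_coord[OF c z p_def] u)
  ultimately have "coord_field M c u p = tzero p"
    using coord_field_in[OF cp] unfolding nondegenerate_on_def by blast
  then have "snd (coord_field M c u p) c = snd (tzero p) c" by simp
  then show "u = 0" by (simp add: cp)
qed

text \<open>Moving the base vector v along itself only rescales it by 1 + t, and for t > -1 this
  leaves the fundamental tensor unchanged.\<close>

lemma cartan_tensor_radial:
  assumes c: "c \<in> charts M" and z: "z \<in> tdom c U" and p: "p = chart_inv c (fst z)"
  shows "cartan_tensor L (tinv c z) (tinv c z) (coord_field M c u p) (coord_field M c w p) = 0"
proof -
  obtain x y where xy: "z = (x, y)" by (cases z)
  have "tadd (tinv c z) (tscale t (tinv c z)) = tinv c (x, (1 + t) *\<^sub>R y)" for t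
    by (rule tvec_eqI) (use tinv_scale[OF c, of z "1 + t"] z in \<open>auto simp: xy tdom_def algebra_simps\<close>)
  moreover have "fund_tensor L (tinv c (x, (1 + t) *\<^sub>R y)) (coord_field M c u p) (coord_field M c w p) = gc c z u w"
    if t: "t \<in> {-1<..}" for t
  proof -
    have pos: "1 + t > 0" using t by simp
    have "(x, (1 + t) *\<^sub>R y) \<in> tdom c U"
      by (rule fibrewise_homogeneous.cone[OF fibrewise_homogeneous_Lc[OF c] _ pos]) (use z xy in simp)
    then show ?thesis
      using fund_tensor_coord[OF c, of "(x, (1 + t) *\<^sub>R y)" p u w] gc_scale[OF c _ pos, of x y u w] z by (simp add: xy p)
  qed
  ultimately have "\<forall>\<^sub>F t in nhds 0. fund_tensor L (tadd (tinv c z) (tscale t (tinv c z)))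
      (coord_field M c u p) (coord_field M c w p) = gc c z u w"
    using eventually_nhds_in_open[of "{-1<..}" "0::real"] by (auto elim!: eventually_mono)
  then show ?thesis unfolding cartan_tensor_def by (subst deriv_cong_ev[OF _ refl]) auto
qed

end

section \<open>The Chern connection in a chart\<close>

locale chern = finsler M U L for M :: "('m, 'e::euclidean_space) manifold" and U L +
  fixes nab :: "('m, 'e) tvec \<Rightarrow> ('m \<Rightarrow> ('m, 'e) tvec) \<Rightarrow> ('m \<Rightarrow> ('m, 'e) tvec) \<Rightarrow> ('m, 'e) tvec"
  assumes chern: "chern_connection M U L nab"
begin

lemma chern_smooth:
  "X \<in> vector_fields M \<Omega> \<Longrightarrow> Y \<in> vector_fields M \<Omega> \<Longrightarrow>
    anisotropic_vector_field M {v \<in> U. fst v \<in> \<Omega>} (\<lambda>v. nab v X Y)"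
  by (rule conjunct1[OF conjunct1[OF chern[unfolded chern_connection_def anisotropic_connection_def]], rule_format])

lemma chern_linear:
  "V \<in> vector_fields M \<Omega> \<Longrightarrow> V ` \<Omega> \<subseteq> U \<Longrightarrow> linear_connection M \<Omega> (\<lambda>X Y p. nab (V p) X Y)"
  by (rule conjunct2[OF conjunct1[OF chern[unfolded chern_connection_def anisotropic_connection_def]], rule_format])

lemma chern_torsion_free:
  "X \<in> vector_fields M \<Omega> \<Longrightarrow> Y \<in> vector_fields M \<Omega> \<Longrightarrow> v \<in> U \<Longrightarrow> fst v \<in> \<Omega> \<Longrightarrow>
    tadd (nab v X Y) (tscale (-1) (nab v Y X)) = lie_bracket M X Y (fst v)"
  by (rule conjunct1[OF conjunct2[OF chern[unfolded chern_connection_def]], rule_format])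

lemma chern_metric:
  "V \<in> vector_fields M \<Omega> \<Longrightarrow> X \<in> vector_fields M \<Omega> \<Longrightarrow> Y \<in> vector_fields M \<Omega> \<Longrightarrow> Z \<in> vector_fields M \<Omega> \<Longrightarrow>
    V ` \<Omega> \<subseteq> U \<Longrightarrow> p \<in> \<Omega> \<Longrightarrow>
    tderiv M (X p) (\<lambda>q. fund_tensor L (V q) (Y q) (Z q)) =
            fund_tensor L (V p) (nab (V p) X Y) (Z p) +
            fund_tensor L (V p) (Y p) (nab (V p) X Z) +
            2 * cartan_tensor L (V p) (Y p) (Z p) (nab (V p) X V)"
  by (rule conjunct2[OF conjunct2[OF chern[unfolded chern_connection_def]], rule_format])

text \<open>The Christoffel symbols as a vector-valued map of arbitrary constant component vectors a
  and b; \<open>christoffel\<close> lists its components on basis vectors.\<close>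

definition Gam :: "('m, 'e) chart \<Rightarrow> 'e \<times> 'e \<Rightarrow> 'e \<Rightarrow> 'e \<Rightarrow> 'e" where
  "Gam c z a b = snd (nab (tinv c z) (coord_field M c a) (coord_field M c b)) c"

text \<open>The coordinate field with components \<open>y\<close> extends the vector with coordinates \<open>(x, y)\<close> to a
  local field with values in \<open>U\<close>.\<close>

definition dom :: "('m, 'e) chart \<Rightarrow> 'e \<Rightarrow> 'm set" where
  "dom c y = {q \<in> fst c. coord_field M c y q \<in> U}"

lemma dom_open: assumes c: "c \<in> charts M" shows "openin (mtop M) (dom c y)"
proof -
  have "smooth_map_on M (tangent_bundle M) (fst c) (coord_field M c y)"
    using coord_field_vector_field[OF c charted_openin_chart[OF ch c] order_refl] by (simp add: vector_fields_def)
  from smooth_map_on_openin_preimage[OF this U_open] show ?thesis by (simp add: dom_def)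
qed

lemma coord_field_dom: "c \<in> charts M \<Longrightarrow> coord_field M c a \<in> vector_fields M (dom c y)"
  by (rule coord_field_vector_field[OF _ dom_open]) (auto simp: dom_def)

lemma dom_point: "(x, y) \<in> tdom c U \<Longrightarrow> chart_inv c x \<in> dom c y"
  by (simp add: tdom_def dom_def tinv_def chart_inv_in)

lemma connection_dom:
  assumes c: "c \<in> charts M"
  shows "linear_connection M (dom c y) (\<lambda>X Y p. nab (coord_field M c y p) X Y)"
  by (rule chern_linear[OF coord_field_dom[OF c]]) (auto simp: dom_def)

lemma nab_in:
  assumes c: "c \<in> charts M" and z: "z \<in> tdom c U"
  shows "nab (tinv c z) (coord_field M c a) (coord_field M c b) \<in> tangent_space M (chart_inv c (fst z))"
proof -
  have "anisotropic_vector_field M {v \<in> U. fst v \<in> dom c (snd z)} (\<lambda>v. nab v (coord_field M c a) (coord_field M c b))"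
    by (rule chern_smooth[OF coord_field_dom[OF c] coord_field_dom[OF c]])
  moreover have "tinv c z \<in> {v \<in> U. fst v \<in> dom c (snd z)}"
    using z dom_point[of "fst z" "snd z" c] by (auto simp: tdom_def)
  ultimately have "nab (tinv c z) (coord_field M c a) (coord_field M c b) \<in> tangent_space M (fst (tinv c z))"
    unfolding anisotropic_vector_field_def by blast
  then show ?thesis by (simp only: tinv_fst)
qed

lemma nab_coord:
  assumes c: "c \<in> charts M" and z: "z \<in> tdom c U" and p: "p = chart_inv c (fst z)"
  shows "nab (tinv c z) (coord_field M c a) (coord_field M c b) = coord_field M c (Gam c z a b) p"
  unfolding Gam_def p
  by (rule tangent_vector_eq[OF nab_in[OF c z] chart_inv_charts_at[OF c]]) (use z in \<open>simp add: tdom_def\<close>)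

text \<open>The axioms speak of linearity only after a local field V in U has been inserted; the
  coordinate field with component vector \<open>snd z\<close> is such a V. A sum of coordinate
  fields is the coordinate field of the sum only over the chart, hence the appeals to the locality
  clause \<open>cong\<close>.\<close>

lemma Gam_linear:
  assumes c: "c \<in> charts M" and z: "z \<in> tdom c U"
  shows "linear (\<lambda>a. Gam c z a b)" "linear (\<lambda>b. Gam c z a b)"
proof -
  obtain x y where xy: "z = (x, y)" by (cases z)
  let ?p = "chart_inv c x" and ?\<Omega> = "dom c y"
  let ?nab = "\<lambda>X Y p. nab (coord_field M c y p) X Y"
  let ?X = "coord_field M c"
  note vf = coord_field_dom[OF c, of _ y]
  have p: "?p \<in> ?\<Omega>" using dom_point z by (simp add: xy)
  have v: "tinv c z = coord_field M c y ?p" by (simp add: xy tinv_def)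
  have cat: "c \<in> charts_at M q" if "q \<in> ?\<Omega>" for q using that c by (auto simp: dom_def charts_at_def)
  have G: "Gam c z a b = snd (?nab (?X a) (?X b) ?p) c" for a b by (simp add: Gam_def v)
  have add_vf: "(\<lambda>q. tadd (?X a q) (?X b q)) \<in> vector_fields M ?\<Omega>" for a b
    by (rule vector_fields_cong[OF vf[of "a + b"]]) (simp add: coord_field_add[OF cat])
  have scale_vf: "(\<lambda>q. tscale r (?X a q)) \<in> vector_fields M ?\<Omega>" for r a
    by (rule vector_fields_cong[OF vf[of "r *\<^sub>R a"]]) (simp add: coord_field_scale[OF cat])
  have const: "smooth_map_on M euclid ?\<Omega> (\<lambda>q. r)" for r :: real
    by (rule smooth_map_on_euclidI[OF ch dom_open[OF c] smooth_on_const])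
  note C = connection_dom[OF c, of y, unfolded linear_connection_def]
  have cong: "?nab X Y ?p = ?nab X' Y' ?p"
    if "X \<in> vector_fields M ?\<Omega>" "X' \<in> vector_fields M ?\<Omega>" "Y \<in> vector_fields M ?\<Omega>" "Y' \<in> vector_fields M ?\<Omega>"
      "\<And>q. q \<in> ?\<Omega> \<Longrightarrow> X q = X' q \<and> Y q = Y' q" for X X' Y Y'
    using conjunct1[OF C] that p by blast
  have addl: "?nab (\<lambda>q. tadd (?X a q) (?X a' q)) (?X b) ?p = tadd (?nab (?X a) (?X b) ?p) (?nab (?X a') (?X b) ?p)" for a a' b
    using conjunct1[OF conjunct2[OF conjunct2[OF C]]] vf p by blast
  have addr: "?nab (?X b) (\<lambda>q. tadd (?X a q) (?X a' q)) ?p = tadd (?nab (?X b) (?X a) ?p) (?nab (?X b) (?X a') ?p)" for a a' b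
    using conjunct1[OF conjunct2[OF conjunct2[OF conjunct2[OF C]]]] vf p by blast
  have scale: "?nab (\<lambda>q. tscale r (?X a q)) (?X b) ?p = tscale r (?nab (?X a) (?X b) ?p)"
    "?nab (?X a) (\<lambda>q. tscale r (?X b q)) ?p =
      tadd (tscale (tderiv M (?X a ?p) (\<lambda>q. r)) (?X b ?p)) (tscale r (?nab (?X a) (?X b) ?p))" for r a b
    using conjunct2[OF conjunct2[OF conjunct2[OF conjunct2[OF C]]]] const[of r] vf p by blast+
  \<comment> \<open>For constant scalars the derivative term of the Leibniz rule vanishes.\<close>
  have "tderiv M w (\<lambda>q. r) = 0" for w and r :: real by (simp add: tderiv_def comp_def)
  note scale = scale[unfolded this]
  show "linear (\<lambda>a. Gam c z a b)"
  proof (rule linearI)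
    show "Gam c z (a + a') b = Gam c z a b + Gam c z a' b" for a a'
      using addl[of a a' b] cong[OF vf[of "a + a'"] add_vf[of a a'] vf[of b] vf[of b]]
      by (simp add: G coord_field_add[OF cat])
    show "Gam c z (r *\<^sub>R a) b = r *\<^sub>R Gam c z a b" for r a
      using scale(1)[of r a b] cong[OF vf[of "r *\<^sub>R a"] scale_vf[of r a] vf[of b] vf[of b]]
      by (simp add: G coord_field_scale[OF cat])
  qed
  show "linear (\<lambda>b. Gam c z a b)"
  proof (rule linearI)
    show "Gam c z a (b + b') = Gam c z a b + Gam c z a b'" for b b'
      using addr[of a b b'] cong[OF vf[of a] vf[of a] vf[of "b + b'"] add_vf[of b b']]
      by (simp add: G coord_field_add[OF cat])
    show "Gam c z a (r *\<^sub>R b) = r *\<^sub>R Gam c z a b" for r b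
      using scale(2)[of a r b] cong[OF vf[of a] vf[of a] vf[of "r *\<^sub>R b"] scale_vf[of r b]]
      by (simp add: G coord_field_scale[OF cat])
  qed
qed

text \<open>Coordinate fields commute: their components in c are constant, so their bracket vanishes
  and torsion-freeness becomes symmetry.\<close>

lemma Gam_sym:
  assumes c: "c \<in> charts M" and z: "z \<in> tdom c U"
  shows "Gam c z a b = Gam c z b a"
proof -
  let ?p = "chart_inv c (fst z)"
  have x: "fst z \<in> snd c ` fst c" using z by (simp add: tdom_def)
  have cp: "c \<in> charts_at M ?p" by (rule chart_inv_charts_at[OF c x])
  have D0: "Df (\<lambda>x. snd (coord_field M c b (chart_inv c x)) c) (fst z) = (\<lambda>h. 0)" for b
  proof -
    have "Df (\<lambda>x. snd (coord_field M c b (chart_inv c x)) c) (fst z) =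
        Df (\<lambda>x. b) (fst z)"
      by (rule frechet_derivative_cong_open[OF charted_chart_image_open[OF ch c] x])
         (simp add: coord_field_self[OF chart_inv_charts_at[OF c]])
    then show ?thesis by simp
  qed
  have "tadd (nab (tinv c z) (coord_field M c a) (coord_field M c b))
      (tscale (-1) (nab (tinv c z) (coord_field M c b) (coord_field M c a))) =
      lie_bracket M (coord_field M c a) (coord_field M c b) (fst (tinv c z))"
  proof -
    have "tinv c z \<in> U" "fst (tinv c z) \<in> dom c (snd z)"
      using z dom_point[of "fst z" "snd z" c] by (auto simp: tdom_def)
    then show ?thesis by (rule chern_torsion_free[OF coord_field_dom[OF c] coord_field_dom[OF c]])
  qed
  then have "Gam c z a b - Gam c z b a = snd (lie_bracket M (coord_field M c a) (coord_field M c b) ?p) c"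
    unfolding Gam_def by (metis tadd_simps(2) tscale_simps(2) tinv_fst scaleR_minus1_left uminus_add_conv_diff add.commute)
  also have "\<dots> = 0" using cp by (simp add: lie_bracket_def chart_chart_inv[OF x] D0)
  finally show ?thesis by simp
qed

text \<open>The derivative f' is left abstract because both applications know it in closed form: by
  Euler's theorem \<open>gc c (x, y) y w\<close> is half a fibre derivative of \<open>Lc c\<close>,
  and \<open>gc c (x, y) y y\<close> is \<open>Lc c\<close> itself.\<close>

lemma metric_compatible_coord:
  assumes c: "c \<in> charts M" and z: "(x, y) \<in> tdom c U"
    and f: "((\<lambda>x. gc c (x, y) y w) has_derivative f') (at x)"
  shows "f' a = gc c (x, y) (Gam c (x, y) a y) w + gc c (x, y) y (Gam c (x, y) a w)"
proof -
  let ?p = "chart_inv c x" and ?X = "coord_field M c" and ?z = "(x, y)"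
  have x: "x \<in> snd c ` fst c" using z by (simp add: tdom_def)
  have cp: "c \<in> charts_at M ?p" by (rule chart_inv_charts_at[OF c x])
  have nab_X: "nab (?X y ?p) (?X a) (?X b) = ?X (Gam c ?z a b) ?p" for b
    using nab_coord[OF c z, of ?p a b] by (simp add: tinv_def)
  have fund: "fund_tensor L (?X y ?p) (?X u ?p) (?X w ?p) = gc c ?z u w" for u w
    using fund_tensor_coord[OF c z, of ?p u w] by (simp add: tinv_def)
  have cartan: "cartan_tensor L (?X y ?p) (?X y ?p) (?X u ?p) (?X w ?p) = 0" for u w
    using cartan_tensor_radial[OF c z, of ?p u w] by (simp add: tinv_def)
  have "?X y ` dom c y \<subseteq> U" by (auto simp: dom_def)
  then have "tderiv M (?X a ?p) (\<lambda>q. fund_tensor L (?X y q) (?X y q) (?X w q)) =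
            fund_tensor L (?X y ?p) (nab (?X y ?p) (?X a) (?X y)) (?X w ?p) +
            fund_tensor L (?X y ?p) (?X y ?p) (nab (?X y ?p) (?X a) (?X w)) +
            2 * cartan_tensor L (?X y ?p) (?X y ?p) (?X w ?p) (nab (?X y ?p) (?X a) (?X y))"
    by (rule chern_metric[OF coord_field_dom[OF c] coord_field_dom[OF c] coord_field_dom[OF c]
          coord_field_dom[OF c] _ dom_point[OF z]])
  also have "\<dots> = gc c ?z (Gam c ?z a y) w + gc c ?z y (Gam c ?z a w)"
    by (simp add: nab_X fund cartan)
  also have "tderiv M (?X a ?p) (\<lambda>q. fund_tensor L (?X y q) (?X y q) (?X w q)) = f' (snd (?X a ?p) c)"
  proof (rule tderiv_coord[OF coord_field_in[OF cp] cp])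
    have op: "open {x. (x, y) \<in> tdom c U}"
      using open_vimage[OF tdom_U_open[OF c], of "\<lambda>x. (x, y)"] by (simp add: vimage_def continuous_intros)
    show "((\<lambda>q. fund_tensor L (?X y q) (?X y q) (?X w q)) \<circ> chart_inv c has_derivative f') (at (snd c ?p))"
      unfolding chart_chart_inv[OF x]
    proof (rule has_derivative_transform_within_open[OF f op])
      show "x \<in> {x. (x, y) \<in> tdom c U}" using z by simp
      fix x' assume "x' \<in> {x. (x, y) \<in> tdom c U}"
      then have "fund_tensor L (tinv c (x', y)) (?X y (chart_inv c x')) (?X w (chart_inv c x')) = gc c (x', y) y w"
        by (intro fund_tensor_coord[OF c]) auto
      then show "gc c (x', y) y w = ((\<lambda>q. fund_tensor L (?X y q) (?X y q) (?X w q)) \<circ> chart_inv c) x'"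
        by (simp add: tinv_def)
    qed
  qed
  finally show ?thesis by (simp add: cp)
qed

text \<open>Metric compatibility for X = y, Z = w and for X = w, Z = y both contain the unknown term
  \<open>gc c (x, y) y (Gam c (x, y) y w)\<close>, the second one by symmetry of \<open>Gam\<close>.
  Eliminating it leaves \<open>Gam c (x, y) y y\<close> expressed through derivatives of
  \<open>Lc c\<close>.\<close>

theorem chern_euler_lagrange:
  assumes c: "c \<in> charts M" and z: "(x, y) \<in> tdom c U"
  shows "gc c (x, y) (a + Gam c (x, y) y y) w = 1/2 * euler_lagrange (Lc c) (x, y) a w"
proof -
  let ?z = "(x, y)"
  let ?k = "\<lambda>w q. Df (Lc c) q (0, w)"
  have op: "open {x. (x, y) \<in> tdom c U}"
    using open_vimage[OF tdom_U_open[OF c], of "\<lambda>x. (x, y)"] by (simp add: vimage_def continuous_intros)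
  have x: "x \<in> {x. (x, y) \<in> tdom c U}" using z by simp
  have slice: "((\<lambda>x. k (x, y)) has_derivative (\<lambda>e. Df k ?z (e, 0))) (at x)"
    if "smooth_on (tdom c U) k" for k :: "'e \<times> 'e \<Rightarrow> real"
    by (rule has_derivative_compose[where f = "\<lambda>x. (x, y)" and g = k, OF _ smooth_on_imp_has_derivative[OF that z]])
       (auto intro!: derivative_eq_intros)
  have "((\<lambda>x. gc c (x, y) y w) has_derivative (\<lambda>e. 1/2 * Df (?k w) ?z (e, 0))) (at x)"
    by (rule has_derivative_transform_within_open[OF
          has_derivative_mult_right[OF slice[OF smooth_on_frechet[OF Lc_smooth[OF c]]]] op x])
       (simp add: gc_radial(1)[OF c])
  from metric_compatible_coord[OF c z this, of y]
  have 1: "1/2 * Df (?k w) ?z (y, 0) =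
      gc c ?z (Gam c ?z y y) w + gc c ?z y (Gam c ?z y w)" .
  have "((\<lambda>x. gc c (x, y) y y) has_derivative (\<lambda>e. Df (Lc c) ?z (e, 0))) (at x)"
    by (rule has_derivative_transform_within_open[OF slice[OF Lc_smooth[OF c]] op x])
       (simp add: gc_radial(2)[OF c])
  from metric_compatible_coord[OF c z this, of w]
  have 2: "Df (Lc c) ?z (w, 0) = 2 * gc c ?z y (Gam c ?z y w)"
    using gc_sym[OF c z, of "Gam c ?z w y" y] Gam_sym[OF c z, of w y] by simp
  have "Df (?k w) ?z ((y, 0) + (0, a)) =
      Df (?k w) ?z (y, 0) + Df (?k w) ?z (0, a)"
    by (rule linear_add[OF smooth_on_linear_frechet[OF smooth_on_frechet[OF Lc_smooth[OF c]] z]])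
  then have "1/2 * euler_lagrange (Lc c) ?z a w = gc c ?z (Gam c ?z y y) w + gc c ?z a w"
    using 1 2 by (simp add: euler_lagrange_def gc_def)
  then show ?thesis by (simp add: linear_add[OF gc_linear[OF c z]])
qed

end

text \<open>The Hessian is the difference of the Euler--Lagrange expressions for the accelerations u
  and 0. Both are natural, and their images differ exactly by the image of u, because the term
  quadratic in the velocity is the same.\<close>

lemma fibre_hessian_natural:
  fixes \<phi> :: "'f::euclidean_space \<Rightarrow> 'e::euclidean_space"
  assumes S: "open S" and \<phi>: "smooth_on S \<phi>" and W: "open W" and l: "smooth_on W (l :: _ \<Rightarrow> real)"
    and W': "open W'" "(x, y) \<in> W'"
    and l': "\<And>q. q \<in> W' \<Longrightarrow> fst q \<in> S \<and> tangent_lift \<phi> q \<in> W \<and> l' q = l (tangent_lift \<phi> q)"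
  shows "Df (\<lambda>q. Df l' q (0, w)) (x, y) (0, u) =
    Df (\<lambda>q. Df l q (0, Df \<phi> x w)) (tangent_lift \<phi> (x, y)) (0, Df \<phi> x u)"
proof -
  have lift: "smooth_on W' (tangent_lift \<phi>)"
    by (rule smooth_on_tangent_lift[OF S \<phi> W'(1)]) (use l' in auto)
  have "smooth_on W' (\<lambda>q. l (tangent_lift \<phi> q))"
    by (rule smooth_on_compose[OF W'(1) _ lift l]) (use l' in auto)
  then have "smooth_on W' l'"
    by (rule smooth_on_cong[OF W'(1), rotated]) (simp add: l')
  then have 1: "euler_lagrange l' (x, y) (0 + u) w = euler_lagrange l' (x, y) 0 w +
      Df (\<lambda>q. Df l' q (0, w)) (x, y) (0, u)"
    by (rule euler_lagrange_acceleration[OF _ W'(2)])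
  have xy: "x \<in> S" "tangent_lift \<phi> (x, y) \<in> W" using l'[OF W'(2)] by auto
  let ?a = "Df (\<lambda>p. Df \<phi> p y) x y"
  have 2: "euler_lagrange l (tangent_lift \<phi> (x, y)) (?a + Df \<phi> x u) (Df \<phi> x w) =
      euler_lagrange l (tangent_lift \<phi> (x, y)) ?a (Df \<phi> x w) +
      Df (\<lambda>q. Df l q (0, Df \<phi> x w)) (tangent_lift \<phi> (x, y)) (0, Df \<phi> x u)"
    by (rule euler_lagrange_acceleration[OF l xy(2)])
  show ?thesis
    using 1 2 euler_lagrange_natural[OF S \<phi> W l W' l', of u w] euler_lagrange_natural[OF S \<phi> W l W' l', of 0 w]
      linear_0[OF smooth_on_linear_frechet[OF \<phi> xy(1)]] by simp
qed

section \<open>Submanifolds\<close>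

context inclusion
begin

sublocale TM: smooth_mfd M by unfold_locales (rule M)
sublocale TN: smooth_mfd N by unfold_locales (rule N)

definition trans :: "('m, 'f) chart \<Rightarrow> ('m, 'e) chart \<Rightarrow> 'f \<Rightarrow> 'e" where
  "trans c d = snd d \<circ> chart_inv c"

text \<open>The part of the coordinate space of TN, in the chart c, over which the chart d of M is
  available too; there the inclusion of TN in TM is a tangent lift.\<close>

definition tdom2 :: "('m, 'f) chart \<Rightarrow> ('m, 'e) chart \<Rightarrow> ('f \<times> 'f) set" where
  "tdom2 c d = snd c ` (fst c \<inter> fst d) \<times> UNIV"

lemma tdom2_open: "c \<in> charts N \<Longrightarrow> d \<in> charts M \<Longrightarrow> open (tdom2 c d)"
  by (simp add: tdom2_def open_Times transition_open)

lemma trans_smooth: "c \<in> charts N \<Longrightarrow> d \<in> charts M \<Longrightarrow> smooth_on (snd c ` (fst c \<inter> fst d)) (trans c d)"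
  by (simp add: trans_def transition_smooth)

lemma trans_linear:
  "c \<in> charts N \<Longrightarrow> d \<in> charts M \<Longrightarrow> x \<in> snd c ` (fst c \<inter> fst d) \<Longrightarrow> linear (Df (trans c d) x)"
  by (rule smooth_on_linear_frechet[OF trans_smooth])

lemma lift_smooth: "c \<in> charts N \<Longrightarrow> d \<in> charts M \<Longrightarrow> smooth_on (tdom2 c d) (tangent_lift (trans c d))"
  by (rule smooth_on_tangent_lift[OF transition_open trans_smooth tdom2_open]) (auto simp: tdom2_def)

lemma tdom2_charts_at:
  assumes "c \<in> charts N" "d \<in> charts M" "z \<in> tdom2 c d"
  shows "c \<in> charts_at N (chart_inv c (fst z))" "d \<in> charts_at M (chart_inv c (fst z))"
    "fst z \<in> snd c ` fst c" "trans c d (fst z) = snd d (chart_inv c (fst z))"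
    "trans c d (fst z) \<in> snd d ` fst d" "chart_inv d (trans c d (fst z)) = chart_inv c (fst z)"
  using assms chart_inv_chart[OF charted_inj[OF chN assms(1)]] chart_inv_chart[OF charted_inj[OF chM assms(2)]]
  by (auto simp: charts_at_def tdom2_def trans_def)

lemma tincl_fst [simp]: "fst (tincl M N v) = fst v"
  by (simp add: tincl_def tmap_def Let_def)

text \<open>\<open>tmap\<close> computes in an arbitrarily chosen source chart; the chain rule
  carries the formula over to any given chart c.\<close>

lemma tincl_snd:
  assumes v: "v \<in> tangent_space N p" and c: "c \<in> charts_at N p" and d: "d \<in> charts_at M p"
  shows "snd (tincl M N v) d = Df (trans c d) (snd c p) (snd v c)"
proof -
  define a where "a = (SOME c. c \<in> charts_at N p)"
  have a: "a \<in> charts_at N p" unfolding a_def using c by (rule someI)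
  have "snd (tincl M N v) d = Df (snd d \<circ> chart_inv a) (snd a p) (snd v a)"
    using TN.tangent_space_fst[OF v] d by (simp add: tincl_def tmap_def a_def Let_def comp_def)
  also have "snd v a = Df (snd a \<circ> chart_inv c) (snd c p) (snd v c)"
    by (rule TN.tangent_space_snd[OF v c a])
  also have "Df (snd d \<circ> chart_inv a) (snd a p) \<dots> =
      Df (snd d \<circ> chart_inv c) (snd c p) (snd v c)"
    by (rule transition_chain_source[OF c a d, symmetric])
  finally show ?thesis by (simp add: trans_def)
qed

lemma tincl_snd_zero: "d \<notin> charts_at M (fst v) \<Longrightarrow> snd (tincl M N v) d = 0"
  by (simp add: tincl_def tmap_def Let_def)

lemma tincl_in:
  assumes v: "v \<in> tangent_space N p" shows "tincl M N v \<in> tangent_space M p"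
proof (rule TM.tangent_spaceI)
  have p: "p \<in> points N" by (rule TN.tangent_space_points[OF v])
  show "fst (tincl M N v) = p" using TN.tangent_space_fst[OF v] by simp
  show "p \<in> points M" using p sub by blast
  show "snd (tincl M N v) d = 0" if "d \<notin> charts_at M p" for d
    using that TN.tangent_space_fst[OF v] by (simp add: tincl_snd_zero)
  obtain c where c: "c \<in> charts_at N p" using charted_ex_charts_at[OF chN p] by blast
  show "snd (tincl M N v) e = Df (snd e \<circ> chart_inv d) (snd d p) (snd (tincl M N v) d)"
    if "d \<in> charts_at M p" "e \<in> charts_at M p" for d e
    unfolding tincl_snd[OF v c that(1)] tincl_snd[OF v c that(2)] trans_def
    by (rule transition_chain_target[OF c that])
qed

lemma tincl_coord_field:
  assumes c: "c \<in> charts_at N p" and d: "d \<in> charts_at M p"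
  shows "tincl M N (coord_field N c y p) = coord_field M d (Df (trans c d) (snd c p) y) p"
  by (rule TM.tangent_space_eqI[OF tincl_in[OF TN.coord_field_in[OF c]] TM.coord_field_in[OF d] d])
     (simp add: tincl_snd[OF TN.coord_field_in[OF c] c d] c d)

lemma tincl_tinv:
  assumes c: "c \<in> charts N" and d: "d \<in> charts M" and z: "z \<in> tdom2 c d"
  shows "tincl M N (TN.tinv c z) = TM.tinv d (tangent_lift (trans c d) z)"
  using tincl_coord_field[OF tdom2_charts_at(1,2)[OF assms], of "snd z"] tdom2_charts_at(3,6)[OF assms]
  by (simp add: TN.tinv_def TM.tinv_def tangent_lift_def chart_chart_inv)

lemma tincl_add:
  assumes v: "v \<in> tangent_space N p" and w: "w \<in> tangent_space N p"
  shows "tincl M N (tadd v w) = tadd (tincl M N v) (tincl M N w)"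
proof -
  have p: "p \<in> points N" by (rule TN.tangent_space_points[OF v])
  obtain c where c: "c \<in> charts_at N p" using charted_ex_charts_at[OF chN p] by blast
  obtain d where d: "d \<in> charts_at M p" using charted_ex_charts_at[OF chM] p sub by blast
  show ?thesis
    by (rule TM.tangent_space_eqI[OF tincl_in[OF TN.tangent_space_add[OF v w]]
          TM.tangent_space_add[OF tincl_in[OF v] tincl_in[OF w]] d])
       (use c d trans_linear[of c d "snd c p"] in \<open>simp add: tincl_snd[OF _ c d] v w TN.tangent_space_add
          linear_add charts_at_def\<close>)
qed

lemma tincl_scale:
  assumes v: "v \<in> tangent_space N p"
  shows "tincl M N (tscale a v) = tscale a (tincl M N v)"
proof -
  have p: "p \<in> points N" by (rule TN.tangent_space_points[OF v])
  obtain c where c: "c \<in> charts_at N p" using charted_ex_charts_at[OF chN p] by blast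
  obtain d where d: "d \<in> charts_at M p" using charted_ex_charts_at[OF chM] p sub by blast
  show ?thesis
    by (rule TM.tangent_space_eqI[OF tincl_in[OF TN.tangent_space_scale[OF v]]
          TM.tangent_space_scale[OF tincl_in[OF v]] d])
       (use c d trans_linear[of c d "snd c p"] in \<open>simp add: tincl_snd[OF _ c d] v TN.tangent_space_scale
          linear_cmul charts_at_def\<close>)
qed

lemma tzero_eq: "v \<in> tangent_space N p \<Longrightarrow> tzero p = tscale 0 v"
  by (rule tvec_eqI) (simp_all add: TN.tangent_space_fst)

text \<open>G keeps the base point, so in charts its base component is the smooth transition
  \<open>trans c d\<close> and only the fibre component has to be checked. The lemma serves forces
  on N, with N included in itself, and reaction forces with values in TM.\<close>

lemma smooth_fibre_map:
  assumes S: "openin (mtop (tangent_bundle N)) S"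
    and G: "\<And>v. v \<in> S \<Longrightarrow> G v \<in> tangent_space M (fst v)"
    and loc: "\<And>c d. c \<in> charts N \<Longrightarrow> d \<in> charts M \<Longrightarrow>
      smooth_on (TN.tdom c S \<inter> tdom2 c d) (\<lambda>z. snd (G (TN.tinv c z)) d)"
  shows "smooth_map_on (tangent_bundle N) (tangent_bundle M) S G"
proof (rule smooth_map_onI[OF TN.charted_tangent_bundle TM.charted_tangent_bundle S])
  show "G ` S \<subseteq> points (tangent_bundle M)"
    unfolding TM.points_tangent_bundle by (rule image_subsetI) (rule TM.tangent_space_imp_vectors[OF G])
  fix tc td assume "tc \<in> charts (tangent_bundle N)" "td \<in> charts (tangent_bundle M)"
  then obtain c d where c: "c \<in> charts N" "tc = tchart N c" and d: "d \<in> charts M" "td = tchart M d"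
    by (auto simp: TN.charts_tangent_bundle TM.charts_tangent_bundle)
  have SN: "S \<subseteq> tangent_vectors N" using S by (simp add: TN.openin_tangent_bundle)
  have "{v \<in> S \<inter> fst tc. G v \<in> fst td} = {v \<in> S. fst v \<in> fst d} \<inter> fst tc"
    using TM.tangent_space_imp_vectors[OF G] TM.tangent_space_fst[OF G] by (auto simp: d TM.fst_tchart)
  then have "snd tc ` {v \<in> S \<inter> fst tc. G v \<in> fst td} = TN.tdom c {v \<in> S. fst v \<in> fst d}"
    using TN.tchart_image[OF c(1), of "{v \<in> S. fst v \<in> fst d}"] SN by (auto simp: c(2))
  also have "\<dots> = TN.tdom c S \<inter> tdom2 c d"
  proof -
    have "fst z \<in> snd c ` (fst c \<inter> fst d) \<longleftrightarrow> chart_inv c (fst z) \<in> fst d" if "fst z \<in> snd c ` fst c" for z :: "'f \<times> 'f"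
    proof
      assume "fst z \<in> snd c ` (fst c \<inter> fst d)"
      then show "chart_inv c (fst z) \<in> fst d" using chart_inv_chart[OF charted_inj[OF chN c(1)]] by auto
    next
      assume "chart_inv c (fst z) \<in> fst d"
      then show "fst z \<in> snd c ` (fst c \<inter> fst d)"
        using chart_inv_in[OF that] chart_chart_inv[OF that] by (metis IntI image_eqI)
    qed
    then have "z \<in> TN.tdom c {v \<in> S. fst v \<in> fst d} \<longleftrightarrow> z \<in> TN.tdom c S \<inter> tdom2 c d" for z
      unfolding TN.tdom_def tdom2_def mem_Times_iff Int_iff mem_Collect_eq TN.tinv_fst by blast
    then show ?thesis by blast
  qed
  finally have eq: "snd tc ` {v \<in> S \<inter> fst tc. G v \<in> fst td} = TN.tdom c S \<inter> tdom2 c d" .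
  have op: "open (TN.tdom c S \<inter> tdom2 c d)"
    using TN.tdom_open[OF S c(1)] tdom2_open[OF c(1) d(1)] by blast
  have 1: "smooth_on (TN.tdom c S \<inter> tdom2 c d) (\<lambda>z. trans c d (fst z))"
    by (rule smooth_on_compose[OF op _ smooth_on_fst[OF op smooth_on_id] trans_smooth[OF c(1) d(1)]])
       (auto simp: tdom2_def)
  have "smooth_on (TN.tdom c S \<inter> tdom2 c d) (\<lambda>z. snd td (G (chart_inv tc z)))"
  proof (rule smooth_on_cong[OF op _ smooth_on_Pair[OF op 1 loc[OF c(1) d(1)]]])
    fix z assume z: "z \<in> TN.tdom c S \<inter> tdom2 c d"
    have "chart_inv tc z = TN.tinv c z"
      unfolding c(2) by (rule TN.tchart_inv[OF c(1)]) (use z in \<open>simp add: TN.tdom_def\<close>)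
    moreover have "fst (G (TN.tinv c z)) = chart_inv c (fst z)"
      using z TM.tangent_space_fst[OF G, of "TN.tinv c z"] by (simp add: TN.tdom_def)
    ultimately show "(trans c d (fst z), snd (G (TN.tinv c z)) d) = snd td (G (chart_inv tc z))"
      using tdom2_charts_at(4)[OF c(1) d(1), of z] z by (simp add: d(2) TM.snd_tchart)
  qed
  then show "open (snd tc ` {v \<in> S \<inter> fst tc. G v \<in> fst td}) \<and>
     smooth_on (snd tc ` {v \<in> S \<inter> fst tc. G v \<in> fst td}) (\<lambda>z. snd td (G (chart_inv tc z)))"
    unfolding eq using op by blast
qed

end

lemma (in smooth_mfd) anisotropic_coord_smooth:
  assumes F: "anisotropic_vector_field M U F" and c: "c \<in> charts M"
  shows "smooth_on (tdom c U) (\<lambda>z. snd (F (tinv c z)) c)"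
proof -
  have sm: "smooth_map_on (tangent_bundle M) (tangent_bundle M) U F"
    and F': "\<And>v. v \<in> U \<Longrightarrow> F v \<in> tangent_space M (fst v)"
    using F by (auto simp: anisotropic_vector_field_def)
  have UT: "U \<subseteq> tangent_vectors M" using smooth_map_on_openin[OF sm] by (simp add: openin_tangent_bundle)
  have tc: "tchart M c \<in> charts (tangent_bundle M)" using c by (simp add: charts_tangent_bundle)
  have set: "{v \<in> U \<inter> fst (tchart M c). F v \<in> fst (tchart M c)} = U \<inter> fst (tchart M c)"
    using tangent_space_imp_vectors[OF F'] tangent_space_fst[OF F'] by (auto simp: fst_tchart)
  have op: "open (tdom c U)" by (rule tdom_open[OF smooth_map_on_openin[OF sm] c])
  have "smooth_on (tdom c U) (\<lambda>z. snd (tchart M c) (F (chart_inv (tchart M c) z)))"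
    using smooth_map_on_chart(2)[OF charted_tangent_bundle charted_tangent_bundle sm tc tc]
    unfolding set tchart_image[OF c UT] .
  from smooth_on_snd[OF op this] show ?thesis
    by (rule smooth_on_cong[OF op, rotated]) (simp add: tdom_def tchart_inv[OF c] snd_tchart)
qed

section \<open>Solving linear equations for the fundamental tensor\<close>

context finsler
begin

lemma gc_smooth_compose:
  assumes c: "c \<in> charts M" and T: "open T" and q: "smooth_on T q" "q ` T \<subseteq> tdom c U"
    and u: "smooth_on T u" and w: "smooth_on T w"
  shows "smooth_on T (\<lambda>p. gc c (q p) (u p) (w p))"
proof (rule smooth_on_cong[OF T])
  have "smooth_on T (\<lambda>p. gc c (q p) (u p) b)" for b
    unfolding gc_def
    by (rule smooth_on_linear_comp[OF T bounded_linear_mult_right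
        smooth_on_frechet_apply[OF T smooth_on_frechet[OF Lc_smooth[OF c]] q smooth_on_Pair[OF T smooth_on_const u]]])
  then show "smooth_on T (\<lambda>p. \<Sum>b\<in>Basis. (w p \<bullet> b) *\<^sub>R gc c (q p) (u p) b)"
    by (intro smooth_on_sum[OF T] smooth_on_scaleR[OF T] smooth_on_inner[OF T w smooth_on_const])
  show "(\<Sum>b\<in>Basis. (w p \<bullet> b) *\<^sub>R gc c (q p) (u p) b) = gc c (q p) (u p) (w p)" if "p \<in> T" for p
    by (rule linear_sum_Basis[OF gc_linear_right[OF c], symmetric]) (use q(2) that in auto)
qed

text \<open>The form g as an endomorphism with respect to the standard inner product. Nondegeneracy
  of g becomes injectivity, as required by \<open>linear_equations\<close>.\<close>

definition gmap :: "('m, 'e) chart \<Rightarrow> 'e \<times> 'e \<Rightarrow> 'e \<Rightarrow> 'e" where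
  "gmap c z u = (\<Sum>b\<in>Basis. gc c z u b *\<^sub>R b)"

lemma gmap_eq_iff:
  assumes c: "c \<in> charts M" and z: "z \<in> tdom c U" and \<beta>: "linear \<beta>"
  shows "gmap c z u = (\<Sum>b\<in>Basis. \<beta> b *\<^sub>R b) \<longleftrightarrow> (\<forall>w. gc c z u w = \<beta> w)"
proof
  assume eq: "gmap c z u = (\<Sum>b\<in>Basis. \<beta> b *\<^sub>R b)"
  have coord: "(\<Sum>b\<in>Basis. f b *\<^sub>R b) \<bullet> a = f a" if "a \<in> Basis" for f and a :: 'e
    using that by (simp add: inner_sum_left inner_Basis if_distrib cong: if_cong)
  have "gc c z u b = \<beta> b" if "b \<in> Basis" for b
    using coord[OF that, of "\<lambda>b. gc c z u b"] coord[OF that, of \<beta>] eq by (simp add: gmap_def)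
  then show "\<forall>w. gc c z u w = \<beta> w"
    using linear_eq_stdbasis[OF gc_linear_right[OF c z] \<beta>] by metis
qed (simp add: gmap_def)

lemma linear_equations_gmap:
  assumes c: "c \<in> charts M" and T: "open T" and q: "smooth_on T q" "q ` T \<subseteq> tdom c U"
  shows "linear_equations T (\<lambda>p. gmap c (q p))"
proof (rule linear_equations.intro[OF T])
  show "smooth_on T (\<lambda>p. gmap c (q p) u)" for u
    unfolding gmap_def
    by (intro smooth_on_sum[OF T] smooth_on_scaleR[OF T] smooth_on_const gc_smooth_compose[OF c T q])
  have z: "q p \<in> tdom c U" if "p \<in> T" for p using q that by auto
  show "linear (gmap c (q p))" if "p \<in> T" for p
    by (rule linearI) (simp_all add: gmap_def linear_add[OF gc_linear[OF c z[OF that]]]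
        linear_cmul[OF gc_linear[OF c z[OF that]]] scaleR_add_left sum.distrib scaleR_sum_right)
  show "u = 0" if p: "p \<in> T" and "gmap c (q p) u = 0" for p u
  proof (rule gc_nondegenerate[OF c z[OF p]])
    show "gc c (q p) u w = 0" for w
      using gmap_eq_iff[OF c z[OF p] linear_zero, of u] that by simp
  qed
qed

text \<open>The endomorphism \<open>gmap c z\<close> is injective on a finite-dimensional space,
  hence onto.\<close>

lemma gc_represents:
  assumes c: "c \<in> charts M" and z: "z \<in> tdom c U" and \<beta>: "linear \<beta>"
  shows "\<exists>u. \<forall>w. gc c z u w = \<beta> w"
proof -
  have "smooth_on (tdom c U) (\<lambda>z. z)" by (rule smooth_on_id)
  from linear_equations_gmap[OF c tdom_U_open[OF c] this]
  interpret linear_equations "tdom c U" "gmap c" by simp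
  have "inj (gmap c z)" using inj[OF z] lin[OF z] by (simp add: linear_injective_0)
  then have "surj (gmap c z)" by (rule linear_injective_imp_surjective[OF lin[OF z]]) simp
  then obtain u where "gmap c z u = (\<Sum>b\<in>Basis. \<beta> b *\<^sub>R b)" by (metis surjD)
  then show ?thesis using gmap_eq_iff[OF c z \<beta>] by blast
qed

text \<open>The criterion for fields that are specified only through their pairings: however u was
  chosen, smoothness of its pairings with constant vectors is enough.\<close>

lemma gc_solution_smooth:
  assumes c: "c \<in> charts M" and T: "open T" and q: "smooth_on T q" "q ` T \<subseteq> tdom c U"
    and \<beta>: "\<And>w. smooth_on T (\<lambda>p. \<beta> p w)" "\<And>p. p \<in> T \<Longrightarrow> linear (\<beta> p)"
    and u: "\<And>p w. p \<in> T \<Longrightarrow> gc c (q p) (u p) w = \<beta> p w"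
  shows "smooth_on T u"
proof -
  interpret linear_equations T "\<lambda>p. gmap c (q p)" by (rule linear_equations_gmap[OF c T q])
  show ?thesis
  proof (rule solution_smooth)
    show "smooth_on T (\<lambda>p. \<Sum>b\<in>Basis. \<beta> p b *\<^sub>R b)"
      by (intro smooth_on_sum[OF T] smooth_on_scaleR[OF T] smooth_on_const \<beta>)
    show "gmap c (q p) (u p) = (\<Sum>b\<in>Basis. \<beta> p b *\<^sub>R b)" if "p \<in> T" for p
      using gmap_eq_iff[OF c _ \<beta>(2)[OF that]] u[OF that] q that by blast
  qed
qed

lemma U_chart:
  assumes v: "v \<in> U" and c: "c \<in> charts_at M (fst v)"
  shows "c \<in> charts M" "(snd c (fst v), snd v c) \<in> tdom c U" "tinv c (snd c (fst v), snd v c) = v"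
    "fst v = chart_inv c (snd c (fst v))"
proof -
  have vt: "v \<in> tangent_space M (fst v)" using v U_vectors tangent_vectors_space by blast
  show eq: "tinv c (snd c (fst v), snd v c) = v" by (rule tinv_chart[OF vt c])
  show c': "c \<in> charts M" using c by (simp add: charts_at_def)
  show "(snd c (fst v), snd v c) \<in> tdom c U" using v c eq by (simp add: tdom_def charts_at_def)
  show "fst v = chart_inv c (snd c (fst v))"
    using c chart_inv_chart[OF charted_inj[OF ch c']] by (simp add: charts_at_def)
qed

lemma fund_tensor_eq_gc:
  assumes v: "v \<in> U" and c: "c \<in> charts_at M (fst v)"
    and u: "u \<in> tangent_space M (fst v)" and w: "w \<in> tangent_space M (fst v)"
  shows "fund_tensor L v u w = gc c (snd c (fst v), snd v c) (snd u c) (snd w c)"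
  using fund_tensor_coord[OF U_chart(1,2)[OF v c], of "fst v" "snd u c" "snd w c"] U_chart(3,4)[OF v c]
    tangent_vector_eq[OF u c] tangent_vector_eq[OF w c] by simp

lemma U_ex_chart: "v \<in> U \<Longrightarrow> \<exists>c. c \<in> charts_at M (fst v)"
  using charted_ex_charts_at[OF ch tangent_vectors_fst] U_vectors by blast

lemma fund_tensor_add_left:
  assumes "v \<in> U" "a \<in> tangent_space M (fst v)" "b \<in> tangent_space M (fst v)" "w \<in> tangent_space M (fst v)"
  shows "fund_tensor L v (tadd a b) w = fund_tensor L v a w + fund_tensor L v b w"
proof -
  obtain c where c: "c \<in> charts_at M (fst v)" using U_ex_chart assms by blast
  show ?thesis
    using assms c linear_add[OF gc_linear[OF U_chart(1,2)[OF assms(1) c]]]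
    by (simp add: fund_tensor_eq_gc tangent_space_add)
qed

lemma fund_tensor_scale_left:
  assumes "v \<in> U" "a \<in> tangent_space M (fst v)" "w \<in> tangent_space M (fst v)"
  shows "fund_tensor L v (tscale r a) w = r * fund_tensor L v a w"
proof -
  obtain c where c: "c \<in> charts_at M (fst v)" using U_ex_chart assms by blast
  show ?thesis
    using assms c linear_cmul[OF gc_linear[OF U_chart(1,2)[OF assms(1) c]]]
    by (simp add: fund_tensor_eq_gc tangent_space_scale)
qed

end

section \<open>The metric induced on a submanifold\<close>

locale finsler_inclusion = inclusion M N + FM: finsler M U L
  for M :: "('m, 'e::euclidean_space) manifold" and N :: "('m, 'f::euclidean_space) manifold" and U L +
  assumes inj_tincl: "\<And>p. p \<in> points N \<Longrightarrow> inj_on (tincl M N) (tangent_space N p)"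
    and nondeg: "\<And>p. p \<in> points N \<Longrightarrow> nondegenerate_subspace U L (sub_tangent_space M N p)"
begin

abbreviation Uh where "Uh \<equiv> induced_domain M N U"
abbreviation Lh where "Lh \<equiv> induced_metric M N L"

lemma Uh_D: "v \<in> Uh \<Longrightarrow> v \<in> tangent_space N (fst v)" "v \<in> Uh \<Longrightarrow> tincl M N v \<in> U"
  using TN.tangent_vectors_space by (auto simp: induced_domain_def)

lemma Uh_tdom:
  assumes c: "c \<in> charts N" and d: "d \<in> charts M"
  shows "TN.tdom c Uh \<inter> tdom2 c d = tdom2 c d \<inter> tangent_lift (trans c d) -` TM.tdom d U"
proof -
  have "z \<in> TN.tdom c Uh \<longleftrightarrow> tangent_lift (trans c d) z \<in> TM.tdom d U" if z: "z \<in> tdom2 c d" for z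
    using tincl_tinv[OF c d z] tdom2_charts_at[OF c d z] TN.tangent_space_imp_vectors[OF TN.tinv_in[OF c], of z]
    by (simp add: TN.tdom_def TM.tdom_def induced_domain_def tangent_lift_def)
  then show ?thesis by auto
qed

lemma Uh_tdom_open: "c \<in> charts N \<Longrightarrow> d \<in> charts M \<Longrightarrow> open (TN.tdom c Uh \<inter> tdom2 c d)"
  unfolding Uh_tdom
  by (rule continuous_open_preimage[OF smooth_on_imp_continuous_on[OF lift_smooth] tdom2_open FM.tdom_U_open])

text \<open>A chart domain of N need not lie in a single chart domain of M. Local statements about
  objects restricted from M are therefore checked on these pieces.\<close>

lemma tdom_cover: "TN.tdom c Uh = (\<Union>d\<in>charts M. TN.tdom c Uh \<inter> tdom2 c d)" if c: "c \<in> charts N"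
proof -
  have "\<exists>d\<in>charts M. z \<in> tdom2 c d" if z: "z \<in> TN.tdom c Uh" for z
  proof -
    have x: "fst z \<in> snd c ` fst c" using z by (simp add: TN.tdom_def)
    then have p: "chart_inv c (fst z) \<in> fst c" by (rule chart_inv_in)
    then obtain d where d: "d \<in> charts M" "chart_inv c (fst z) \<in> fst d"
      using charted_ex_chart[OF chM] charted_chart_subset[OF chN c] sub by blast
    then have "z \<in> tdom2 c d" using p chart_chart_inv[OF x] by (cases z) (force simp: tdom2_def)
    then show ?thesis using d by blast
  qed
  then show ?thesis by blast
qed

lemma Uh_openin: "openin (mtop (tangent_bundle N)) Uh"
  unfolding TN.openin_tangent_bundle
proof (intro conjI ballI)
  show "Uh \<subseteq> tangent_vectors N" by (auto simp: induced_domain_def)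
  show "open (TN.tdom c Uh)" if "c \<in> charts N" for c
    by (subst tdom_cover[OF that]) (rule open_UN[OF ballI[OF Uh_tdom_open[OF that]]])
qed

lemma fund_tensor_tincl:
  assumes v: "v \<in> tangent_space N p" and u: "u \<in> tangent_space N p" and w: "w \<in> tangent_space N p"
  shows "fund_tensor Lh v u w = fund_tensor L (tincl M N v) (tincl M N u) (tincl M N w)"
proof -
  have "Lh (tadd (tadd v (tscale t u)) (tscale s w)) =
    L (tadd (tadd (tincl M N v) (tscale t (tincl M N u))) (tscale s (tincl M N w)))" for t s
    using v u w by (simp add: induced_metric_def tincl_add[of _ p] tincl_scale[of _ p]
        TN.tangent_space_add TN.tangent_space_scale)
  then show ?thesis by (simp add: fund_tensor_def)
qed

text \<open>Nondegeneracy of the tangent space of N is stated inside that of M; injectivity of the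
  inclusion carries it back to vectors of N.\<close>

lemma nondegenerate_tincl:
  assumes v: "v \<in> Uh" and u: "u \<in> tangent_space N (fst v)"
    and z: "\<And>w. w \<in> tangent_space N (fst v) \<Longrightarrow> fund_tensor L (tincl M N v) (tincl M N u) (tincl M N w) = 0"
  shows "u = tzero (fst v)"
proof -
  let ?p = "fst v"
  have p: "?p \<in> points N" by (rule TN.tangent_space_points[OF Uh_D(1)[OF v]])
  have "tincl M N v \<in> U \<inter> sub_tangent_space M N ?p"
    using Uh_D[OF v] by (simp add: sub_tangent_space_def)
  then have "nondegenerate_on (sub_tangent_space M N ?p) (tzero ?p) (fund_tensor L (tincl M N v))"
    using nondeg[OF p] unfolding nondegenerate_subspace_def tincl_fst[symmetric, of v] by blast
  then have "tincl M N u = tzero ?p" using u z unfolding nondegenerate_on_def sub_tangent_space_def by blast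
  also have "\<dots> = tincl M N (tscale 0 u)"
    by (rule tvec_eqI) (simp_all add: tincl_scale[OF u] TN.tangent_space_fst[OF u])
  finally show ?thesis
    using inj_onD[OF inj_tincl[OF p] _ u TN.tangent_space_scale[OF u]] tzero_eq[OF u] by simp
qed

lemma Lh_lift:
  assumes c: "c \<in> charts N" and d: "d \<in> charts M" and q: "q \<in> TN.tdom c Uh \<inter> tdom2 c d"
  shows "fst q \<in> snd c ` (fst c \<inter> fst d) \<and> tangent_lift (trans c d) q \<in> TM.tdom d U \<and>
    Lh (TN.tinv c q) = FM.Lc d (tangent_lift (trans c d) q)"
proof -
  have q2: "q \<in> tdom2 c d \<inter> tangent_lift (trans c d) -` TM.tdom d U" using q Uh_tdom[OF c d] by blast
  then show ?thesis using tincl_tinv[OF c d, of q]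
    by (auto simp: tdom2_def induced_metric_def FM.Lc_def)
qed

lemma finsler_induced: "conic_pseudo_finsler N Uh Lh"
  unfolding conic_pseudo_finsler_def conic_domain_def
proof (intro conjI ballI allI impI)
  show "openin (mtop (tangent_bundle N)) Uh" by (rule Uh_openin)
  \<comment> \<open>The inclusion maps zero to zero, and U contains no zero vector.\<close>
  show "v \<noteq> tzero (fst v)" if v: "v \<in> Uh" for v
  proof
    assume "v = tzero (fst v)"
    also have "\<dots> = tscale 0 v" by (rule tzero_eq[OF Uh_D(1)[OF v]])
    finally have "tincl M N v = tscale 0 (tincl M N v)" using tincl_scale[OF Uh_D(1)[OF v]] by metis
    also have "\<dots> = tzero (fst (tincl M N v))" by (rule tvec_eqI) simp_all
    finally show False
      using Uh_D(2)[OF v] FM.finsler unfolding conic_pseudo_finsler_def conic_domain_def by blast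
  qed
  show "tscale a v \<in> Uh" if v: "v \<in> Uh" and a: "a > 0" for v a
    using TN.tangent_space_imp_vectors[OF TN.tangent_space_scale[OF Uh_D(1)[OF v]]] FM.U_scale[OF Uh_D(2)[OF v] a]
    by (simp add: induced_domain_def tincl_scale[OF Uh_D(1)[OF v]])
  show "Lh (tscale a v) = a\<^sup>2 * Lh v" if v: "v \<in> Uh" and a: "a > 0" for v a
    by (simp add: induced_metric_def tincl_scale[OF Uh_D(1)[OF v]] FM.L_scale[OF Uh_D(2)[OF v] a])
  show "nondegenerate_on (tangent_space N (fst v)) (tzero (fst v)) (fund_tensor Lh v)" if v: "v \<in> Uh" for v
    unfolding nondegenerate_on_def
    using nondegenerate_tincl[OF v] fund_tensor_tincl[OF Uh_D(1)[OF v]] by metis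
  show "smooth_map_on (tangent_bundle N) euclid Uh Lh"
  proof (rule smooth_map_on_euclidI[OF TN.charted_tangent_bundle Uh_openin])
    fix tc assume "tc \<in> charts (tangent_bundle N)"
    then obtain c where c: "c \<in> charts N" and tc: "tc = tchart N c" by (auto simp: TN.charts_tangent_bundle)
    have Uh_sub: "Uh \<subseteq> tangent_vectors N" by (auto simp: induced_domain_def)
    \<comment> \<open>On the piece over a chart d of M, the induced metric function is
      \<open>FM.Lc d\<close> composed with the tangent lift of the transition.\<close>
    have "smooth_on (TN.tdom c Uh) (\<lambda>z. Lh (chart_inv (tchart N c) z))"
    proof (rule smooth_on_local)
      fix z assume "z \<in> TN.tdom c Uh"
      then obtain d where d: "d \<in> charts M" and z: "z \<in> TN.tdom c Uh \<inter> tdom2 c d" using tdom_cover[OF c] by blast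
      let ?T = "TN.tdom c Uh \<inter> tdom2 c d"
      have T: "open ?T" by (rule Uh_tdom_open[OF c d])
      have "smooth_on ?T (\<lambda>z. FM.Lc d (tangent_lift (trans c d) z))"
        by (rule smooth_on_compose[OF T _ smooth_on_subset[OF lift_smooth[OF c d]] FM.Lc_smooth[OF d]])
           (use Lh_lift[OF c d] in auto)
      then have "smooth_on ?T (\<lambda>z. Lh (chart_inv (tchart N c) z))"
      proof (rule smooth_on_cong[OF T, rotated])
        fix q assume q: "q \<in> ?T"
        then have "chart_inv (tchart N c) q = TN.tinv c q" by (intro TN.tchart_inv[OF c]) (simp add: TN.tdom_def)
        then show "FM.Lc d (tangent_lift (trans c d) q) = Lh (chart_inv (tchart N c) q)"
          using Lh_lift[OF c d q] by simp
      qed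
      then show "\<exists>T. open T \<and> z \<in> T \<and> smooth_on T (\<lambda>z. Lh (chart_inv (tchart N c) z))" using T z by blast
    qed
    then show "smooth_on (snd tc ` (Uh \<inter> fst tc)) (\<lambda>z. Lh (chart_inv tc z))"
      by (simp add: tc TN.tchart_image[OF c Uh_sub])
  qed
qed

sublocale FN: finsler N Uh Lh
  by unfold_locales (rule finsler_induced)

lemma euler_lagrange_induced:
  assumes c: "c \<in> charts N" and d: "d \<in> charts M" and q: "(x, y) \<in> TN.tdom c Uh \<inter> tdom2 c d"
  shows "euler_lagrange (FN.Lc c) (x, y) z w = euler_lagrange (FM.Lc d) (tangent_lift (trans c d) (x, y))
    (Df (\<lambda>p. Df (trans c d) p y) x y + Df (trans c d) x z)
    (Df (trans c d) x w)"
  by (rule euler_lagrange_natural[OF transition_open[OF c d] trans_smooth[OF c d] FM.tdom_U_open[OF d] FM.Lc_smooth[OF d]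
        Uh_tdom_open[OF c d] q]) (use Lh_lift[OF c d] in \<open>simp add: FN.Lc_def\<close>)

end

section \<open>The induced force\<close>

locale constrained_system = finsler_inclusion M N U L
  for M :: "('m, 'e::euclidean_space) manifold" and N :: "('m, 'f::euclidean_space) manifold" and U L +
  fixes F
  assumes F: "anisotropic_vector_field M U F"
begin

abbreviation Fh where "Fh \<equiv> induced_force M N L F"

lemma F_in: "v \<in> U \<Longrightarrow> F v \<in> tangent_space M (fst v)"
  using F by (simp add: anisotropic_vector_field_def)

text \<open>\<open>orth_proj\<close> is a definite description, so the decomposition has to be
  constructed first: nondegeneracy of the induced metric represents the functional w \<mapsto> g(F,
  w) on the tangent space of N by a vector u, and the same nondegeneracy shows that u is the only
  possible projection.\<close>

lemma induced_force:
  assumes v: "v \<in> Uh"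
  shows "Fh v \<in> tangent_space N (fst v)"
    and "\<And>w. w \<in> tangent_space N (fst v) \<Longrightarrow>
      fund_tensor L (tincl M N v) (tincl M N (Fh v)) (tincl M N w) = fund_tensor L (tincl M N v) (F (tincl M N v)) (tincl M N w)"
proof -
  define p V where "p = fst v" and "V = tincl M N v"
  have vp: "v \<in> tangent_space N p" and V: "V \<in> U" "fst V = p" using Uh_D[OF v] by (auto simp: V_def p_def)
  have p: "p \<in> points N" by (rule TN.tangent_space_points[OF vp])
  let ?E = "sub_tangent_space M N p"
  obtain c where c: "c \<in> charts_at N p" using charted_ex_charts_at[OF chN p] by blast
  obtain d where d: "d \<in> charts_at M p" using charted_ex_charts_at[OF chM] p sub by blast
  have cd: "c \<in> charts N" "d \<in> charts M" "p \<in> fst c" "p \<in> fst d" using c d by (auto simp: charts_at_def)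
  \<comment> \<open>The functional to be represented, as a function of the coordinates of w in a
    chart of N.\<close>
  define \<beta> where "\<beta> w = fund_tensor L V (F V) (coord_field M d (Df (trans c d) (snd c p) w) p)" for w
  have FV: "F V \<in> tangent_space M p" using F_in V by metis
  have "linear (\<lambda>w. FM.gc d (snd d p, snd V d) (snd (F V) d) (Df (trans c d) (snd c p) w))"
    using linear_compose[OF trans_linear[OF cd(1,2)] FM.gc_linear_right[OF cd(2)], of "snd c p" "(snd d p, snd V d)" "snd (F V) d"]
      FM.U_chart(2)[OF V(1)] d cd V(2) by (auto simp: comp_def)
  then have \<beta>: "linear \<beta>"
    using FM.fund_tensor_eq_gc[OF V(1), of d] d V(2) FV TM.coord_field_in[OF d] by (simp add: \<beta>_def[abs_def])
  have v_chart: "(snd c p, snd v c) \<in> TN.tdom c Uh" using FN.U_chart(2)[OF v, of c] c by (simp add: p_def)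
  obtain a where a: "\<And>w. FN.gc c (snd c p, snd v c) a w = \<beta> w"
    using FN.gc_represents[OF cd(1) v_chart \<beta>] by blast
  define u where "u = coord_field N c a p"
  have u: "u \<in> tangent_space N p" unfolding u_def by (rule TN.coord_field_in[OF c])
  have uF: "fund_tensor L V (tincl M N u) (tincl M N w) = fund_tensor L V (F V) (tincl M N w)"
    if w: "w \<in> tangent_space N p" for w
  proof -
    have "fund_tensor L V (tincl M N u) (tincl M N w) = fund_tensor Lh v u w"
      unfolding V_def by (rule fund_tensor_tincl[OF vp u w, symmetric])
    also have "\<dots> = FN.gc c (snd c p, snd v c) a (snd w c)"
      using FN.fund_tensor_eq_gc[OF v, of c u w] c u w by (simp add: p_def[symmetric] u_def)
    also have "\<dots> = fund_tensor L V (F V) (tincl M N (coord_field N c (snd w c) p))"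
      by (simp add: a \<beta>_def tincl_coord_field[OF c d])
    finally show ?thesis using TN.tangent_vector_eq[OF w c] by simp
  qed
  have proj: "orth_proj M L ?E V (F V) = tincl M N u"
    unfolding orth_proj_def
  proof (rule the_equality)
    \<comment> \<open>The remainder of F after subtracting u; it is orthogonal to the tangent space
      of N by the choice of u.\<close>
    define z where "z = tadd (F V) (tscale (-1) (tincl M N u))"
    have uM: "tincl M N u \<in> tangent_space M p" by (rule tincl_in[OF u])
    have "z \<in> orth_compl M L ?E V"
      unfolding orth_compl_def V(2) z_def sub_tangent_space_def
      using FV uM u V uF tincl_in
      by (auto simp: TM.tangent_space_add TM.tangent_space_scale FM.fund_tensor_add_left FM.fund_tensor_scale_left)
    moreover have "F V = tadd (tincl M N u) z"
      by (rule tvec_eqI) (simp_all add: z_def TN.tangent_space_fst[OF u] TM.tangent_space_fst[OF FV])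
    ultimately show "tincl M N u \<in> ?E \<and> (\<exists>z\<in>orth_compl M L ?E V. F V = tadd (tincl M N u) z)"
      using u by (auto simp: sub_tangent_space_def)
  next
    fix u' assume u': "u' \<in> ?E \<and> (\<exists>z\<in>orth_compl M L ?E V. F V = tadd u' z)"
    then obtain u1 z where u1: "u1 \<in> tangent_space N p" "u' = tincl M N u1"
      and z: "z \<in> orth_compl M L ?E V" "F V = tadd u' z" by (auto simp: sub_tangent_space_def)
    have zp: "z \<in> tangent_space M p" using z V by (simp add: orth_compl_def)
    \<comment> \<open>The difference of two candidates is tangent to N and orthogonal to all of the
      tangent space of N, hence zero.\<close>
    define e where "e = tadd u1 (tscale (-1) u)"
    have e: "e \<in> tangent_space N p" unfolding e_def by (intro TN.tangent_space_add TN.tangent_space_scale u u1)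
    have "e = tzero p"
      unfolding p_def
    proof (rule nondegenerate_tincl[OF v])
      show "e \<in> tangent_space N (fst v)" using e by (simp add: p_def)
      fix w assume "w \<in> tangent_space N (fst v)"
      then have w: "w \<in> tangent_space N p" by (simp add: p_def)
      have "fund_tensor L V (F V) (tincl M N w) = fund_tensor L V (tincl M N u1) (tincl M N w)"
        using z zp w u1 tincl_in[OF w] tincl_in[OF u1(1)] V
        by (auto simp: FM.fund_tensor_add_left orth_compl_def sub_tangent_space_def)
      then show "fund_tensor L (tincl M N v) (tincl M N e) (tincl M N w) = 0"
        using uF[OF w] tincl_in[OF w] tincl_in[OF u] tincl_in[OF u1(1)] V u u1
        by (simp add: V_def[symmetric] e_def tincl_add[OF u1(1) TN.tangent_space_scale[OF u]] tincl_scale[OF u]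
            FM.fund_tensor_add_left FM.fund_tensor_scale_left TM.tangent_space_scale)
    qed
    then have "snd e b = 0" for b by simp
    then have "u1 = u"
      by (intro tvec_eqI) (simp_all add: e_def TN.tangent_space_fst[OF u] TN.tangent_space_fst[OF u1(1)])
    then show "u' = tincl M N u" by (simp add: u1(2))
  qed
  have eq: "Fh v = u"
    using proj inv_into_f_f[OF inj_tincl[OF p] u] by (simp add: induced_force_def p_def V_def)
  show "Fh v \<in> tangent_space N (fst v)" using u by (simp add: eq p_def)
  show "fund_tensor L (tincl M N v) (tincl M N (Fh v)) (tincl M N w) = fund_tensor L (tincl M N v) (F (tincl M N v)) (tincl M N w)"
    if "w \<in> tangent_space N (fst v)" for w
    using uF[of w] that by (simp add: eq p_def V_def)
qed

text \<open>The right-hand side involves only data of M along the smooth lift, so it is smooth in q.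
  This is the input that \<open>gc_solution_smooth\<close> needs for the induced force.\<close>

lemma induced_force_coord:
  assumes c: "c \<in> charts N" and d: "d \<in> charts M" and q: "q \<in> TN.tdom c Uh \<inter> tdom2 c d"
  shows "FN.gc c q (snd (Fh (TN.tinv c q)) c) w = FM.gc d (tangent_lift (trans c d) q)
    (snd (F (TM.tinv d (tangent_lift (trans c d) q))) d) (Df (trans c d) (fst q) w)"
proof -
  define v p where "v = TN.tinv c q" and "p = chart_inv c (fst q)"
  have v: "v \<in> Uh" "fst v = p" using q by (auto simp: v_def p_def TN.tdom_def)
  have cat: "c \<in> charts_at N p" "d \<in> charts_at M p" "snd c p = fst q"
    using tdom2_charts_at[OF c d, of q] q by (auto simp: p_def chart_chart_inv)
  have V: "tincl M N v = TM.tinv d (tangent_lift (trans c d) q)"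
    unfolding v_def by (rule tincl_tinv[OF c d]) (use q in blast)
  let ?w = "coord_field N c w p"
  have w: "?w \<in> tangent_space N p" by (rule TN.coord_field_in[OF cat(1)])
  have vc: "(snd c (fst v), snd v c) = q"
    using tdom2_charts_at(3)[OF c d, of q] q by (simp add: v(2) cat(3)) (simp add: v_def TN.tinv_snd[OF c])
  have "fst (tangent_lift (trans c d) q) \<in> snd d ` fst d"
    using Lh_lift[OF c d q] by (simp add: TM.tdom_def)
  then have Vc: "(snd d (fst (tincl M N v)), snd (tincl M N v) d) = tangent_lift (trans c d) q"
    unfolding V by (simp add: TM.tinv_snd[OF d] chart_chart_inv)
  have "FN.gc c q (snd (Fh v) c) w = fund_tensor Lh v (Fh v) ?w"
    using FN.fund_tensor_eq_gc[OF v(1), of c "Fh v" ?w] cat(1) induced_force(1)[OF v(1)] w vc v(2) by simp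
  also have "\<dots> = fund_tensor L (tincl M N v) (F (tincl M N v)) (tincl M N ?w)"
    using fund_tensor_tincl[of v p "Fh v" ?w] induced_force[OF v(1)] Uh_D(1)[OF v(1)] w v(2) by simp
  also have "\<dots> = FM.gc d (tangent_lift (trans c d) q) (snd (F (tincl M N v)) d) (snd (tincl M N ?w) d)"
    using FM.fund_tensor_eq_gc[OF Uh_D(2)[OF v(1)], of d "F (tincl M N v)" "tincl M N ?w"] Vc cat(2) v(2)
      F_in[OF Uh_D(2)[OF v(1)]] tincl_in[OF w] by simp
  also have "snd (tincl M N ?w) d = Df (trans c d) (fst q) w"
    using tincl_coord_field[OF cat(1,2)] by (simp add: cat)
  finally show ?thesis by (simp add: v_def V[unfolded v_def])
qed

lemma induced_force_smooth:
  assumes c: "c \<in> charts N" shows "smooth_on (TN.tdom c Uh) (\<lambda>z. snd (Fh (TN.tinv c z)) c)"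
proof (rule smooth_on_local)
  fix z assume "z \<in> TN.tdom c Uh"
  then obtain d where d: "d \<in> charts M" and z: "z \<in> TN.tdom c Uh \<inter> tdom2 c d" using tdom_cover[OF c] by blast
  let ?T = "TN.tdom c Uh \<inter> tdom2 c d"
  have T: "open ?T" by (rule Uh_tdom_open[OF c d])
  have lift: "smooth_on ?T (tangent_lift (trans c d))" by (rule smooth_on_subset[OF lift_smooth[OF c d]]) auto
  have img: "tangent_lift (trans c d) ` ?T \<subseteq> TM.tdom d U" using Lh_lift[OF c d] by blast
  have fimg: "fst ` ?T \<subseteq> snd c ` (fst c \<inter> fst d)" using Lh_lift[OF c d] by blast
  have "smooth_on ?T (\<lambda>z. snd (Fh (TN.tinv c z)) c)"
  proof (rule FN.gc_solution_smooth[OF c T smooth_on_id _ _ _ induced_force_coord[OF c d]])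
    show "smooth_on ?T (\<lambda>q. FM.gc d (tangent_lift (trans c d) q)
        (snd (F (TM.tinv d (tangent_lift (trans c d) q))) d) (Df (trans c d) (fst q) w))" for w
      by (rule FM.gc_smooth_compose[OF d T lift img
            smooth_on_compose[OF T img lift TM.anisotropic_coord_smooth[OF F d]]
            smooth_on_frechet_apply[OF T trans_smooth[OF c d] smooth_on_fst[OF T smooth_on_id] fimg smooth_on_const]])
    show "linear (\<lambda>w. FM.gc d (tangent_lift (trans c d) q)
        (snd (F (TM.tinv d (tangent_lift (trans c d) q))) d) (Df (trans c d) (fst q) w))"
      if "q \<in> ?T" for q
      using linear_compose[OF trans_linear[OF c d, of "fst q"] FM.gc_linear_right[OF d, of "tangent_lift (trans c d) q"]]
        Lh_lift[OF c d that] by (simp add: comp_def)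
  qed auto
  then show "\<exists>T. open T \<and> z \<in> T \<and> smooth_on T (\<lambda>z. snd (Fh (TN.tinv c z)) c)" using T z by blast
qed

lemma anisotropic_induced_force: "anisotropic_vector_field N Uh Fh"
  unfolding anisotropic_vector_field_def
proof
  show "\<forall>v\<in>Uh. Fh v \<in> tangent_space N (fst v)" using induced_force(1) by blast
  show "smooth_map_on (tangent_bundle N) (tangent_bundle N) Uh Fh"
  \<comment> \<open>N is regarded as included in itself. The components of the force in a second
    chart e arise from those in c by the derivative of the transition.\<close>
  proof (rule TN.MM.smooth_fibre_map[OF Uh_openin induced_force(1)])
    fix c e assume c: "c \<in> charts N" and e: "e \<in> charts N"
    let ?T = "TN.tdom c Uh \<inter> TN.MM.tdom2 c e"
    have T: "open ?T" using TN.tdom_open[OF Uh_openin c] TN.MM.tdom2_open[OF c e] by blast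
    have f: "smooth_on ?T (\<lambda>z. snd (Fh (TN.tinv c z)) c)"
      by (rule smooth_on_subset[OF induced_force_smooth[OF c]]) auto
    have fimg: "fst ` ?T \<subseteq> snd c ` (fst c \<inter> fst e)" by (auto simp: TN.MM.tdom2_def)
    show "smooth_on ?T (\<lambda>z. snd (Fh (TN.tinv c z)) e)"
    proof (rule smooth_on_cong[OF T _ smooth_on_frechet_apply[OF T TN.MM.trans_smooth[OF c e]
            smooth_on_fst[OF T smooth_on_id] fimg f]])
      fix z assume z: "z \<in> ?T"
      then have "TN.tinv c z \<in> Uh" by (simp add: TN.tdom_def)
      from TN.tangent_space_snd[OF induced_force(1)[OF this], of c e]
      show "Df (TN.MM.trans c e) (fst z) (snd (Fh (TN.tinv c z)) c) = snd (Fh (TN.tinv c z)) e"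
        using TN.MM.tdom2_charts_at[OF c e, of z] z by (simp add: TN.MM.trans_def chart_chart_inv)
    qed
  qed
qed

end

section \<open>Curves\<close>

text \<open>In the first term w sits inside the function that is differentiated. Symmetry of second
  derivatives moves it to the direction slot, where linearity is plain.\<close>

lemma euler_lagrange_linear:
  assumes W: "open W" and l: "smooth_on W l" and q: "q \<in> W"
  shows "linear (\<lambda>w. euler_lagrange l q z w)"
proof -
  have 1: "linear (\<lambda>w. Df (\<lambda>q. Df l q (snd q0, z)) q (0, w))" for q0 :: "'a \<times> 'a"
    using linear_compose[OF _ smooth_on_linear_frechet[OF smooth_on_frechet[OF l] q], of "\<lambda>w. (0, w)" "(snd q0, z)"]
    by (simp add: comp_def linear_iff)
  have 2: "linear (\<lambda>w. Df l q (w, 0))"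
    using linear_compose[OF _ smooth_on_linear_frechet[OF l q], of "\<lambda>w. (w, 0)"]
    by (simp add: comp_def linear_iff)
  have "euler_lagrange l q z = (\<lambda>w. Df (\<lambda>q'. Df l q' (snd q, z)) q (0, w)
      - Df l q (w, 0))"
    by (simp add: fun_eq_iff euler_lagrange_def symmetric_derivative[OF W l q, of "(0, _)"])
  then show ?thesis using linear_compose_sub[OF 1[of q] 2] by simp
qed

section \<open>Velocity and acceleration of curves in charts\<close>

definition cvel :: "('m, 'e::euclidean_space) chart \<Rightarrow> (real \<Rightarrow> 'm) \<Rightarrow> real \<Rightarrow> 'e" where
  "cvel c \<gamma> t = vector_derivative (\<lambda>s. snd c (\<gamma> s)) (at t)"

definition cacc :: "('m, 'e::euclidean_space) chart \<Rightarrow> (real \<Rightarrow> 'm) \<Rightarrow> real \<Rightarrow> 'e" where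
  "cacc c \<gamma> t = vector_derivative (cvel c \<gamma>) (at t)"

lemma smooth_on_vector_derivative:
  fixes x :: "real \<Rightarrow> 'a::euclidean_space"
  assumes J: "open J" and x: "smooth_on J x"
  shows "t \<in> J \<Longrightarrow> (x has_vector_derivative vector_derivative x (at t)) (at t)"
    and "smooth_on J (\<lambda>t. vector_derivative x (at t))"
proof -
  show 1: "(x has_vector_derivative vector_derivative x (at t)) (at t)" if "t \<in> J" for t
    using vector_derivative_works smooth_on_imp_differentiable[OF x that] by blast
  show "smooth_on J (\<lambda>t. vector_derivative x (at t))"
  proof (rule smooth_on_cong[OF J _ smooth_on_frechet[OF x, of 1]])
    fix t assume t: "t \<in> J"
    from frechet_derivative_eqI[OF 1[OF t, unfolded has_vector_derivative_def]]
    show "Df x t 1 = vector_derivative x (at t)" by simp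
  qed
qed

lemma vector_derivative_cong_open:
  assumes "open J" "t \<in> J" "\<And>s. s \<in> J \<Longrightarrow> f s = g s"
  shows "vector_derivative f (at t) = vector_derivative g (at t)"
proof -
  have "(f has_vector_derivative D) (at t) \<longleftrightarrow> (g has_vector_derivative D) (at t)" for D
    using assms has_vector_derivative_transform_within_open[of f D t J g]
      has_vector_derivative_transform_within_open[of g D t J f] by auto
  then show ?thesis unfolding vector_derivative_def by simp
qed

context smooth_mfd
begin

lemma smooth_curve_chart:
  assumes \<gamma>: "smooth_curve M I \<gamma>" and c: "c \<in> charts M"
  shows "open {t \<in> I. \<gamma> t \<in> fst c}" "smooth_on {t \<in> I. \<gamma> t \<in> fst c} (\<lambda>t. snd c (\<gamma> t))"
proof -
  have e: "(UNIV, id) \<in> charts (euclid :: (real, real) manifold)" by (simp add: euclid_def)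
  have inv: "chart_inv (UNIV, id) = (id :: real \<Rightarrow> real)" by (simp add: chart_inv_def)
  have "smooth_map_on euclid M I \<gamma>" using \<gamma> by (simp add: smooth_curve_def)
  from smooth_map_on_chart[OF charted_euclid ch this e c]
  show "open {t \<in> I. \<gamma> t \<in> fst c}" "smooth_on {t \<in> I. \<gamma> t \<in> fst c} (\<lambda>t. snd c (\<gamma> t))"
    by (simp_all add: inv)
qed

lemma smooth_curveI:
  assumes I: "open_interval I" and \<gamma>: "\<gamma> ` I \<subseteq> points M"
    and loc: "\<And>c. c \<in> charts M \<Longrightarrow> open {t \<in> I. \<gamma> t \<in> fst c} \<and> smooth_on {t \<in> I. \<gamma> t \<in> fst c} (\<lambda>t. snd c (\<gamma> t))"
  shows "smooth_curve M I \<gamma>"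
  unfolding smooth_curve_def
proof
  show "smooth_map_on euclid M I \<gamma>"
  proof (rule smooth_map_onI[OF charted_euclid ch _ \<gamma>])
    show "openin (mtop euclid) I" using I by (simp add: euclid_def open_interval_def)
    fix e c assume e: "e \<in> charts (euclid :: (real, real) manifold)" and c: "c \<in> charts M"
    have "e = (UNIV, id)" "chart_inv e = id" using e by (auto simp: euclid_def chart_inv_def)
    then show "open (snd e ` {p \<in> I \<inter> fst e. \<gamma> p \<in> fst c}) \<and>
      smooth_on (snd e ` {p \<in> I \<inter> fst e. \<gamma> p \<in> fst c}) (\<lambda>x. snd c (\<gamma> (chart_inv e x)))"
      using loc[OF c] by simp
  qed
qed (rule I)

lemma smooth_curve_points: "smooth_curve M I \<gamma> \<Longrightarrow> t \<in> I \<Longrightarrow> \<gamma> t \<in> points M"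
  by (auto simp: smooth_curve_def smooth_map_on_def continuous_map_def euclid_def points_def)

lemma velocity_fst [simp]: "fst (velocity M \<gamma> t) = \<gamma> t"
  by (simp add: velocity_def)

lemma velocity_snd: "c \<in> charts_at M (\<gamma> t) \<Longrightarrow> snd (velocity M \<gamma> t) c = cvel c \<gamma> t"
  by (simp add: velocity_def cvel_def comp_def)

lemma curve_jets:
  assumes \<gamma>: "smooth_curve M I \<gamma>" and c: "c \<in> charts M" and t: "t \<in> I" "\<gamma> t \<in> fst c"
  shows "((\<lambda>t. snd c (\<gamma> t)) has_vector_derivative cvel c \<gamma> t) (at t)"
    "(cvel c \<gamma> has_vector_derivative cacc c \<gamma> t) (at t)"
proof -
  note J = smooth_curve_chart[OF \<gamma> c]
  show "((\<lambda>t. snd c (\<gamma> t)) has_vector_derivative cvel c \<gamma> t) (at t)"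
    unfolding cvel_def by (rule smooth_on_vector_derivative(1)[OF J]) (use t in simp)
  have "smooth_on {t \<in> I. \<gamma> t \<in> fst c} (cvel c \<gamma>)"
    unfolding cvel_def[abs_def] by (rule smooth_on_vector_derivative(2)[OF J])
  from smooth_on_vector_derivative(1)[OF J(1) this]
  show "(cvel c \<gamma> has_vector_derivative cacc c \<gamma> t) (at t)" using t by (simp add: cacc_def)
qed

end

context inclusion
begin

lemma openin_curve_preimage:
  assumes \<gamma>: "smooth_curve N I \<gamma>" and W: "openin (mtop N) W"
  shows "open {t \<in> I. \<gamma> t \<in> W}"
proof -
  have "smooth_map_on euclid N I \<gamma>" using \<gamma> by (simp add: smooth_curve_def)
  from smooth_map_on_openin_preimage[OF this W] show ?thesis by (simp add: euclid_def)
qed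

lemma overlap_openin: "c \<in> charts N \<Longrightarrow> d \<in> charts M \<Longrightarrow> openin (mtop N) (fst c \<inter> fst d)"
proof -
  assume c: "c \<in> charts N" and d: "d \<in> charts M"
  have "fst c \<inter> (fst d \<inter> points N) = fst c \<inter> fst d" using charted_chart_subset[OF chN c] by blast
  then show ?thesis
    using openin_Int[OF charted_openin_chart[OF chN c] openin_inclusion[OF charted_openin_chart[OF chM d]]] by simp
qed

text \<open>Accelerations pick up the second derivative of the transition, which is exactly the
  acceleration argument occurring in \<open>euler_lagrange_natural\<close>.\<close>

lemma curve_transition:
  assumes \<gamma>: "smooth_curve N I \<gamma>" and c: "c \<in> charts_at N (\<gamma> t)" and d: "d \<in> charts_at M (\<gamma> t)" and t: "t \<in> I"
  shows "snd d (\<gamma> t) = trans c d (snd c (\<gamma> t))"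
    "cvel d \<gamma> t = Df (trans c d) (snd c (\<gamma> t)) (cvel c \<gamma> t)"
    "cacc d \<gamma> t = Df (\<lambda>p. Df (trans c d) p (cvel c \<gamma> t)) (snd c (\<gamma> t)) (cvel c \<gamma> t)
        + Df (trans c d) (snd c (\<gamma> t)) (cacc c \<gamma> t)"
proof -
  have cd: "c \<in> charts N" "d \<in> charts M" "\<gamma> t \<in> fst c" "\<gamma> t \<in> fst d" using c d by (auto simp: charts_at_def)
  let ?J = "{s \<in> I. \<gamma> s \<in> fst c \<inter> fst d}"
  have J: "open ?J" by (rule openin_curve_preimage[OF \<gamma> overlap_openin[OF cd(1,2)]])
  have tJ: "t \<in> ?J" using t cd by simp
  have pos: "snd d (\<gamma> s) = trans c d (snd c (\<gamma> s))" if "s \<in> ?J" for s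
    using that chart_inv_chart[OF charted_inj[OF chN cd(1)]] by (simp add: trans_def)
  then show "snd d (\<gamma> t) = trans c d (snd c (\<gamma> t))" using tJ by blast
  have x: "snd c (\<gamma> s) \<in> snd c ` (fst c \<inter> fst d)" if "s \<in> ?J" for s using that by auto
  have jets: "((\<lambda>t. snd c (\<gamma> t)) has_derivative (\<lambda>h. h *\<^sub>R cvel c \<gamma> s)) (at s)"
    "(cvel c \<gamma> has_derivative (\<lambda>h. h *\<^sub>R cacc c \<gamma> s)) (at s)" if "s \<in> ?J" for s
    using TN.curve_jets[OF \<gamma> cd(1), of s] that by (auto simp: has_vector_derivative_def)
  have vel: "cvel d \<gamma> s = Df (trans c d) (snd c (\<gamma> s)) (cvel c \<gamma> s)" if s: "s \<in> ?J" for s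
  proof -
    have "((\<lambda>s. trans c d (snd c (\<gamma> s))) has_derivative
        (\<lambda>h. Df (trans c d) (snd c (\<gamma> s)) (h *\<^sub>R cvel c \<gamma> s))) (at s)"
      by (rule has_derivative_compose[OF jets(1)[OF s] smooth_on_imp_has_derivative[OF trans_smooth[OF cd(1,2)] x[OF s]]])
    then have "((\<lambda>s. trans c d (snd c (\<gamma> s))) has_vector_derivative
        Df (trans c d) (snd c (\<gamma> s)) (cvel c \<gamma> s)) (at s)"
      by (simp add: has_vector_derivative_def linear_cmul[OF trans_linear[OF cd(1,2) x[OF s]]])
    from vector_derivative_at[OF this] show ?thesis
      unfolding cvel_def[of d] using vector_derivative_cong_open[OF J s pos] by simp
  qed
  then show "cvel d \<gamma> t = Df (trans c d) (snd c (\<gamma> t)) (cvel c \<gamma> t)" using tJ by blast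
  have "((\<lambda>s. Df (trans c d) (snd c (\<gamma> s)) (cvel c \<gamma> s)) has_derivative (\<lambda>h.
      Df (\<lambda>p. Df (trans c d) p (cvel c \<gamma> t)) (snd c (\<gamma> t)) (h *\<^sub>R cvel c \<gamma> t)
        + Df (trans c d) (snd c (\<gamma> t)) (h *\<^sub>R cacc c \<gamma> t))) (at t)"
    by (rule has_derivative_frechet_apply[OF transition_open[OF cd(1,2)] trans_smooth[OF cd(1,2)] x[OF tJ] jets[OF tJ]])
  then have "((\<lambda>s. Df (trans c d) (snd c (\<gamma> s)) (cvel c \<gamma> s)) has_vector_derivative
      Df (\<lambda>p. Df (trans c d) p (cvel c \<gamma> t)) (snd c (\<gamma> t)) (cvel c \<gamma> t)
        + Df (trans c d) (snd c (\<gamma> t)) (cacc c \<gamma> t)) (at t)"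
    by (simp add: has_vector_derivative_def linear_cmul[OF trans_linear[OF cd(1,2) x[OF tJ]]]
        linear_cmul[OF smooth_on_linear_frechet[OF smooth_on_frechet[OF trans_smooth[OF cd(1,2)]] x[OF tJ]]] scaleR_add_right)
  from vector_derivative_at[OF this]
  show "cacc d \<gamma> t = Df (\<lambda>p. Df (trans c d) p (cvel c \<gamma> t)) (snd c (\<gamma> t)) (cvel c \<gamma> t)
        + Df (trans c d) (snd c (\<gamma> t)) (cacc c \<gamma> t)"
    unfolding cacc_def[of d] using vector_derivative_cong_open[OF J tJ vel] by simp
qed

lemma smooth_curve_inclusion:
  assumes \<gamma>: "smooth_curve N I \<gamma>" shows "smooth_curve M I \<gamma>"
proof (rule TM.smooth_curveI)
  show "open_interval I" using \<gamma> by (simp add: smooth_curve_def)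
  show "\<gamma> ` I \<subseteq> points M" using TN.smooth_curve_points[OF \<gamma>] sub by blast
  fix d assume d: "d \<in> charts M"
  have "{t \<in> I. \<gamma> t \<in> fst d} = {t \<in> I. \<gamma> t \<in> fst d \<inter> points N}" using TN.smooth_curve_points[OF \<gamma>] by blast
  then have op: "open {t \<in> I. \<gamma> t \<in> fst d}"
    using openin_curve_preimage[OF \<gamma> openin_inclusion[OF charted_openin_chart[OF chM d]]] by simp
  have "smooth_on {t \<in> I. \<gamma> t \<in> fst d} (\<lambda>t. snd d (\<gamma> t))"
  proof (rule smooth_on_local)
    fix t assume t: "t \<in> {t \<in> I. \<gamma> t \<in> fst d}"
    then obtain c where c: "c \<in> charts N" "\<gamma> t \<in> fst c"
      using charted_ex_chart[OF chN TN.smooth_curve_points[OF \<gamma>]] by blast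
    let ?J = "{s \<in> I. \<gamma> s \<in> fst c \<inter> fst d}"
    have J: "open ?J" by (rule openin_curve_preimage[OF \<gamma> overlap_openin[OF c(1) d]])
    have x: "smooth_on ?J (\<lambda>s. snd c (\<gamma> s))" by (rule smooth_on_subset[OF TN.smooth_curve_chart(2)[OF \<gamma> c(1)]]) auto
    have "smooth_on ?J (\<lambda>s. trans c d (snd c (\<gamma> s)))"
      by (rule smooth_on_compose[OF J _ x trans_smooth[OF c(1) d]]) auto
    then have "smooth_on ?J (\<lambda>t. snd d (\<gamma> t))"
      by (rule smooth_on_cong[OF J, rotated])
         (simp add: trans_def chart_inv_chart[OF charted_inj[OF chN c(1)]])
    then show "\<exists>T. open T \<and> t \<in> T \<and> smooth_on T (\<lambda>t. snd d (\<gamma> t))" using J t c by blast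
  qed
  with op show "open {t \<in> I. \<gamma> t \<in> fst d} \<and> smooth_on {t \<in> I. \<gamma> t \<in> fst d} (\<lambda>t. snd d (\<gamma> t))" by blast
qed

end

lemma (in smooth_mfd) velocity_in:
  assumes \<gamma>: "smooth_curve M I \<gamma>" and t: "t \<in> I"
  shows "velocity M \<gamma> t \<in> tangent_space M (\<gamma> t)"
proof (rule tangent_spaceI)
  show "\<gamma> t \<in> points M" by (rule smooth_curve_points[OF \<gamma> t])
  show "snd (velocity M \<gamma> t) c = 0" if "c \<notin> charts_at M (\<gamma> t)" for c using that by (simp add: velocity_def)
  show "snd (velocity M \<gamma> t) d = Df (snd d \<circ> chart_inv c) (snd c (\<gamma> t)) (snd (velocity M \<gamma> t) c)"
    if "c \<in> charts_at M (\<gamma> t)" "d \<in> charts_at M (\<gamma> t)" for c d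
    using MM.curve_transition(2)[OF \<gamma> that t] that by (simp add: velocity_snd MM.trans_def)
qed simp

lemma (in inclusion) tincl_velocity:
  assumes \<gamma>: "smooth_curve N I \<gamma>" and t: "t \<in> I"
  shows "tincl M N (velocity N \<gamma> t) = velocity M \<gamma> t"
proof -
  have v: "velocity N \<gamma> t \<in> tangent_space N (\<gamma> t)" by (rule TN.velocity_in[OF \<gamma> t])
  obtain c where c: "c \<in> charts_at N (\<gamma> t)"
    using charted_ex_charts_at[OF chN TN.smooth_curve_points[OF \<gamma> t]] by blast
  obtain d where d: "d \<in> charts_at M (\<gamma> t)"
    using charted_ex_charts_at[OF chM] TN.smooth_curve_points[OF \<gamma> t] sub by blast
  show ?thesis
    by (rule TM.tangent_space_eqI[OF tincl_in[OF v] TM.velocity_in[OF smooth_curve_inclusion[OF \<gamma>] t] d])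
       (simp add: tincl_snd[OF v c d] TN.velocity_snd c TM.velocity_snd d curve_transition(2)[OF \<gamma> c d t])
qed

context finsler
begin

lemma Lc_change:
  assumes d: "d \<in> charts M" and e: "e \<in> charts M" and q: "q \<in> tdom d U \<inter> MM.tdom2 d e"
  shows "fst q \<in> snd d ` (fst d \<inter> fst e) \<and> tangent_lift (MM.trans d e) q \<in> tdom e U \<and>
    Lc d q = Lc e (tangent_lift (MM.trans d e) q)"
proof -
  have q2: "q \<in> MM.tdom2 d e" using q by blast
  note ca = MM.tdom2_charts_at[OF d e q2]
  have "tinv d q = tinv e (tangent_lift (MM.trans d e) q)"
  proof (rule tangent_space_eqI[OF tinv_in[OF d ca(3)] _ ca(2)])
    have x: "fst (tangent_lift (MM.trans d e) q) \<in> snd e ` fst e" using ca(5) by (simp add: tangent_lift_def)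
    show "tinv e (tangent_lift (MM.trans d e) q) \<in> tangent_space M (chart_inv d (fst q))"
      using tinv_in[OF e x] ca(6) by (simp add: tangent_lift_def)
    show "snd (tinv d q) e = snd (tinv e (tangent_lift (MM.trans d e) q)) e"
      unfolding tinv_snd[OF e x] unfolding tinv_def coord_field_snd[OF ca(2)]
      using ca(3) by (simp add: tangent_lift_def MM.trans_def chart_chart_inv)
  qed
  moreover have "fst q \<in> snd d ` (fst d \<inter> fst e)" using q2 by (simp add: MM.tdom2_def mem_Times_iff)
  moreover have "tinv d q \<in> U" using q by (simp add: tdom_def)
  ultimately show ?thesis using ca(5) by (simp add: tdom_def Lc_def tangent_lift_def)
qed

lemma tdom_overlap_open: "d \<in> charts M \<Longrightarrow> e \<in> charts M \<Longrightarrow> open (tdom d U \<inter> MM.tdom2 d e)"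
  using tdom_U_open MM.tdom2_open by blast

end

section \<open>The covariant acceleration of a curve\<close>

context chern
begin

lemma cov_deriv_coord:
  assumes \<gamma>: "smooth_curve M I \<gamma>" and t: "t \<in> I" and v: "velocity M \<gamma> t \<in> U" and c: "c \<in> charts_at M (\<gamma> t)"
  shows "snd (cov_deriv M nab \<gamma> (velocity M \<gamma>) t) c =
    cacc c \<gamma> t + Gam c (snd c (\<gamma> t), cvel c \<gamma> t) (cvel c \<gamma> t) (cvel c \<gamma> t)"
proof -
  let ?z = "(snd c (\<gamma> t), cvel c \<gamma> t)" and ?y = "cvel c \<gamma> t"
  have c': "c \<in> charts M" "\<gamma> t \<in> fst c" using c by (auto simp: charts_at_def)
  have vc: "snd (velocity M \<gamma> t) c = ?y" by (rule velocity_snd[of c \<gamma> t, OF c])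
  have z: "?z \<in> tdom c U" and zv: "tinv c ?z = velocity M \<gamma> t"
    using U_chart(2,3)[OF v, of c] c by (simp_all add: vc)
  note G = Gam_linear[OF c'(1) z]
  have der: "deriv (\<lambda>s. snd (velocity M \<gamma> s) c \<bullet> k) t = cacc c \<gamma> t \<bullet> k" for k
  proof -
    have "((\<lambda>s. cvel c \<gamma> s \<bullet> k) has_field_derivative cacc c \<gamma> t \<bullet> k) (at t)"
      using has_derivative_inner_left[OF curve_jets(2)[OF \<gamma> c'(1) t c'(2), unfolded has_vector_derivative_def], of k]
      by (simp add: has_field_derivative_def mult.commute[of _ "_ \<bullet> _"])
    then have "((\<lambda>s. snd (velocity M \<gamma> s) c \<bullet> k) has_field_derivative cacc c \<gamma> t \<bullet> k) (at t)"
      by (rule has_field_derivative_transform_within_open[OF _ smooth_curve_chart(1)[OF \<gamma> c'(1)]])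
         (use t c' in \<open>auto simp: velocity_snd charts_at_def\<close>)
    then show ?thesis by (rule DERIV_imp_deriv)
  qed
  \<comment> \<open>Bilinearity of \<open>Gam\<close> reassembles the double sum over basis vectors
    in \<open>cov_deriv\<close> into a single vector.\<close>
  have "Gam c ?z ?y ?y = (\<Sum>i\<in>Basis. (?y \<bullet> i) *\<^sub>R Gam c ?z i ?y)" by (rule linear_sum_Basis[OF G(1)])
  also have "\<dots> = (\<Sum>i\<in>Basis. (?y \<bullet> i) *\<^sub>R (\<Sum>j\<in>Basis. (?y \<bullet> j) *\<^sub>R Gam c ?z i j))"
    by (intro sum.cong refl arg_cong[of _ _ "\<lambda>v. _ *\<^sub>R v"]) (rule linear_sum_Basis[OF G(2)])
  finally have chr: "(\<Sum>i\<in>Basis. \<Sum>j\<in>Basis. christoffel M nab c k i j (velocity M \<gamma> t) * (?y \<bullet> i) * (?y \<bullet> j)) =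
      Gam c ?z ?y ?y \<bullet> k" for k
    by (simp add: inner_sum_left sum_distrib_left christoffel_def Gam_def zv mult_ac)
  have "snd (cov_deriv M nab \<gamma> (velocity M \<gamma>) t) c = (\<Sum>k\<in>Basis. (cacc c \<gamma> t \<bullet> k + Gam c ?z ?y ?y \<bullet> k) *\<^sub>R k)"
    using c by (simp add: cov_deriv_def der vc chr)
  also have "\<dots> = (\<Sum>k\<in>Basis. ((cacc c \<gamma> t + Gam c ?z ?y ?y) \<bullet> k) *\<^sub>R k)" by (simp add: inner_add_left)
  also have "\<dots> = cacc c \<gamma> t + Gam c ?z ?y ?y" by (rule euclidean_representation)
  finally show ?thesis .
qed

lemma cov_deriv_euler_lagrange:
  assumes \<gamma>: "smooth_curve M I \<gamma>" and t: "t \<in> I" and v: "velocity M \<gamma> t \<in> U" and c: "c \<in> charts_at M (\<gamma> t)"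
  shows "(snd c (\<gamma> t), cvel c \<gamma> t) \<in> tdom c U"
    "gc c (snd c (\<gamma> t), cvel c \<gamma> t) (snd (cov_deriv M nab \<gamma> (velocity M \<gamma>) t) c) w =
      1/2 * euler_lagrange (Lc c) (snd c (\<gamma> t), cvel c \<gamma> t) (cacc c \<gamma> t) w"
proof -
  have c': "c \<in> charts M" using c by (simp add: charts_at_def)
  show z: "(snd c (\<gamma> t), cvel c \<gamma> t) \<in> tdom c U"
    using U_chart(2)[OF v, of c] c by (simp add: velocity_snd)
  show "gc c (snd c (\<gamma> t), cvel c \<gamma> t) (snd (cov_deriv M nab \<gamma> (velocity M \<gamma>) t) c) w =
      1/2 * euler_lagrange (Lc c) (snd c (\<gamma> t), cvel c \<gamma> t) (cacc c \<gamma> t) w"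
    unfolding cov_deriv_coord[OF assms] by (rule chern_euler_lagrange[OF c' z])
qed

lemma cov_deriv_in:
  assumes \<gamma>: "smooth_curve M I \<gamma>" and t: "t \<in> I" and v: "velocity M \<gamma> t \<in> U"
  shows "cov_deriv M nab \<gamma> (velocity M \<gamma>) t \<in> tangent_space M (\<gamma> t)"
proof (rule tangent_spaceI)
  let ?A = "cov_deriv M nab \<gamma> (velocity M \<gamma>) t"
  show "fst ?A = \<gamma> t" by (simp add: cov_deriv_def)
  show "\<gamma> t \<in> points M" by (rule smooth_curve_points[OF \<gamma> t])
  show "snd ?A c = 0" if "c \<notin> charts_at M (\<gamma> t)" for c using that by (simp add: cov_deriv_def)
  fix d e assume d: "d \<in> charts_at M (\<gamma> t)" and e: "e \<in> charts_at M (\<gamma> t)"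
  have de: "d \<in> charts M" "e \<in> charts M" using d e by (auto simp: charts_at_def)
  define \<phi> where "\<phi> = MM.trans d e"
  define D where "D = Df \<phi> (snd d (\<gamma> t))"
  define q where "q = (snd d (\<gamma> t), cvel d \<gamma> t)"
  define Q where "Q = (snd e (\<gamma> t), cvel e \<gamma> t)"
  note tr = MM.curve_transition[OF \<gamma> d e t, folded \<phi>_def D_def]
  have Q: "Q = tangent_lift \<phi> q" by (simp add: Q_def q_def tangent_lift_def tr D_def)
  have qd: "q \<in> tdom d U \<inter> MM.tdom2 d e"
    using cov_deriv_euler_lagrange(1)[OF \<gamma> t v d] d e by (auto simp: q_def MM.tdom2_def charts_at_def)
  have Qd: "Q \<in> tdom e U" unfolding Q_def by (rule cov_deriv_euler_lagrange(1)[OF \<gamma> t v e])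
  have lc: "\<And>q. q \<in> tdom d U \<inter> MM.tdom2 d e \<Longrightarrow> fst q \<in> snd d ` (fst d \<inter> fst e) \<and> tangent_lift \<phi> q \<in> tdom e U \<and>
    Lc d q = Lc e (tangent_lift \<phi> q)" unfolding \<phi>_def by (rule Lc_change[OF de])
  have nat: "open (snd d ` (fst d \<inter> fst e))" "smooth_on (snd d ` (fst d \<inter> fst e)) \<phi>" "open (tdom e U)" "smooth_on (tdom e U) (Lc e)"
    "open (tdom d U \<inter> MM.tdom2 d e)"
    using MM.transition_open[OF de] MM.trans_smooth[OF de] tdom_U_open[OF de(2)] Lc_smooth[OF de(2)]
      tdom_overlap_open[OF de] by (simp_all add: \<phi>_def)
  have el: "euler_lagrange (Lc d) q (cacc d \<gamma> t) w = euler_lagrange (Lc e) Q (cacc e \<gamma> t) (D w)" for w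
    unfolding Q unfolding q_def tr(3) D_def
    by (rule euler_lagrange_natural[OF nat, of "snd d (\<gamma> t)" "cvel d \<gamma> t"]) (use qd lc in \<open>simp_all add: q_def\<close>)
  have g: "gc d q u w = gc e Q (D u) (D w)" for u w
    unfolding Q unfolding q_def gc_def D_def
    by (subst fibre_hessian_natural[OF nat, of "snd d (\<gamma> t)" "cvel d \<gamma> t"]) (use qd lc in \<open>simp_all add: q_def\<close>)
  have "gc e Q (D (snd ?A d) - snd ?A e) w' = 0" for w'
  proof -
    \<comment> \<open>The derivative of the reverse transition is a right inverse of D, so the
      vectors D w exhaust all test vectors w'.\<close>
    define w where "w = Df (snd d \<circ> chart_inv e) (snd e (\<gamma> t)) w'"
    have "D w = w'"
      using MM.transition_chain_source[OF e d e, of w'] transition_refl[OF ch e, of w']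
      by (simp add: D_def \<phi>_def MM.trans_def w_def)
    moreover have "gc e Q (D (snd ?A d)) (D w) = gc e Q (snd ?A e) (D w)"
      using cov_deriv_euler_lagrange(2)[OF \<gamma> t v d, of w, folded q_def] g[of "snd ?A d" w] el[of w]
        cov_deriv_euler_lagrange(2)[OF \<gamma> t v e, of "D w", folded Q_def] by linarith
    ultimately show ?thesis by (simp add: linear_diff[OF gc_linear[OF de(2) Qd]])
  qed
  then have "D (snd ?A d) - snd ?A e = 0" by (rule gc_nondegenerate[OF de(2) Qd])
  then show "snd ?A e = Df (snd e \<circ> chart_inv d) (snd d (\<gamma> t)) (snd ?A d)"
    by (simp add: D_def \<phi>_def MM.trans_def)
qed

end

lemma (in finsler) euler_lagrange_split:
  assumes c: "c \<in> charts M" and q: "q \<in> tdom c U"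
  shows "euler_lagrange (Lc c) q z w = euler_lagrange (Lc c) q 0 w + 2 * gc c q z w"
  using euler_lagrange_acceleration[OF Lc_smooth[OF c] q, of 0 z w] by (simp add: gc_def)

lemma (in finsler) gc_eqI:
  assumes c: "c \<in> charts M" and q: "q \<in> tdom c U" and eq: "\<And>w. gc c q a w = gc c q b w"
  shows "a = b"
  using gc_nondegenerate[OF c q, of "a - b"] eq by (simp add: linear_diff[OF gc_linear[OF c q]])

section \<open>The constrained dynamics\<close>

context constrained_system
begin

text \<open>The acceleration, in a chart of \<open>N\<close>, of a motion of the induced system.\<close>

definition accel :: "('m, 'f) chart \<Rightarrow> 'f \<times> 'f \<Rightarrow> 'f" where
  "accel c q = (SOME a. \<forall>w. FN.gc c q a w =
     FN.gc c q (snd (Fh (TN.tinv c q)) c) w - 1/2 * euler_lagrange (FN.Lc c) q 0 w)"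

lemma accel_linear:
  assumes c: "c \<in> charts N" and q: "q \<in> TN.tdom c Uh"
  shows "linear (\<lambda>w. FN.gc c q f w - 1/2 * euler_lagrange (FN.Lc c) q 0 w)"
  using linear_compose_sub[OF FN.gc_linear_right[OF c q]
      linear_compose_scale_right[OF euler_lagrange_linear[OF FN.tdom_U_open[OF c] FN.Lc_smooth[OF c] q], of "1/2" 0]]
  by simp

lemma gc_accel:
  assumes c: "c \<in> charts N" and q: "q \<in> TN.tdom c Uh"
  shows "FN.gc c q (accel c q) w = FN.gc c q (snd (Fh (TN.tinv c q)) c) w - 1/2 * euler_lagrange (FN.Lc c) q 0 w"
  using someI_ex[OF FN.gc_represents[OF c q accel_linear[OF c q]]] unfolding accel_def by blast

text \<open>The Euler--Lagrange expression is affine in the acceleration with linear part 2 g, so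
  nondegeneracy solves the equation for the acceleration.\<close>

lemma accel_iff:
  assumes c: "c \<in> charts N" and q: "q \<in> TN.tdom c Uh"
  shows "(\<forall>w. FN.gc c q (snd (Fh (TN.tinv c q)) c) w = 1/2 * euler_lagrange (FN.Lc c) q a w) \<longleftrightarrow> a = accel c q"
proof -
  have "(\<forall>w. FN.gc c q (snd (Fh (TN.tinv c q)) c) w = 1/2 * euler_lagrange (FN.Lc c) q a w) \<longleftrightarrow>
      (\<forall>w. FN.gc c q a w = FN.gc c q (accel c q) w)"
    unfolding gc_accel[OF c q] by (subst FN.euler_lagrange_split[OF c q]) (simp add: field_simps eq_commute)
  then show ?thesis using FN.gc_eqI[OF c q] by blast
qed

lemma accel_smooth:
  assumes c: "c \<in> charts N" shows "smooth_on (TN.tdom c Uh) (accel c)"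
proof (rule FN.gc_solution_smooth[OF c FN.tdom_U_open[OF c] smooth_on_id _ _ accel_linear[OF c] gc_accel[OF c]])
  let ?T = "TN.tdom c Uh"
  have T: "open ?T" by (rule FN.tdom_U_open[OF c])
  have id: "smooth_on ?T (\<lambda>q. q)" by (rule smooth_on_id)
  show "smooth_on ?T (\<lambda>q. FN.gc c q (snd (Fh (TN.tinv c q)) c) w - 1/2 * euler_lagrange (FN.Lc c) q 0 w)" for w
    by (rule smooth_on_diff[OF T FN.gc_smooth_compose[OF c T id _ induced_force_smooth[OF c] smooth_on_const]
        smooth_on_linear_comp[OF T bounded_linear_mult_right
          smooth_on_euler_lagrange[OF T FN.Lc_smooth[OF c] T id _ smooth_on_const]]]) auto
qed auto

end

lemma (in inclusion) curve_point: "smooth_curve N I \<gamma> \<Longrightarrow> t \<in> I \<Longrightarrow> \<exists>c d. c \<in> charts_at N (\<gamma> t) \<and> d \<in> charts_at M (\<gamma> t)"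
  using charted_ex_charts_at[OF chN TN.smooth_curve_points] charted_ex_charts_at[OF chM, of "\<gamma> t"]
    TN.smooth_curve_points sub by blast

lemma (in finsler_inclusion) velocity_Uh:
  "smooth_curve N I \<gamma> \<Longrightarrow> t \<in> I \<Longrightarrow> velocity N \<gamma> t \<in> Uh \<longleftrightarrow> velocity M \<gamma> t \<in> U"
  using TN.tangent_space_imp_vectors[OF TN.velocity_in] by (simp add: induced_domain_def tincl_velocity)

lemma (in finsler_inclusion) velocity_inj:
  assumes "smooth_curve N I \<gamma>" "t \<in> I" "smooth_curve N J \<delta>" "s \<in> J" "velocity M \<gamma> t = velocity M \<delta> s"
  shows "velocity N \<gamma> t = velocity N \<delta> s"
proof -
  have p: "\<gamma> t = \<delta> s" using assms(5) by (metis TM.velocity_fst)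
  show ?thesis
    using inj_onD[OF inj_tincl[OF TN.smooth_curve_points[OF assms(1,2)]], of "velocity N \<gamma> t" "velocity N \<delta> s"]
      TN.velocity_in[OF assms(1,2)] TN.velocity_in[OF assms(3,4)] assms(5)
    by (simp add: p tincl_velocity[OF assms(1,2)] tincl_velocity[OF assms(3,4)])
qed

section \<open>The tangential equation and its solutions\<close>

locale constrained_chern = constrained_system M N U L F + CM: chern M U L nab
  for M :: "('m, 'e::euclidean_space) manifold" and N :: "('m, 'f::euclidean_space) manifold" and U L F nab
begin

abbreviation cov where "cov \<gamma> \<equiv> cov_deriv M nab \<gamma> (velocity M \<gamma>)"

text \<open>Newton's equation modulo the orthogonal complement of \<open>TN\<close>: the form in which it does not
  mention the reaction force.\<close>

definition tangential_newton :: "real set \<Rightarrow> (real \<Rightarrow> 'm) \<Rightarrow> bool" where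
  "tangential_newton I \<gamma> \<longleftrightarrow> smooth_curve N I \<gamma> \<and> (\<forall>t\<in>I. velocity M \<gamma> t \<in> U \<and>
     (\<forall>w\<in>tangent_space N (\<gamma> t). fund_tensor L (velocity M \<gamma> t) (cov \<gamma> t) (tincl M N w) =
        fund_tensor L (velocity M \<gamma> t) (F (velocity M \<gamma> t)) (tincl M N w)))"

lemma cov_in:
  "smooth_curve N I \<gamma> \<Longrightarrow> t \<in> I \<Longrightarrow> velocity M \<gamma> t \<in> U \<Longrightarrow> cov \<gamma> t \<in> tangent_space M (\<gamma> t)"
  by (rule CM.cov_deriv_in[OF smooth_curve_inclusion])

lemma velocity_tdom:
  assumes \<gamma>: "smooth_curve N I \<gamma>" and t: "t \<in> I" and V: "velocity M \<gamma> t \<in> U"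
    and c: "c \<in> charts_at N (\<gamma> t)"
  shows "(snd c (\<gamma> t), cvel c \<gamma> t) \<in> TN.tdom c Uh" "TN.tinv c (snd c (\<gamma> t), cvel c \<gamma> t) = velocity N \<gamma> t"
  using FN.U_chart(2,3)[of "velocity N \<gamma> t" c] velocity_Uh[OF \<gamma> t] V c by (simp_all add: TN.velocity_snd)

text \<open>A chart d of M is only an intermediary: there the pairing is the Euler--Lagrange
  expression of \<open>FM.Lc d\<close>, and naturality along \<open>trans c d\<close> expresses it
  through the induced metric in the chart c of N.\<close>

lemma fund_tensor_cov:
  assumes \<gamma>: "smooth_curve N I \<gamma>" and t: "t \<in> I" and V: "velocity M \<gamma> t \<in> U"
    and c: "c \<in> charts_at N (\<gamma> t)" and w: "w \<in> tangent_space N (\<gamma> t)"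
  shows "fund_tensor L (velocity M \<gamma> t) (cov \<gamma> t) (tincl M N w) =
    1/2 * euler_lagrange (FN.Lc c) (snd c (\<gamma> t), cvel c \<gamma> t) (cacc c \<gamma> t) (snd w c)"
proof -
  obtain d where d: "d \<in> charts_at M (\<gamma> t)" using curve_point[OF \<gamma> t] by blast
  have cd: "c \<in> charts N" "d \<in> charts M" using c d by (auto simp: charts_at_def)
  note \<gamma>M = smooth_curve_inclusion[OF \<gamma>]
  note tr = curve_transition[OF \<gamma> c d t]
  let ?q = "(snd c (\<gamma> t), cvel c \<gamma> t)" and ?Q = "(snd d (\<gamma> t), cvel d \<gamma> t)"
  let ?D = "Df (trans c d) (snd c (\<gamma> t))"
  have Q: "tangent_lift (trans c d) ?q = ?Q" by (simp add: tangent_lift_def tr)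
  have q: "?q \<in> TN.tdom c Uh \<inter> tdom2 c d"
    using velocity_tdom(1)[OF \<gamma> t V c] c d by (auto simp: tdom2_def charts_at_def)
  have "fund_tensor L (velocity M \<gamma> t) (cov \<gamma> t) (tincl M N w) = FM.gc d ?Q (snd (cov \<gamma> t) d) (?D (snd w c))"
    using FM.fund_tensor_eq_gc[OF V, of d "cov \<gamma> t" "tincl M N w"] d cov_in[OF \<gamma> t V] tincl_in[OF w] tincl_snd[OF w c d]
    by (simp add: TM.velocity_snd)
  also have "\<dots> = 1/2 * euler_lagrange (FM.Lc d) ?Q (cacc d \<gamma> t) (?D (snd w c))"
    by (rule CM.cov_deriv_euler_lagrange(2)[OF \<gamma>M t V d])
  also have "euler_lagrange (FM.Lc d) ?Q (cacc d \<gamma> t) (?D (snd w c)) = euler_lagrange (FN.Lc c) ?q (cacc c \<gamma> t) (snd w c)"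
    unfolding euler_lagrange_induced[OF cd q] Q tr(3) ..
  finally show ?thesis .
qed

lemma fund_tensor_force:
  assumes v: "v \<in> Uh" and c: "c \<in> charts_at N (fst v)" and w: "w \<in> tangent_space N (fst v)"
  shows "fund_tensor L (tincl M N v) (F (tincl M N v)) (tincl M N w) =
    FN.gc c (snd c (fst v), snd v c) (snd (Fh v) c) (snd w c)"
  using induced_force(2)[OF v w] fund_tensor_tincl[OF Uh_D(1)[OF v] induced_force(1)[OF v] w]
    FN.fund_tensor_eq_gc[OF v c induced_force(1)[OF v] w] by simp

text \<open>Both pairings are expressed in a chart of N, where every coordinate vector belongs to
  some tangent vector w. So the tangential equation becomes an explicit second-order equation for
  the coordinates of the curve.\<close>

lemma tangential_newton_accel:
  assumes \<gamma>: "smooth_curve N I \<gamma>" and t: "t \<in> I" and V: "velocity M \<gamma> t \<in> U"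
    and c: "c \<in> charts_at N (\<gamma> t)"
  shows "(\<forall>w\<in>tangent_space N (\<gamma> t). fund_tensor L (velocity M \<gamma> t) (cov \<gamma> t) (tincl M N w) =
        fund_tensor L (velocity M \<gamma> t) (F (velocity M \<gamma> t)) (tincl M N w)) \<longleftrightarrow>
    cacc c \<gamma> t = accel c (snd c (\<gamma> t), cvel c \<gamma> t)"
proof -
  let ?q = "(snd c (\<gamma> t), cvel c \<gamma> t)" and ?v = "velocity N \<gamma> t"
  have c': "c \<in> charts N" using c by (simp add: charts_at_def)
  have v: "?v \<in> Uh" using V velocity_Uh[OF \<gamma> t] by simp
  have force: "fund_tensor L (velocity M \<gamma> t) (F (velocity M \<gamma> t)) (tincl M N w) = FN.gc c ?q (snd (Fh ?v) c) (snd w c)"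
    if "w \<in> tangent_space N (\<gamma> t)" for w
    using fund_tensor_force[OF v, of c w] c that by (simp add: tincl_velocity[OF \<gamma> t] TN.velocity_snd)
  have ex: "\<exists>w'\<in>tangent_space N (\<gamma> t). snd w' c = w" for w
    using TN.coord_field_in[OF c, of w] TN.coord_field_self[OF c, of w] by blast
  have "(\<forall>w\<in>tangent_space N (\<gamma> t). fund_tensor L (velocity M \<gamma> t) (cov \<gamma> t) (tincl M N w) =
        fund_tensor L (velocity M \<gamma> t) (F (velocity M \<gamma> t)) (tincl M N w)) \<longleftrightarrow>
      (\<forall>w. FN.gc c ?q (snd (Fh (TN.tinv c ?q)) c) w = 1/2 * euler_lagrange (FN.Lc c) ?q (cacc c \<gamma> t) w)"
    unfolding velocity_tdom(2)[OF assms] using force fund_tensor_cov[OF assms] ex by metis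
  then show ?thesis using accel_iff[OF c' velocity_tdom(1)[OF assms]] by simp
qed

text \<open>Any Chern connection of the induced metric will do, because in a chart of N both sides
  reduce to the same equation with \<open>accel\<close>.\<close>

lemma motion_iff:
  assumes nabN: "chern_connection N Uh Lh nabN"
  shows "motion N Uh nabN Fh I \<gamma> \<longleftrightarrow> tangential_newton I \<gamma>"
proof -
  interpret CN: chern N Uh Lh nabN by unfold_locales (rule nabN)
  have "cov_deriv N nabN \<gamma> (velocity N \<gamma>) t = Fh (velocity N \<gamma> t) \<longleftrightarrow>
     (\<forall>w\<in>tangent_space N (\<gamma> t). fund_tensor L (velocity M \<gamma> t) (cov \<gamma> t) (tincl M N w) =
        fund_tensor L (velocity M \<gamma> t) (F (velocity M \<gamma> t)) (tincl M N w))"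
    if \<gamma>: "smooth_curve N I \<gamma>" and t: "t \<in> I" and V: "velocity M \<gamma> t \<in> U" for t
  proof -
    obtain c where c: "c \<in> charts_at N (\<gamma> t)" using curve_point[OF \<gamma> t] by blast
    have c': "c \<in> charts N" using c by (simp add: charts_at_def)
    let ?q = "(snd c (\<gamma> t), cvel c \<gamma> t)" and ?v = "velocity N \<gamma> t"
    have v: "?v \<in> Uh" using V velocity_Uh[OF \<gamma> t] by simp
    have "cov_deriv N nabN \<gamma> (velocity N \<gamma>) t = Fh ?v \<longleftrightarrow>
        snd (cov_deriv N nabN \<gamma> (velocity N \<gamma>) t) c = snd (Fh ?v) c"
      using TN.tangent_space_eqI[OF CN.cov_deriv_in[OF \<gamma> t v] _ c, of "Fh ?v"] induced_force(1)[OF v]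
      by (metis TN.velocity_fst)
    also have "\<dots> \<longleftrightarrow> (\<forall>w. FN.gc c ?q (snd (Fh ?v) c) w = FN.gc c ?q (snd (cov_deriv N nabN \<gamma> (velocity N \<gamma>) t) c) w)"
      using FN.gc_eqI[OF c' velocity_tdom(1)[OF \<gamma> t V c], of "snd (Fh ?v) c"] by metis
    also have "\<dots> \<longleftrightarrow> cacc c \<gamma> t = accel c ?q"
      unfolding CN.cov_deriv_euler_lagrange(2)[OF \<gamma> t v c]
      using accel_iff[OF c' velocity_tdom(1)[OF \<gamma> t V c]] by (simp add: velocity_tdom(2)[OF \<gamma> t V c])
    finally show ?thesis by (simp only: tangential_newton_accel[OF \<gamma> t V c])
  qed
  then show ?thesis
    unfolding motion_def tangential_newton_def using velocity_Uh[of I \<gamma>] by blast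
qed

text \<open>The second-order equation is solved as a first-order system for position and velocity on
  the coordinate image of \<open>Uh\<close>; staying in this set keeps the position in the chart and
  the velocity admissible.\<close>

lemma tangential_newton_exists:
  assumes v: "v \<in> Uh"
  shows "\<exists>I \<gamma>. tangential_newton I \<gamma> \<and> 0 \<in> I \<and> velocity N \<gamma> 0 = v"
proof -
  obtain c where c: "c \<in> charts_at N (fst v)" using FN.U_ex_chart[OF v] by blast
  have c': "c \<in> charts N" "fst v \<in> fst c" using c by (auto simp: charts_at_def)
  let ?T = "TN.tdom c Uh"
  have T: "open ?T" by (rule FN.tdom_U_open[OF c'(1)])
  have z0: "(snd c (fst v), snd v c) \<in> ?T" by (rule FN.U_chart(2)[OF v c])
  have sm: "smooth_on ?T (\<lambda>q. (snd q, accel c q))"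
    by (rule smooth_on_Pair[OF T smooth_on_snd[OF T smooth_on_id] accel_smooth[OF c'(1)]])
  obtain e u where e: "e > 0" and u0: "u 0 = (snd c (fst v), snd v c)" and uT: "u ` {-e<..<e} \<subseteq> ?T"
    and us: "smooth_on {-e<..<e} u"
    and u: "\<And>t. t \<in> {-e<..<e} \<Longrightarrow> (u has_vector_derivative (snd (u t), accel c (u t))) (at t)"
    using smooth_ode_local_solution[OF T sm z0] by blast
  define I where "I = {-e<..<e}"
  have I: "open I" "0 \<in> I" using e by (simp_all add: I_def)
  note uT = uT[folded I_def] and us = us[folded I_def] and u = u[folded I_def]
  define \<gamma> where "\<gamma> t = chart_inv c (fst (u t))" for t
  have x: "fst (u t) \<in> snd c ` fst c" if "t \<in> I" for t using uT that by (auto simp: TN.tdom_def)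
  have \<gamma>c: "\<gamma> t \<in> fst c" "snd c (\<gamma> t) = fst (u t)" if "t \<in> I" for t
    using x[OF that] by (simp_all add: \<gamma>_def chart_inv_in chart_chart_inv)
  have fu: "smooth_on I (\<lambda>t. fst (u t))" by (rule smooth_on_fst[OF I(1) us])
  have \<gamma>: "smooth_curve N I \<gamma>"
  proof (rule TN.smooth_curveI)
    show "open_interval I" using e by (auto simp: open_interval_def I_def is_interval_oo)
    show "\<gamma> ` I \<subseteq> points N" using \<gamma>c charted_chart_subset[OF chN c'(1)] by blast
    fix b assume b: "b \<in> charts N"
    \<comment> \<open>The times at which the curve lies in another chart b, described through its
      coordinates in c so that openness follows from continuity of u.\<close>
    let ?J = "I \<inter> (\<lambda>t. fst (u t)) -` (snd c ` (fst c \<inter> fst b))"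
    have J: "open ?J"
      by (rule continuous_open_preimage[OF smooth_on_imp_continuous_on[OF fu] I(1) TN.MM.transition_open[OF c'(1) b]])
    have "{t \<in> I. \<gamma> t \<in> fst b} = ?J"
    proof -
      have "\<gamma> t \<in> fst b \<longleftrightarrow> fst (u t) \<in> snd c ` (fst c \<inter> fst b)" if "t \<in> I" for t
      proof
        assume "\<gamma> t \<in> fst b"
        then show "fst (u t) \<in> snd c ` (fst c \<inter> fst b)" using \<gamma>c[OF that] by (metis IntI image_eqI)
      next
        assume "fst (u t) \<in> snd c ` (fst c \<inter> fst b)"
        then show "\<gamma> t \<in> fst b" using chart_inv_chart[OF charted_inj[OF chN c'(1)]] by (auto simp: \<gamma>_def)
      qed
      then show ?thesis by auto
    qed
    moreover have "smooth_on ?J (\<lambda>t. snd b (\<gamma> t))"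
    proof (rule smooth_on_cong[OF J])
      show "smooth_on ?J (\<lambda>t. TN.MM.trans c b (fst (u t)))"
        by (rule smooth_on_compose[OF J _ smooth_on_subset[OF fu] TN.MM.trans_smooth[OF c'(1) b]]) auto
    qed (simp add: TN.MM.trans_def \<gamma>_def)
    ultimately show "open {t \<in> I. \<gamma> t \<in> fst b} \<and> smooth_on {t \<in> I. \<gamma> t \<in> fst b} (\<lambda>t. snd b (\<gamma> t))"
      using J by simp
  qed
  have vel: "cvel c \<gamma> t = snd (u t)" if t: "t \<in> I" for t
  proof -
    have "((\<lambda>t. fst (u t)) has_vector_derivative snd (u t)) (at t)"
      using bounded_linear.has_vector_derivative[OF bounded_linear_fst u[OF t]] by simp
    from vector_derivative_at[OF this] show ?thesis
      unfolding cvel_def using vector_derivative_cong_open[OF I(1) t \<gamma>c(2)] by simp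
  qed
  have acc: "cacc c \<gamma> t = accel c (u t)" if t: "t \<in> I" for t
  proof -
    have "((\<lambda>t. snd (u t)) has_vector_derivative accel c (u t)) (at t)"
      using bounded_linear.has_vector_derivative[OF bounded_linear_snd u[OF t]] by simp
    from vector_derivative_at[OF this] show ?thesis
      unfolding cacc_def using vector_derivative_cong_open[OF I(1) t vel] by simp
  qed
  have cat: "c \<in> charts_at N (\<gamma> t)" if "t \<in> I" for t using \<gamma>c[OF that] c' by (simp add: charts_at_def)
  have velocity: "velocity N \<gamma> t = TN.tinv c (u t)" if t: "t \<in> I" for t
    using TN.tinv_chart[OF TN.velocity_in[OF \<gamma> t] cat[OF t]] by (simp add: \<gamma>c t TN.velocity_snd cat vel)
  have "tangential_newton I \<gamma>"
    unfolding tangential_newton_def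
  proof (intro conjI ballI \<gamma>)
    fix t assume t: "t \<in> I"
    have "velocity N \<gamma> t \<in> Uh" using uT t by (auto simp: velocity[OF t] TN.tdom_def)
    then show V: "velocity M \<gamma> t \<in> U" using velocity_Uh[OF \<gamma> t] by simp
    fix w assume w: "w \<in> tangent_space N (\<gamma> t)"
    show "fund_tensor L (velocity M \<gamma> t) (cov \<gamma> t) (tincl M N w) =
        fund_tensor L (velocity M \<gamma> t) (F (velocity M \<gamma> t)) (tincl M N w)"
      using tangential_newton_accel[OF \<gamma> t V cat[OF t]] w by (simp add: acc[OF t] vel[OF t] \<gamma>c[OF t])
  qed
  moreover have "velocity N \<gamma> 0 = v"
    using velocity[OF I(2)] FN.U_chart(3)[OF v c] by (simp add: u0)
  ultimately show ?thesis using I(2) by blast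
qed

text \<open>The acceleration of a motion in a chart of M is the fibre part of the derivative of the
  lift along \<open>(snd q, accel c q)\<close>. The right-hand side thus depends on the velocity q
  alone, and smoothly; this gives both well-definedness and smoothness of the reaction
  force.\<close>

lemma cov_coord:
  assumes \<gamma>: "tangential_newton I \<gamma>" and t: "t \<in> I"
    and c: "c \<in> charts_at N (\<gamma> t)" and d: "d \<in> charts_at M (\<gamma> t)"
    and q: "q = (snd c (\<gamma> t), cvel c \<gamma> t)"
  shows "FM.gc d (tangent_lift (trans c d) q) (snd (cov \<gamma> t) d) w =
    1/2 * euler_lagrange (FM.Lc d) (tangent_lift (trans c d) q)
      (snd (Df (tangent_lift (trans c d)) q (snd q, accel c q))) w"
    "q \<in> TN.tdom c Uh \<inter> tdom2 c d"
proof -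
  have \<gamma>': "smooth_curve N I \<gamma>" and V: "velocity M \<gamma> t \<in> U" using \<gamma> t by (auto simp: tangential_newton_def)
  have cd: "c \<in> charts N" "d \<in> charts M" "\<gamma> t \<in> fst c" "\<gamma> t \<in> fst d" using c d by (auto simp: charts_at_def)
  note tr = curve_transition[OF \<gamma>' c d t]
  show qd: "q \<in> TN.tdom c Uh \<inter> tdom2 c d"
    using velocity_tdom(1)[OF \<gamma>' t V c] cd by (auto simp: q tdom2_def)
  have acc: "cacc c \<gamma> t = accel c q"
    using tangential_newton_accel[OF \<gamma>' t V c] \<gamma> t by (simp add: tangential_newton_def q)
  have "fst q \<in> snd c ` (fst c \<inter> fst d)" using cd by (simp add: q)
  from fun_cong[OF frechet_derivative_eqI[OF has_derivative_tangent_lift[OF transition_open[OF cd(1,2)] trans_smooth[OF cd(1,2)] this]],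
      of "(snd q, accel c q)"]
  have "snd (Df (tangent_lift (trans c d)) q (snd q, accel c q)) = cacc d \<gamma> t"
    by (simp add: tr(3) acc q)
  moreover have "tangent_lift (trans c d) q = (snd d (\<gamma> t), cvel d \<gamma> t)" by (simp add: tangent_lift_def tr q)
  ultimately show "FM.gc d (tangent_lift (trans c d) q) (snd (cov \<gamma> t) d) w =
    1/2 * euler_lagrange (FM.Lc d) (tangent_lift (trans c d) q)
      (snd (Df (tangent_lift (trans c d)) q (snd q, accel c q))) w"
    using CM.cov_deriv_euler_lagrange(2)[OF smooth_curve_inclusion[OF \<gamma>'] t V d] by simp
qed

section \<open>The reaction force\<close>

lemma cov_determined:
  assumes \<gamma>: "tangential_newton I \<gamma>" and t: "t \<in> I" and \<delta>: "tangential_newton J \<delta>" and s: "s \<in> J"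
    and eq: "velocity M \<gamma> t = velocity M \<delta> s"
  shows "cov \<gamma> t = cov \<delta> s"
proof -
  have \<gamma>': "smooth_curve N I \<gamma>" and V: "velocity M \<gamma> t \<in> U" using \<gamma> t by (auto simp: tangential_newton_def)
  have \<delta>': "smooth_curve N J \<delta>" and V': "velocity M \<delta> s \<in> U" using \<delta> s by (auto simp: tangential_newton_def)
  have vN: "velocity N \<gamma> t = velocity N \<delta> s" by (rule velocity_inj[OF \<gamma>' t \<delta>' s eq])
  have p: "\<gamma> t = \<delta> s" using vN by (metis TN.velocity_fst)
  obtain c d where c: "c \<in> charts_at N (\<gamma> t)" and d: "d \<in> charts_at M (\<gamma> t)" using curve_point[OF \<gamma>' t] by blast
  have cd: "c \<in> charts N" "d \<in> charts M" using c d by (auto simp: charts_at_def)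
  have q: "(snd c (\<gamma> t), cvel c \<gamma> t) = (snd c (\<delta> s), cvel c \<delta> s)"
    using TN.velocity_snd[of c \<gamma> t] TN.velocity_snd[of c \<delta> s] c vN p by simp
  note A = cov_coord[OF \<gamma> t c d refl]
  note B = cov_coord(1)[OF \<delta> s c[unfolded p] d[unfolded p] q]
  have "snd (cov \<gamma> t) d = snd (cov \<delta> s) d"
    by (rule FM.gc_eqI[OF cd(2) conjunct1[OF conjunct2[OF Lh_lift[OF cd A(2)]]]]) (simp only: A(1) B)
  then show ?thesis
    using TM.tangent_space_eqI[OF cov_in[OF \<gamma>' t V] _ d] cov_in[OF \<delta>' s V'] by (simp add: p)
qed

text \<open>Outside the admissible vectors tangent to N the choice, and so the value, is arbitrary.
  On them \<open>reaction_eq\<close> frees the value from the chosen motion and from the parameter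
  0.\<close>

definition reaction :: "('m, 'e) tvec \<Rightarrow> ('m, 'e) tvec" where
  "reaction V = (let \<gamma> = SOME \<gamma>. \<exists>I. tangential_newton I \<gamma> \<and> 0 \<in> I \<and> velocity M \<gamma> 0 = V
     in tadd (cov \<gamma> 0) (tscale (-1) (F V)))"

lemma reaction_eq:
  assumes \<gamma>: "tangential_newton I \<gamma>" and t: "t \<in> I"
  shows "reaction (velocity M \<gamma> t) = tadd (cov \<gamma> t) (tscale (-1) (F (velocity M \<gamma> t)))"
proof -
  let ?V = "velocity M \<gamma> t"
  have \<gamma>': "smooth_curve N I \<gamma>" and V: "?V \<in> U" using \<gamma> t by (auto simp: tangential_newton_def)
  have "velocity N \<gamma> t \<in> Uh" using velocity_Uh[OF \<gamma>' t] V by simp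
  then obtain J \<delta> where \<delta>: "tangential_newton J \<delta>" "0 \<in> J" "velocity N \<delta> 0 = velocity N \<gamma> t"
    using tangential_newton_exists by blast
  then have "velocity M \<delta> 0 = ?V"
    using tincl_velocity[of J \<delta> 0] tincl_velocity[OF \<gamma>' t] by (simp add: tangential_newton_def)
  \<comment> \<open>The motion picked by the definition. It need not be \<delta>, nor \<gamma>,
    which has the velocity in question at time t instead of 0; therefore
    \<open>cov_determined\<close> compares different curves at different times.\<close>
  define \<epsilon> where "\<epsilon> = (SOME \<gamma>. \<exists>I. tangential_newton I \<gamma> \<and> 0 \<in> I \<and> velocity M \<gamma> 0 = ?V)"
  have "\<exists>I. tangential_newton I \<epsilon> \<and> 0 \<in> I \<and> velocity M \<epsilon> 0 = ?V"
    unfolding \<epsilon>_def by (rule someI[of _ \<delta>]) (use \<delta> \<open>velocity M \<delta> 0 = ?V\<close> in blast)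
  then obtain K where "tangential_newton K \<epsilon>" "0 \<in> K" "velocity M \<epsilon> 0 = ?V" by blast
  then have "cov \<epsilon> 0 = cov \<gamma> t" by (rule cov_determined[OF _ _ \<gamma> t])
  then show ?thesis by (simp add: reaction_def \<epsilon>_def[symmetric] Let_def)
qed

lemma reaction_newton:
  assumes \<gamma>: "tangential_newton I \<gamma>" and t: "t \<in> I"
  shows "tadd (F (velocity M \<gamma> t)) (reaction (velocity M \<gamma> t)) = cov \<gamma> t"
    and "reaction (velocity M \<gamma> t) \<in> tangent_space M (\<gamma> t)"
    and "w \<in> tangent_space N (\<gamma> t) \<Longrightarrow> fund_tensor L (velocity M \<gamma> t) (reaction (velocity M \<gamma> t)) (tincl M N w) = 0"
proof -
  let ?V = "velocity M \<gamma> t"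
  have \<gamma>': "smooth_curve N I \<gamma>" and V: "?V \<in> U" using \<gamma> t by (auto simp: tangential_newton_def)
  have c: "cov \<gamma> t \<in> tangent_space M (\<gamma> t)" by (rule cov_in[OF \<gamma>' t V])
  have f: "F ?V \<in> tangent_space M (\<gamma> t)" using F_in[OF V] by simp
  show "tadd (F ?V) (reaction ?V) = cov \<gamma> t"
    unfolding reaction_eq[OF assms]
    by (rule tvec_eqI) (simp_all add: TM.tangent_space_fst[OF c] TM.tangent_space_fst[OF f])
  show "reaction ?V \<in> tangent_space M (\<gamma> t)"
    unfolding reaction_eq[OF assms] by (intro TM.tangent_space_add TM.tangent_space_scale c f)
  show "fund_tensor L ?V (reaction ?V) (tincl M N w) = 0" if w: "w \<in> tangent_space N (\<gamma> t)"
    unfolding reaction_eq[OF assms]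
    using \<gamma> t w tincl_in[OF w] c f
    by (simp add: FM.fund_tensor_add_left[OF V] FM.fund_tensor_scale_left[OF V] TM.tangent_space_scale tangential_newton_def)
qed

text \<open>Pairing Newton's equation with a vector tangent to N removes the reaction term by
  d'Alembert's principle. R is arbitrary here, since uniqueness needs the implication for a
  competing force as well.\<close>

lemma newton_solution_imp_tangential:
  assumes sol: "newton_solution M U nab F N R I \<gamma>" and al: "d_alembert M U L N R"
    and R: "\<And>v. v \<in> U \<inter> sub_tangent_vectors M N \<Longrightarrow> R v \<in> tangent_space M (fst v)"
  shows "tangential_newton I \<gamma>"
  unfolding tangential_newton_def
proof (intro conjI ballI)
  show \<gamma>: "smooth_curve N I \<gamma>" using sol by (simp add: newton_solution_def)
  fix t assume t: "t \<in> I"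
  let ?V = "velocity M \<gamma> t"
  show V: "?V \<in> U" using sol t by (simp add: newton_solution_def)
  have VN: "?V \<in> U \<inter> sub_tangent_vectors M N"
    using V TN.velocity_in[OF \<gamma> t] TN.smooth_curve_points[OF \<gamma> t] tincl_velocity[OF \<gamma> t]
    by (auto simp: sub_tangent_vectors_def sub_tangent_space_def intro!: bexI[of _ "\<gamma> t"] image_eqI[of _ _ "velocity N \<gamma> t"])
  fix w assume w: "w \<in> tangent_space N (\<gamma> t)"
  have "fund_tensor L ?V (R ?V) (tincl M N w) = 0"
    using al VN w unfolding d_alembert_def sub_tangent_space_def by simp
  moreover have "cov \<gamma> t = tadd (F ?V) (R ?V)" using sol t by (simp add: newton_solution_def)
  ultimately show "fund_tensor L ?V (cov \<gamma> t) (tincl M N w) = fund_tensor L ?V (F ?V) (tincl M N w)"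
    using R[OF VN] F_in[OF V] tincl_in[OF w] by (simp add: FM.fund_tensor_add_left[OF V])
qed

lemma sub_tangent_vector_curve:
  assumes V: "V \<in> U \<inter> sub_tangent_vectors M N"
  obtains I \<gamma> where "tangential_newton I \<gamma>" "0 \<in> I" "velocity M \<gamma> 0 = V" "\<gamma> 0 = fst V"
proof -
  obtain p v where "v \<in> tangent_space N p" and v: "V = tincl M N v"
    using V unfolding sub_tangent_vectors_def sub_tangent_space_def by blast
  then have "v \<in> tangent_vectors N" by (intro TN.tangent_space_imp_vectors)
  then have "v \<in> Uh" using V v by (simp add: induced_domain_def)
  then obtain I \<gamma> where \<gamma>: "tangential_newton I \<gamma>" "0 \<in> I" "velocity N \<gamma> 0 = v"
    using tangential_newton_exists by blast
  then have "velocity M \<gamma> 0 = V" using tincl_velocity[of I \<gamma> 0] v by (simp add: tangential_newton_def)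
  with \<gamma> show ?thesis using that by (metis TM.velocity_fst)
qed

lemma d_alembert_reaction: "d_alembert M U L N reaction"
  unfolding d_alembert_def
proof (intro ballI)
  fix V w assume V: "V \<in> U \<inter> sub_tangent_vectors M N" and "w \<in> sub_tangent_space M N (fst V)"
  then obtain w' where w: "w = tincl M N w'" "w' \<in> tangent_space N (fst V)" by (auto simp: sub_tangent_space_def)
  obtain I \<gamma> where \<gamma>: "tangential_newton I \<gamma>" "0 \<in> I" "velocity M \<gamma> 0 = V" "\<gamma> 0 = fst V"
    using sub_tangent_vector_curve[OF V] by blast
  show "fund_tensor L V (reaction V) w = 0"
    using reaction_newton(3)[OF \<gamma>(1,2), of w'] w by (simp add: \<gamma>)
qed

lemma reaction_in:
  assumes V: "V \<in> U \<inter> sub_tangent_vectors M N" shows "reaction V \<in> tangent_space M (fst V)"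
proof -
  obtain I \<gamma> where \<gamma>: "tangential_newton I \<gamma>" "0 \<in> I" "velocity M \<gamma> 0 = V" "\<gamma> 0 = fst V"
    using sub_tangent_vector_curve[OF V] by blast
  show ?thesis using reaction_newton(2)[OF \<gamma>(1,2)] by (simp add: \<gamma>)
qed

lemma newton_solution_reaction: "newton_solution M U nab F N reaction I \<gamma> \<longleftrightarrow> tangential_newton I \<gamma>"
proof
  assume "newton_solution M U nab F N reaction I \<gamma>"
  then show "tangential_newton I \<gamma>" by (rule newton_solution_imp_tangential[OF _ d_alembert_reaction reaction_in])
next
  assume \<gamma>: "tangential_newton I \<gamma>"
  then show "newton_solution M U nab F N reaction I \<gamma>"
    using reaction_newton(1)[OF \<gamma>] by (simp add: newton_solution_def tangential_newton_def)
qed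

lemma tincl_Uh: "v \<in> Uh \<Longrightarrow> tincl M N v \<in> U \<inter> sub_tangent_vectors M N"
  using Uh_D[of v] TN.tangent_space_points[of v "fst v"] by (auto simp: sub_tangent_vectors_def sub_tangent_space_def)

lemma reaction_smooth:
  "smooth_map_on (tangent_bundle N) (tangent_bundle M) Uh (reaction \<circ> tincl M N)"
proof (rule smooth_fibre_map[OF Uh_openin])
  show "(reaction \<circ> tincl M N) v \<in> tangent_space M (fst v)" if "v \<in> Uh" for v
    using reaction_in[OF tincl_Uh[OF that]] by simp
  fix c d assume c: "c \<in> charts N" and d: "d \<in> charts M"
  let ?T = "TN.tdom c Uh \<inter> tdom2 c d"
  let ?lift = "tangent_lift (trans c d)"
  have T: "open ?T" by (rule Uh_tdom_open[OF c d])
  have lift: "smooth_on ?T ?lift" by (rule smooth_on_subset[OF lift_smooth[OF c d]]) auto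
  have img: "?lift ` ?T \<subseteq> TM.tdom d U" using Lh_lift[OF c d] by blast
  have f: "smooth_on ?T (\<lambda>q. snd (F (TM.tinv d (?lift q))) d)"
    by (rule smooth_on_compose[OF T img lift TM.anisotropic_coord_smooth[OF F d]])
  \<comment> \<open>Adding F back turns the reaction force into the covariant acceleration of the
    motion through the given vector, whose pairings \<open>cov_coord\<close> computes. The smooth
    term F is subtracted again at the end.\<close>
  define A where "A q = snd (reaction (tincl M N (TN.tinv c q))) d + snd (F (TM.tinv d (?lift q))) d" for q
  \<comment> \<open>The ordinary acceleration of that motion in the chart d, as a function of its
    velocity coordinates in c.\<close>
  define Z where "Z q = snd (Df ?lift q (snd q, accel c q))" for q
  have "smooth_on ?T A"
  proof (rule FM.gc_solution_smooth[OF d T lift img])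
    have acc: "smooth_on ?T (accel c)" by (rule smooth_on_subset[OF accel_smooth[OF c]]) auto
    have "smooth_on ?T Z"
      unfolding Z_def
      by (rule smooth_on_snd[OF T smooth_on_frechet_apply[OF T lift_smooth[OF c d] smooth_on_id _
            smooth_on_Pair[OF T smooth_on_snd[OF T smooth_on_id] acc]]]) auto
    then show "smooth_on ?T (\<lambda>q. 1/2 * euler_lagrange (FM.Lc d) (?lift q) (Z q) w)" for w
      by (rule smooth_on_linear_comp[OF T bounded_linear_mult_right
            smooth_on_euler_lagrange[OF FM.tdom_U_open[OF d] FM.Lc_smooth[OF d] T lift img]])
    show "linear (\<lambda>w. 1/2 * euler_lagrange (FM.Lc d) (?lift q) (Z q) w)" if "q \<in> ?T" for q
      using linear_compose_scale_right[OF euler_lagrange_linear[OF FM.tdom_U_open[OF d] FM.Lc_smooth[OF d]], of "?lift q" "1/2" "Z q"]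
        img that by auto
    show "FM.gc d (?lift q) (A q) w = 1/2 * euler_lagrange (FM.Lc d) (?lift q) (Z q) w" if q: "q \<in> ?T" for q w
    proof -
      have v: "TN.tinv c q \<in> Uh" using q by (simp add: TN.tdom_def)
      obtain I \<gamma> where \<gamma>: "tangential_newton I \<gamma>" "0 \<in> I" "velocity N \<gamma> 0 = TN.tinv c q"
        using tangential_newton_exists[OF v] by blast
      have \<gamma>': "smooth_curve N I \<gamma>" using \<gamma> by (simp add: tangential_newton_def)
      have V: "velocity M \<gamma> 0 = tincl M N (TN.tinv c q)" using tincl_velocity[OF \<gamma>' \<gamma>(2)] \<gamma>(3) by simp
      have p: "\<gamma> 0 = chart_inv c (fst q)" using \<gamma>(3) by (metis TN.velocity_fst TN.tinv_fst)
      have ca: "c \<in> charts_at N (\<gamma> 0)" "d \<in> charts_at M (\<gamma> 0)" "fst q \<in> snd c ` fst c"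
        using tdom2_charts_at[OF c d, of q] q by (auto simp: p)
      have qeq: "q = (snd c (\<gamma> 0), cvel c \<gamma> 0)"
        using TN.velocity_snd[of c \<gamma> 0, OF ca(1)] \<gamma>(3) by (simp add: prod_eq_iff p chart_chart_inv[OF ca(3)] TN.tinv_snd[OF c ca(3)])
      have "A q = snd (tadd (F (velocity M \<gamma> 0)) (reaction (velocity M \<gamma> 0))) d"
        unfolding A_def V using tincl_tinv[OF c d, of q] q by simp
      then have "A q = snd (cov \<gamma> 0) d" by (simp only: reaction_newton(1)[OF \<gamma>(1,2)])
      then show ?thesis using cov_coord(1)[OF \<gamma>(1,2) ca(1,2) qeq] by (simp only: Z_def)
    qed
  qed
  from smooth_on_diff[OF T this f]
  show "smooth_on ?T (\<lambda>q. snd ((reaction \<circ> tincl M N) (TN.tinv c q)) d)" by (simp add: A_def)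
qed

lemma reaction_force_reaction: "reaction_force M U nab F N reaction"
  unfolding reaction_force_def newton_solution_reaction
  using reaction_smooth reaction_in sub_tangent_vector_curve by metis

text \<open>A reaction force comes with a solution through every admissible V tangent to N. Under
  d'Alembert's principle this solution satisfies the tangential equation, hence also Newton's
  equation with \<open>reaction\<close>; at time 0 the two equations share the acceleration and F,
  so the forces agree at V.\<close>

lemma reaction_unique:
  assumes R: "reaction_force M U nab F N R" and al: "d_alembert M U L N R"
    and V: "V \<in> U \<inter> sub_tangent_vectors M N"
  shows "R V = reaction V"
proof -
  have Rin: "\<And>v. v \<in> U \<inter> sub_tangent_vectors M N \<Longrightarrow> R v \<in> tangent_space M (fst v)"
    using R by (simp add: reaction_force_def)
  obtain I \<gamma> where sol: "newton_solution M U nab F N R I \<gamma>" and t: "0 \<in> I" and v: "velocity M \<gamma> 0 = V"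
    using R V unfolding reaction_force_def by blast
  have \<gamma>: "tangential_newton I \<gamma>" by (rule newton_solution_imp_tangential[OF sol al Rin])
  have "tadd (F V) (R V) = cov \<gamma> 0" using sol t v by (simp add: newton_solution_def)
  also have "\<dots> = tadd (F V) (reaction V)" using reaction_newton(1)[OF \<gamma> t] by (simp add: v)
  finally have "snd (tadd (F V) (R V)) c = snd (tadd (F V) (reaction V)) c" for c by simp
  then show ?thesis
    by (intro tvec_eqI) (simp_all add: TM.tangent_space_fst[OF Rin[OF V]] TM.tangent_space_fst[OF reaction_in[OF V]])
qed

end

theorem theorem4p15:
  fixes M :: "('m, 'e::euclidean_space) manifold"
    and N :: "('m, 'f::euclidean_space) manifold"
    and U :: "('m, 'e) tvec set"
    and L :: "('m, 'e) tvec \<Rightarrow> real"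
    and F :: "('m, 'e) tvec \<Rightarrow> ('m, 'e) tvec"
    and nab :: "('m, 'e) tvec \<Rightarrow> ('m \<Rightarrow> ('m, 'e) tvec) \<Rightarrow> ('m \<Rightarrow> ('m, 'e) tvec) \<Rightarrow> ('m, 'e) tvec"
  assumes "mechanical_system M U L F"
    and "chern_connection M U L nab"
    and "holonomic_constraint M N"
    and "conic_pseudo_finsler_submanifold M U L N"
  shows "mechanical_system N (induced_domain M N U) (induced_metric M N L) (induced_force M N L F) \<and>
    (\<exists>R. reaction_force M U nab F N R \<and> d_alembert M U L N R \<and>
      (\<forall>R'. reaction_force M U nab F N R' \<and> d_alembert M U L N R' \<longrightarrow>
        (\<forall>v\<in>U \<inter> sub_tangent_vectors M N. R' v = R v)) \<and>
      (\<forall>nab_N. chern_connection N (induced_domain M N U) (induced_metric M N L) nab_N \<longrightarrow>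
        (\<forall>I \<gamma>. newton_solution M U nab F N R I \<gamma> \<longleftrightarrow>
          motion N (induced_domain M N U) nab_N (induced_force M N L F) I \<gamma>)))"
proof -
  have mfd: "smooth_manifold M" and metric: "conic_pseudo_finsler M U L" and force: "anisotropic_vector_field M U F"
    using assms(1) by (simp_all add: mechanical_system_def)
  have submfd: "submanifold M N" using assms(3) by (simp add: holonomic_constraint_def)
  interpret inclusion M N by (rule submanifold_inclusion[OF mfd submfd])
  interpret constrained_chern M N U L F nab
  proof unfold_locales
    show "inj_on (tincl M N) (tangent_space N p)" if "p \<in> points N" for p
      using submfd that by (simp add: submanifold_def)
    show "nondegenerate_subspace U L (sub_tangent_space M N p)" if "p \<in> points N" for p
      using assms(4) that by (simp add: conic_pseudo_finsler_submanifold_def)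
  qed (rule metric force assms(2))+
  show ?thesis
  proof (intro conjI exI[of _ reaction] allI impI ballI)
    show "mechanical_system N Uh Lh Fh"
      using TN.M finsler_induced anisotropic_induced_force by (simp add: mechanical_system_def)
    show "R' v = reaction v"
      if "reaction_force M U nab F N R' \<and> d_alembert M U L N R'" "v \<in> U \<inter> sub_tangent_vectors M N" for R' v
      using reaction_unique that by blast
    show "newton_solution M U nab F N reaction I \<gamma> \<longleftrightarrow> motion N Uh nab_N Fh I \<gamma>"
      if "chern_connection N Uh Lh nab_N" for nab_N I \<gamma>
      unfolding newton_solution_reaction motion_iff[OF that] ..
  qed (rule reaction_force_reaction d_alembert_reaction)+
qed

end
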